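(* Let $K>0$, $\gamma>3$, $\alpha\ge 0$ and $\lambda\in\mathbb{R}$ with $\lambda\neq 1$. Suppose the initial data $(\tau_0,u_0)\in C^1(\mathbb{R})$ satisfy, for some positive constant $C_0$, $$|u_0(x)|\le C_0,\qquad C_0^{-1}<\tau_0(x),$$ and let $(\tau,u)$ be a $C^1$ solution of $$\tau_t-u_x=0,\qquad u_t+p_x=-\frac{\alpha}{(1+t)^{\lambda}}u,\qquad p=K\tau^{-\gamma},\qquad (\tau,u)(x,0)=(\tau_0,u_0)(x).$$ There exist two positive constants $K_5,K_6$, depending only on $C_0,\gamma,K,\lambda$ and $\alpha$, such that if there exists one point $x_0\in\mathbb{R}$ with $$u_x(x_0,0)+\phi_x(x_0,0)<K_5\,(\phi(x_0,0))^{-\frac{2}{\gamma-1}}-K_6\,(\phi(x_0,0))^{-\frac{\gamma+1}{2(\gamma-1)}}$$ or $$u_x(x_0,0)-\phi_x(x_0,0)<K_5\,(\phi(x_0,0))^{-\frac{2}{\gamma-1}}-K_6\,(\phi(x_0,0))^{-\frac{\gamma+1}{2(\gamma-1)}},$$ then $\|(\tau_x,u_x)\|_{L^\infty}$ must blow up in finite time.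
   Context: The unknowns are the specific volume $\tau(x,t)>0$ and the velocity $u(x,t)$, for $x\in\mathbb{R}$, $t\ge 0$ (one-dimensional compressible Euler equations in Lagrangian coordinates with time-dependent damping). The function $\phi$ is $$\phi(x,t)=\frac{2\sqrt{K\gamma}}{\gamma-1}\,\tau(x,t)^{-\frac{\gamma-1}{2}}>0.$$ The $L^\infty$ norm is taken in $x\in\mathbb{R}$. "Blows up in finite time" means that the $C^1$ solution has a finite maximal time of existence $T_*$ and $\|(\tau_x,u_x)(\cdot,t)\|_{L^\infty}$ does not remain bounded as $t\uparrow T_*$. *)

theory Defs
  imports "HOL-Analysis.Analysis" "HOL-Probability.Essential_Supremum"
begin

text \<open>Functions of position and time are curried, \<open>f x t\<close>.\<close>

definition strip :: "ereal \<Rightarrow> (real \<times> real) set" where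
  "strip T = {(x, t). 0 \<le> t \<and> ereal t < T}"

definition partial_x :: "(real \<Rightarrow> real \<Rightarrow> real) \<Rightarrow> real \<Rightarrow> real \<Rightarrow> real" where
  "partial_x f x t = deriv (\<lambda>y. f y t) x"

text \<open>The time derivative is the right derivative at \<open>t = 0\<close> and the ordinary one at \<open>t > 0\<close>.\<close>

definition partial_t :: "(real \<Rightarrow> real \<Rightarrow> real) \<Rightarrow> real \<Rightarrow> real \<Rightarrow> real" where
  "partial_t f x t = vector_derivative (f x) (at t within {0..})"

definition C1_on_strip :: "ereal \<Rightarrow> (real \<Rightarrow> real \<Rightarrow> real) \<Rightarrow> bool" where
  "C1_on_strip T f \<longleftrightarrow>
     (\<forall>(x, t) \<in> strip T. (\<lambda>y. f y t) differentiable (at x)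
                        \<and> f x differentiable (at t within {0..})) \<and>
     continuous_on (strip T) (\<lambda>(x, t). partial_x f x t) \<and>
     continuous_on (strip T) (\<lambda>(x, t). partial_t f x t)"

definition pressure :: "real \<Rightarrow> real \<Rightarrow> (real \<Rightarrow> real \<Rightarrow> real) \<Rightarrow> real \<Rightarrow> real \<Rightarrow> real" where
  "pressure K \<gamma> \<tau> x t = K * \<tau> x t powr (-\<gamma>)"

definition phi :: "real \<Rightarrow> real \<Rightarrow> (real \<Rightarrow> real \<Rightarrow> real) \<Rightarrow> real \<Rightarrow> real \<Rightarrow> real" where
  "phi K \<gamma> \<tau> x t = 2 * sqrt (K * \<gamma>) / (\<gamma> - 1) * \<tau> x t powr (- ((\<gamma> - 1) / 2))"

definition damped_Euler_solution ::
  "real \<Rightarrow> real \<Rightarrow> real \<Rightarrow> real \<Rightarrow> (real \<Rightarrow> real) \<Rightarrow> (real \<Rightarrow> real) \<Rightarrow> ereal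
     \<Rightarrow> (real \<Rightarrow> real \<Rightarrow> real) \<Rightarrow> (real \<Rightarrow> real \<Rightarrow> real) \<Rightarrow> bool" where
  "damped_Euler_solution K \<gamma> \<alpha> lam \<tau>0 u0 T \<tau> u \<longleftrightarrow>
     0 < T \<and> C1_on_strip T \<tau> \<and> C1_on_strip T u \<and>
     (\<forall>(x, t) \<in> strip T.
        0 < \<tau> x t \<and>
        partial_t \<tau> x t - partial_x u x t = 0 \<and>
        partial_t u x t + partial_x (pressure K \<gamma> \<tau>) x t
          = - (\<alpha> / (1 + t) powr lam) * u x t) \<and>
     (\<forall>x. \<tau> x 0 = \<tau>0 x \<and> u x 0 = u0 x)"

text \<open>Values outside the strip are irrelevant, so one pair \<open>(\<tau>', u')\<close> extends another one
  \<open>(\<tau>, u)\<close>, given on \<open>strip T\<close>, as soon as they agree there.\<close>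

definition agree_on_strip ::
  "ereal \<Rightarrow> (real \<Rightarrow> real \<Rightarrow> real) \<Rightarrow> (real \<Rightarrow> real \<Rightarrow> real)
     \<Rightarrow> (real \<Rightarrow> real \<Rightarrow> real) \<Rightarrow> (real \<Rightarrow> real \<Rightarrow> real) \<Rightarrow> bool" where
  "agree_on_strip T \<tau> u \<tau>' u' \<longleftrightarrow>
     (\<forall>(x, t) \<in> strip T. \<tau>' x t = \<tau> x t \<and> u' x t = u x t)"

definition maximal_damped_Euler_solution ::
  "real \<Rightarrow> real \<Rightarrow> real \<Rightarrow> real \<Rightarrow> (real \<Rightarrow> real) \<Rightarrow> (real \<Rightarrow> real) \<Rightarrow> ereal
     \<Rightarrow> (real \<Rightarrow> real \<Rightarrow> real) \<Rightarrow> (real \<Rightarrow> real \<Rightarrow> real) \<Rightarrow> bool" where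
  "maximal_damped_Euler_solution K \<gamma> \<alpha> lam \<tau>0 u0 T \<tau> u \<longleftrightarrow>
     damped_Euler_solution K \<gamma> \<alpha> lam \<tau>0 u0 T \<tau> u \<and>
     \<not> (\<exists>T' \<tau>' u'. T < T' \<and> damped_Euler_solution K \<gamma> \<alpha> lam \<tau>0 u0 T' \<tau>' u' \<and>
          agree_on_strip T \<tau> u \<tau>' u')"

definition gradient_Linf :: "(real \<Rightarrow> real \<Rightarrow> real) \<Rightarrow> (real \<Rightarrow> real \<Rightarrow> real) \<Rightarrow> real \<Rightarrow> ereal" where
  "gradient_Linf \<tau> u t =
     esssup lborel (\<lambda>x. ereal (norm (partial_x \<tau> x t, partial_x u x t)))"

text \<open>A \<open>C\<^sup>1\<close> solution on \<open>[0, T)\<close> blows up in finite time if its continuation \<open>(\<tau>', u')\<close> to the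
  maximal interval of existence \<open>[0, Ts)\<close> has \<open>Ts < \<infinity>\<close> and its gradient is not bounded in
  any left neighbourhood of \<open>Ts\<close>.  (Boundedness on the whole of \<open>[0, Ts)\<close> would be the wrong
  notion: it already fails if the initial gradient is unbounded.)\<close>

definition blows_up_in_finite_time ::
  "real \<Rightarrow> real \<Rightarrow> real \<Rightarrow> real \<Rightarrow> (real \<Rightarrow> real) \<Rightarrow> (real \<Rightarrow> real) \<Rightarrow> ereal
     \<Rightarrow> (real \<Rightarrow> real \<Rightarrow> real) \<Rightarrow> (real \<Rightarrow> real \<Rightarrow> real) \<Rightarrow> bool" where
  "blows_up_in_finite_time K \<gamma> \<alpha> lam \<tau>0 u0 T \<tau> u \<longleftrightarrow>
     (\<exists>(Ts::real) \<tau>' u'.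
        T \<le> ereal Ts \<and> agree_on_strip T \<tau> u \<tau>' u' \<and>
        maximal_damped_Euler_solution K \<gamma> \<alpha> lam \<tau>0 u0 (ereal Ts) \<tau>' u' \<and>
        \<not> (\<exists>M::real. \<forall>\<^sub>F t in at_left Ts. gradient_Linf \<tau>' u' t \<le> ereal M))"

end

theory Submission
  imports Defs
begin

text \<open>
  The Riemann invariants \<open>w = u + \<phi>\<close> and \<open>z = u - \<phi>\<close> diagonalize the system:
  \<open>w\<^sub>t + c w\<^sub>x = - a u\<close> and \<open>z\<^sub>t - c z\<^sub>x = - a u\<close>, where \<open>a(t) = \<alpha> / (1 + t)\<^bsup>\<lambda>\<^esup>\<close> and the speed of
  sound is \<open>c = \<kappa> \<phi>\<^bsup>m\<^esup>\<close> with \<open>m = (\<gamma> + 1) / (\<gamma> - 1)\<close>.  The hypothesis \<open>\<gamma> > 3\<close> says \<open>1 < m < 2\<close>.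

  \<^emph>\<open>Every solution is short-lived.\<close>  As damping only contracts, \<open>\<bar>w\<bar>\<close> and \<open>\<bar>z\<bar>\<close> never exceed their
  initial bound \<open>N\<close>, which depends on \<open>C\<^sub>0\<close>, \<open>K\<close>, \<open>\<gamma>\<close> only (\<open>riemann_bound\<close>); hence \<open>0 < \<phi> \<le> N\<close>.
  Along a characteristic of the family of \<open>w\<close> the quantity
  \<open>Y = \<surd>c w\<^sub>x - (a/2) G(\<phi>)\<close>, with \<open>G' = 1 / \<surd>c\<close>, satisfies
  \<open>Y' = - (a/2) Q - b Q\<^sup>2 - (a'/2) G\<close>, where \<open>Q = \<surd>c w\<^sub>x\<close> and \<open>b = c' / (2 \<surd>c)\<close>: the factor \<open>\<surd>c\<close> and
  the correction \<open>G\<close> absorb every occurrence of \<open>z\<^sub>x\<close>, since \<open>- c z\<^sub>x\<close> is the derivative of \<open>\<phi>\<close> along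
  the characteristic.  For \<open>m < 2\<close> the function \<open>G\<close> is bounded on \<open>(0, N]\<close>, and \<open>b\<close> is bounded below
  there by a positive constant although \<open>\<phi>\<close> may be arbitrarily small.  So once \<open>Y\<close> is very negative
  the quadratic term wins, and \<open>Y\<close> would reach \<open>-\<infinity>\<close> before time \<open>1/2\<close> (\<open>gradient_catastrophe\<close>).  On
  so short a time interval \<open>a\<close> and \<open>a'\<close> are bounded.  Choosing \<open>K\<^sub>5 = 1\<close> and \<open>K\<^sub>6\<close>
  large turns the hypothesis on the initial gradient into the negativity that is required.  The
  gradient of \<open>z\<close> obeys the same equation along its own characteristics, which settles the other
  alternative.

  \<^emph>\<open>A solution ends only by losing its gradient bound.\<close>  Any two solutions with the same data agree
  (\<open>solutions_agree\<close>), so all of them patch together to one on \<open>[0, Ts)\<close>, where \<open>Ts\<close> is the supremum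
  of all life spans; it is maximal.  If its gradient stayed bounded near \<open>Ts\<close>, the system could be
  solved anew from a time just before \<open>Ts\<close>.  The life span of that new solution depends only on
  bounds of the data and of their derivatives, hence passes \<open>Ts\<close>; gluing contradicts maximality
  (\<open>bounded_gradient_extends\<close>).

  This needs a local existence theorem for the diagonal system with \<open>C\<^sup>1\<close> data (\<open>local_solution\<close>).
  The invariants are found by a contraction in the uniform norm on functions with a fixed Lipschitz
  bound.  That such a Lipschitz solution is differentiable follows from comparing two difference
  quotients with increments \<open>h\<close> and \<open>k\<close> along a common characteristic: both satisfy the same closed
  equation up to a small error, so on a short time interval their distance is at most half of
  itself plus a quantity that vanishes with \<open>h\<close> and \<open>k\<close>.

  Bounds, uniqueness and the barriers for differential inequalities all come from one argument,
  \<open>cone_comparison\<close>: at the first time at which a function could become nonnegative in a backward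
  cone, it cannot be decreasing along a direction that enters from the interior of the cone.  Since
  the cone is compact, nothing has to be assumed about the solutions at infinity.
\<close>


section \<open>Comparison in cones and ordinary differential equations\<close>

text \<open>Consider the first time at which some \<open>G i\<close> fails to be negative in the cone.  A direction of slope
  at most \<open>Lam\<close>, followed backwards from that point, stays in the cone, where \<open>G i\<close> is still
  negative; so \<open>G i\<close> is zero at the point, and its derivative in that direction cannot be negative.
  With \<open>Lam = 0\<close> and \<open>R = 0\<close> this is the barrier argument for functions of time alone.\<close>

lemma cone_comparison:
  fixes G :: "'i \<Rightarrow> real \<Rightarrow> real \<Rightarrow> real"
  assumes I: "finite I" and Lam: "0 \<le> Lam"
    and cont: "\<And>i. i \<in> I \<Longrightarrow>
      continuous_on {(x, t). 0 \<le> t \<and> t \<le> S \<and> \<bar>x\<bar> + Lam * t \<le> R} (\<lambda>(x, t). G i x t)"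
    and init: "\<And>i x. i \<in> I \<Longrightarrow> \<bar>x\<bar> \<le> R \<Longrightarrow> G i x 0 < 0"
    and cross: "\<And>i x t. i \<in> I \<Longrightarrow> 0 < t \<Longrightarrow> t \<le> S \<Longrightarrow> \<bar>x\<bar> + Lam * t \<le> R \<Longrightarrow> G i x t = 0 \<Longrightarrow>
        (\<And>j. j \<in> I \<Longrightarrow> G j x t \<le> 0) \<Longrightarrow>
        \<exists>c d. \<bar>c\<bar> \<le> Lam \<and> d < 0 \<and>
          ((\<lambda>s. G i (x + c * s) (t + s)) has_real_derivative d) (at_left 0)"
    and i: "i \<in> I" and t: "0 \<le> t" "t \<le> S" and x: "\<bar>x\<bar> + Lam * t \<le> R"
  shows "G i x t < 0"
proof (rule ccontr)
  assume neg: "\<not> G i x t < 0"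
  define K where "K = {(x, t). 0 \<le> t \<and> t \<le> S \<and> \<bar>x\<bar> + Lam * t \<le> R}"
  have "closed K"
    unfolding K_def case_prod_beta
    by (intro closed_Collect_conj closed_Collect_le continuous_intros)
  moreover have "K \<subseteq> {-R..R} \<times> {0..S}"
  proof
    fix p assume "p \<in> K"
    then obtain x t where p: "p = (x, t)" "0 \<le> t" "t \<le> S" "\<bar>x\<bar> + Lam * t \<le> R"
      by (auto simp: K_def)
    moreover have "0 \<le> Lam * t" using p Lam by simp
    ultimately show "p \<in> {-R..R} \<times> {0..S}" by auto
  qed
  then have "bounded K"
    by (rule bounded_subset[rotated]) (intro bounded_Times; simp)
  ultimately have K: "compact K" by (simp add: compact_eq_bounded_closed)
  \<comment> \<open>the points where negativity fails; \<open>p\<close> below is one with the least time\<close>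
  define B where "B = (\<Union>i\<in>I. {p \<in> K. 0 \<le> (\<lambda>(x, t). G i x t) p})"
  have "compact {p \<in> K. 0 \<le> (\<lambda>(x, t). G i x t) p}" if "i \<in> I" for i
  proof -
    have "closed {p \<in> K. 0 \<le> (\<lambda>(x, t). G i x t) p}"
      using cont[OF that] \<open>closed K\<close> unfolding K_def[symmetric]
      by (intro continuous_on_closed_Collect_le continuous_on_const) auto
    then have "compact (K \<inter> {p \<in> K. 0 \<le> (\<lambda>(x, t). G i x t) p})"
      using K by (rule compact_Int_closed[rotated])
    then show ?thesis by (simp add: Int_def)
  qed
  then have "compact B"
    unfolding B_def using I by (intro compact_UN) auto
  moreover have "(x, t) \<in> B"
    unfolding B_def K_def using neg i t x by (intro UN_I[OF i]) auto
  then have "B \<noteq> {}" by blast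
  moreover have "continuous_on B snd" by (intro continuous_intros)
  ultimately obtain p where p: "p \<in> B" "\<forall>q\<in>B. snd p \<le> snd q"
    using continuous_attains_inf[of B snd] by metis
  obtain x1 t1 where p_eq: "p = (x1, t1)" by (cases p)
  with p(1) obtain j where j: "j \<in> I" "(x1, t1) \<in> K" "0 \<le> G j x1 t1"
    unfolding B_def by auto
  have early: "G l y s < 0" if "l \<in> I" "(y, s) \<in> K" "s < t1" for l y s
  proof (rule ccontr)
    assume "\<not> ?thesis"
    then have "(y, s) \<in> B" unfolding B_def using that by (intro UN_I[of l]) auto
    with p(2) p_eq that show False by force
  qed
  have K1: "0 \<le> t1" "t1 \<le> S" "\<bar>x1\<bar> + Lam * t1 \<le> R" using j by (auto simp: K_def)
  have "t1 \<noteq> 0" using init[of j x1] j K1 by auto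
  then have t1: "0 < t1" using K1 by simp
  have go_back: "(x1 + c * s, t1 + s) \<in> K" if "\<bar>c\<bar> \<le> Lam" "-t1 < s" "s < 0" for c s
  proof -
    have "\<bar>c * s\<bar> \<le> Lam * (- s)" using that by (simp add: abs_mult mult_right_mono)
    then have "\<bar>x1 + c * s\<bar> \<le> \<bar>x1\<bar> - Lam * s" by linarith
    then show ?thesis using K1 that by (auto simp: K_def algebra_simps)
  qed
  have ev: "\<forall>\<^sub>F s in at_left (0::real). -t1 < s \<and> s < 0"
    using t1 by (auto simp: eventually_at_left_field intro!: exI[of _ "-t1"])
  have le0: "G l x1 t1 \<le> 0" if "l \<in> I" for l
  proof -
    have "((\<lambda>s. (x1, t1 + s)) \<longlongrightarrow> (x1, t1 + 0)) (at_left 0)"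
      by (intro tendsto_intros)
    then have "filterlim (\<lambda>s. (x1, t1 + s)) (at (x1, t1) within K) (at_left 0)"
      using go_back[of 0] Lam by (auto simp: filterlim_at intro!: eventually_mono[OF ev])
    moreover have "((\<lambda>(x, t). G l x t) \<longlongrightarrow> G l x1 t1) (at (x1, t1) within K)"
      using cont[OF that] j unfolding K_def[symmetric] by (auto simp: continuous_on_def)
    ultimately have "((\<lambda>s. (\<lambda>(x, t). G l x t) (x1, t1 + s)) \<longlongrightarrow> G l x1 t1) (at_left 0)"
      by (rule filterlim_compose[rotated])
    then show ?thesis
      by (rule tendsto_upperbound)
        (use go_back[of 0] Lam early[OF that] in \<open>auto intro!: eventually_mono[OF ev] less_imp_le\<close>)
  qed
  then have "G j x1 t1 = 0" using j by force
  with cross[OF j(1) t1 K1(2,3) this le0] obtain c d where c: "\<bar>c\<bar> \<le> Lam" "d < 0"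
    and der: "((\<lambda>s. G j (x1 + c * s) (t1 + s)) has_real_derivative d) (at_left 0)" by blast
  from der have "((\<lambda>s. G j (x1 + c * s) (t1 + s) / s) \<longlongrightarrow> d) (at_left 0)"
    using \<open>G j x1 t1 = 0\<close> by (simp add: has_field_derivative_iff)
  then have "0 \<le> d"
    by (rule tendsto_lowerbound)
      (auto intro!: eventually_mono[OF ev] divide_neg_neg less_imp_le[of 0] early[OF j(1) go_back] c)
  with c show False by simp
qed

lemma DERIV_chain_within:
  assumes "(g has_field_derivative d) (at (f x) within T)"
    and "(f has_field_derivative e) (at x within S)" and "f ` S \<subseteq> T"
  shows "((\<lambda>x. g (f x)) has_field_derivative d * e) (at x within S)"
  using DERIV_image_chain[OF has_field_derivative_subset[OF assms(1,3)] assms(2)]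
  by (simp add: o_def)

text \<open>A barrier argument with the strict barrier
  \<open>(\<bar>y a\<bar> + r + (e + r) s) exp (B s)\<close> for \<open>\<bar>y\<bar>\<close>, followed by \<open>r \<rightarrow> 0\<close>.\<close>

lemma gronwall_forward:
  fixes y y' :: "real \<Rightarrow> real"
  assumes der: "\<And>s. s \<in> {a..b} \<Longrightarrow> (y has_real_derivative y' s) (at s within {a..b})"
    and bd: "\<And>s. s \<in> {a..b} \<Longrightarrow> \<bar>y' s\<bar> \<le> B * \<bar>y s\<bar> + e"
    and B: "0 \<le> B" and e: "0 \<le> e" and t: "a \<le> t" "t \<le> b"
  shows "\<bar>y t\<bar> \<le> (\<bar>y a\<bar> + e * (t - a)) * exp (B * (t - a))"
proof -
  have main: "\<bar>y t\<bar> \<le> (\<bar>y a\<bar> + r + (e + r) * (t - a)) * exp (B * (t - a))" if r: "0 < r" for r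
  proof -
    define g where "g s = (\<bar>y a\<bar> + r + (e + r) * s) * exp (B * s)" for s
    define G where "G i x s = i * y (a + s) - g s" for i x s :: real
    have g': "(g has_real_derivative B * g s + (e + r) * exp (B * s)) (at s within X)" for s X
      unfolding g_def by (auto intro!: derivative_eq_intros simp: algebra_simps)
    have yc: "continuous_on {a..b} y"
      by (rule DERIV_continuous_on[OF der])
    have "G i 0 (t - a) < 0" if i: "i \<in> {1, -1}" for i
    proof (rule cone_comparison[where G = G and I = "{1, -1::real}" and Lam = 0 and R = 0 and S = "b - a"])
      fix i :: real assume i: "i \<in> {1, -1}"
      have "continuous_on {(x, t). 0 \<le> t \<and> t \<le> b - a \<and> \<bar>x\<bar> + 0 * t \<le> (0::real)} (\<lambda>p. y (a + snd p))"
        by (rule continuous_on_compose2[OF yc]) (auto intro!: continuous_intros)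
      then show "continuous_on {(x, t). 0 \<le> t \<and> t \<le> b - a \<and> \<bar>x\<bar> + 0 * t \<le> (0::real)} (\<lambda>(x, t). G i x t)"
        unfolding G_def g_def case_prod_beta by (intro continuous_intros)
    next
      fix i x :: real assume "i \<in> {1, -1}"
      then show "G i x 0 < 0" using r by (auto simp: G_def g_def)
    next
      fix i x s :: real
      assume i: "i \<in> {1, -1}" and s: "0 < s" "s \<le> b - a" and G0: "G i x s = 0"
      have "(y has_real_derivative y' (a + s)) (at (a + s) within {a..b})"
        using der[of "a + s"] s by simp
      then have "(y has_real_derivative y' (a + s)) (at (a + s) within {a..a + s})"
        by (rule has_field_derivative_subset) (use s in auto)
      then have "(y has_real_derivative y' (a + s)) (at_left (a + s))"
        using s by (simp add: at_within_Icc_at_left)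
      moreover have "((\<lambda>r. a + s + r) has_real_derivative 1) (at_left 0)"
        by (auto intro!: derivative_eq_intros)
      moreover have "(\<lambda>r. a + s + r) ` {..<0} \<subseteq> {..<a + s}" by auto
      ultimately have y': "((\<lambda>r. y (a + s + r)) has_real_derivative y' (a + s)) (at_left 0)"
        using DERIV_chain_within[of y "y' (a+s)" "\<lambda>r. a + s + r" 0 "{..<a+s}" 1 "{..<0}"]
        by simp
      have gg: "((\<lambda>r. g (s + r)) has_real_derivative B * g s + (e + r) * exp (B * s)) (at_left 0)"
      proof -
        have "((\<lambda>r. s + r) has_real_derivative 1) (at_left 0)"
          by (auto intro!: derivative_eq_intros)
        from DERIV_chain_within[OF g'[where X = UNIV] this] show ?thesis by simp
      qed
      have "((\<lambda>r. G i (x + 0 * r) (s + r)) has_real_derivative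
           i * y' (a + s) - (B * g s + (e + r) * exp (B * s))) (at_left 0)"
        unfolding G_def using DERIV_cmult[OF y', of i] gg
        by (intro DERIV_diff) (auto simp: add.assoc)
      moreover have "i * y' (a + s) - (B * g s + (e + r) * exp (B * s)) < 0"
      proof -
        have "\<bar>y (a + s)\<bar> = g s"
        proof -
          have "0 \<le> g s" unfolding g_def using r e s by (intro mult_nonneg_nonneg add_nonneg_nonneg) auto
          then show ?thesis using G0 i by (auto simp: G_def)
        qed
        then have "\<bar>y' (a + s)\<bar> \<le> B * g s + e" using bd[of "a + s"] s by simp
        moreover have "i * y' (a + s) \<le> \<bar>y' (a + s)\<bar>" using i by auto
        moreover have "e + r \<le> (e + r) * exp (B * s)"
          using e r B s by (intro mult_le_cancel_left1[THEN iffD2]) auto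
        ultimately show ?thesis using r by linarith
      qed
      ultimately show "\<exists>c d. \<bar>c\<bar> \<le> 0 \<and> d < 0 \<and>
          ((\<lambda>r. G i (x + c * r) (s + r)) has_real_derivative d) (at_left 0)"
        by (intro exI[of _ 0] exI) auto
    qed (use i t in auto)
    from this[of 1] this[of "-1"] show ?thesis by (auto simp: G_def g_def)
  qed
  have "((\<lambda>r. (\<bar>y a\<bar> + r + (e + r) * (t - a)) * exp (B * (t - a))) \<longlongrightarrow>
      (\<bar>y a\<bar> + 0 + (e + 0) * (t - a)) * exp (B * (t - a))) (at_right 0)"
    by (intro tendsto_intros)
  then have "\<bar>y t\<bar> \<le> (\<bar>y a\<bar> + 0 + (e + 0) * (t - a)) * exp (B * (t - a))"
    by (rule tendsto_lowerbound) (use main in \<open>auto simp: eventually_at_right_field intro!: exI[of _ 1]\<close>)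
  then show ?thesis by simp
qed

lemma has_real_derivative_reflect:
  assumes "(y has_real_derivative d) (at (c - s) within {a..b})"
  shows "((\<lambda>s. y (c - s)) has_real_derivative - d) (at s within {c - b..c - a})"
proof -
  have "((\<lambda>s. c - s) has_real_derivative - 1) (at s within {c - b..c - a})"
    by (auto intro!: derivative_eq_intros)
  moreover have "(\<lambda>s. c - s) ` {c - b..c - a} \<subseteq> {a..b}" by auto
  ultimately show ?thesis
    using DERIV_chain_within[of y d "\<lambda>s. c - s" s "{a..b}" "-1" "{c - b..c - a}"] assms
    by simp
qed

lemma gronwall_backward:
  fixes y y' :: "real \<Rightarrow> real"
  assumes der: "\<And>s. s \<in> {a..b} \<Longrightarrow> (y has_real_derivative y' s) (at s within {a..b})"
    and bd: "\<And>s. s \<in> {a..b} \<Longrightarrow> \<bar>y' s\<bar> \<le> B * \<bar>y s\<bar> + e"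
    and B: "0 \<le> B" and e: "0 \<le> e" and t: "a \<le> t" "t \<le> b"
  shows "\<bar>y t\<bar> \<le> (\<bar>y b\<bar> + e * (b - t)) * exp (B * (b - t))"
proof -
  have "\<bar>y (0 - (- t))\<bar> \<le> (\<bar>y (0 - (- b))\<bar> + e * (- t - - b)) * exp (B * (- t - - b))"
  proof (rule gronwall_forward[where b = "- a" and y = "\<lambda>s. y (0 - s)" and y' = "\<lambda>s. - y' (- s)"])
    fix s assume "s \<in> {- b..- a}"
    then show "((\<lambda>s. y (0 - s)) has_real_derivative - y' (- s)) (at s within {- b..- a})"
      using has_real_derivative_reflect[of y "y' (-s)" 0 s a b] der[of "- s"] by auto
  qed (use bd B e t in \<open>auto\<close>)
  then show ?thesis by (simp add: add.commute)
qed

text \<open>Picard iteration, in the norm weighted by \<open>exp (- 2 C s)\<close>: there the integral operator is a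
  contraction with factor \<open>1/2\<close> on an interval of any length.  The unknown is the displacement
  \<open>V = exp (- 2 C s) (y - x0)\<close>.\<close>

lemma ode_forward:
  fixes b :: "real \<Rightarrow> real \<Rightarrow> real"
  assumes cont: "continuous_on UNIV (\<lambda>(x, t). b x t)"
    and lip: "\<And>x y t. \<bar>b x t - b y t\<bar> \<le> B * \<bar>x - y\<bar>"
    and S: "0 \<le> S"
  shows "\<exists>y. y a = x0 \<and> (\<forall>s\<in>{a..a + S}. (y has_real_derivative b (y s) s) (at s within {a..a + S}))"
proof -
  define C where "C = \<bar>B\<bar> + 1"
  have C: "0 < C" by (simp add: C_def)
  have lipC: "\<bar>b x t - b y t\<bar> \<le> C * \<bar>x - y\<bar>" for x y t
    using order_trans[OF lip[of x t y] mult_right_mono[of B C "\<bar>x - y\<bar>"]] by (simp add: C_def)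
  have bc: "continuous_on X (\<lambda>r. b (f r) (g r))" if "continuous_on X f" "continuous_on X g" for X :: "real set" and f g
    using continuous_on_compose2[OF cont, of X "\<lambda>r. (f r, g r)"] that by (auto intro: continuous_intros)
  define cl where "cl s = max 0 (min s S)" for s
  have cl: "0 \<le> cl s" "cl s \<le> S" for s using S by (auto simp: cl_def)
  define h where "h V s = integral {0..s} (\<lambda>r. b (x0 + exp (2 * C * r) * apply_bcontfun V r) (a + r))"
    for V :: "real \<Rightarrow>\<^sub>C real" and s
  have ic: "continuous_on X (\<lambda>r. b (x0 + exp (2 * C * r) * apply_bcontfun V r) (a + r))" for X V
    by (intro bc continuous_intros) auto
  have hd: "(h V has_real_derivative b (x0 + exp (2 * C * s) * apply_bcontfun V s) (a + s)) (at s within {0..S})"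
    if "s \<in> {0..S}" for V s
    unfolding h_def using integral_has_real_derivative[OF ic that] .
  have hc: "continuous_on {0..S} (h V)" for V
    by (rule DERIV_continuous_on[OF hd])
  define Psi where "Psi V = Bcontfun (\<lambda>s. exp (- 2 * C * cl s) * h V (cl s))" for V
  have mem: "(\<lambda>s. exp (- 2 * C * cl s) * h V (cl s)) \<in> bcontfun" for V
  proof -
    have c0: "continuous_on {0..S} (\<lambda>s. exp (- 2 * C * s) * h V s)"
      by (intro continuous_intros hc)
    have "continuous_on UNIV (\<lambda>s. exp (- 2 * C * cl s) * h V (cl s))"
      by (rule continuous_on_compose2[OF c0, of UNIV cl]) (use cl in \<open>auto simp: cl_def intro!: continuous_intros\<close>)
    moreover have "bounded ((\<lambda>s. exp (- 2 * C * s) * h V s) ` {0..S})"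
      by (intro compact_imp_bounded compact_continuous_image c0) simp
    then have "bounded (range (\<lambda>s. exp (- 2 * C * cl s) * h V (cl s)))"
      by (rule bounded_subset) (use cl in auto)
    ultimately show ?thesis by (simp add: bcontfun_def)
  qed
  have Psi: "apply_bcontfun (Psi V) s = exp (- 2 * C * cl s) * h V (cl s)" for V s
    unfolding Psi_def using mem by (simp add: Bcontfun_inverse)
  have contr: "dist (Psi V) (Psi W) \<le> 1/2 * dist V W" for V W
  proof (rule dist_bound)
    fix s
    define d where "d = dist V W"
    have "\<bar>h V (cl s) - h W (cl s)\<bar> =
      norm (integral {0..cl s} (\<lambda>r. b (x0 + exp (2 * C * r) * apply_bcontfun V r) (a + r)
           - b (x0 + exp (2 * C * r) * apply_bcontfun W r) (a + r)))"
      unfolding h_def by (subst integral_diff) (auto intro!: integrable_continuous_interval ic)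
    also have "\<dots> \<le> integral {0..cl s} (\<lambda>r. C * exp (2 * C * r) * d)"
    proof (rule integral_norm_bound_integral)
      fix r
      have "\<bar>b (x0 + exp (2 * C * r) * apply_bcontfun V r) (a + r) - b (x0 + exp (2 * C * r) * apply_bcontfun W r) (a + r)\<bar>
        \<le> C * \<bar>exp (2 * C * r) * (apply_bcontfun V r - apply_bcontfun W r)\<bar>"
        using lipC[of "x0 + exp (2 * C * r) * apply_bcontfun V r" "a + r" "x0 + exp (2 * C * r) * apply_bcontfun W r"]
        by (simp add: algebra_simps)
      also have "\<dots> \<le> C * (exp (2 * C * r) * d)"
        using C dist_bounded[of V r W] unfolding d_def
        by (intro mult_left_mono) (auto simp: abs_mult dist_real_def)
      finally show "norm (b (x0 + exp (2 * C * r) * apply_bcontfun V r) (a + r)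
           - b (x0 + exp (2 * C * r) * apply_bcontfun W r) (a + r)) \<le> C * exp (2 * C * r) * d"
        by simp
    qed (auto intro!: integrable_continuous_interval continuous_intros ic)
    also have "\<dots> = d/2 * exp (2 * C * cl s) - d/2 * exp (2 * C * 0)"
      by (intro integral_unique fundamental_theorem_of_calculus cl)
        (auto intro!: derivative_eq_intros simp: has_real_derivative_iff_has_vector_derivative[symmetric])
    also have "\<dots> \<le> d/2 * exp (2 * C * cl s)" by (simp add: d_def)
    finally have "exp (- 2 * C * cl s) * \<bar>h V (cl s) - h W (cl s)\<bar> \<le> exp (- 2 * C * cl s) * (d/2 * exp (2 * C * cl s))"
      by (intro mult_left_mono) auto
    also have "\<dots> = d / 2" by (simp add: exp_minus field_simps)
    finally show "dist (apply_bcontfun (Psi V) s) (apply_bcontfun (Psi W) s) \<le> 1/2 * dist V W"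
      by (simp add: Psi dist_real_def d_def abs_mult flip: right_diff_distrib)
  qed
  then obtain V where V: "Psi V = V"
    using banach_fix_type[of "1/2" Psi] by auto
  define y where "y s = x0 + h V (s - a)" for s
  have yV: "y s = x0 + exp (2 * C * (s - a)) * apply_bcontfun V (s - a)" if "s \<in> {a..a + S}" for s
    using arg_cong[OF V, of "\<lambda>V. apply_bcontfun V (s - a)"] that
    by (auto simp: Psi y_def cl_def exp_minus field_simps)
  have "(y has_real_derivative b (y s) s) (at s within {a..a + S})" if s: "s \<in> {a..a + S}" for s
  proof -
    have 1: "((\<lambda>s. s - a) has_real_derivative 1) (at s within {a..a + S})"
      by (auto intro!: derivative_eq_intros)
    have 2: "(\<lambda>s. s - a) ` {a..a + S} \<subseteq> {0..S}" by auto
    have "(h V has_real_derivative b (y s) s) (at (s - a) within {0..S})"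
      using hd[of "s - a" V] s yV[OF s] by auto
    from DERIV_add[OF DERIV_const[of x0] DERIV_chain_within[OF this 1 2]] show ?thesis
      by (simp add: y_def[abs_def])
  qed
  moreover have "y a = x0" by (simp add: y_def h_def)
  ultimately show ?thesis by blast
qed

lemma ode_backward:
  fixes b :: "real \<Rightarrow> real \<Rightarrow> real"
  assumes cont: "continuous_on UNIV (\<lambda>(x, t). b x t)"
    and lip: "\<And>x y t. \<bar>b x t - b y t\<bar> \<le> B * \<bar>x - y\<bar>"
    and S: "0 \<le> t"
  shows "\<exists>y. y t = x0 \<and> (\<forall>s\<in>{0..t}. (y has_real_derivative b (y s) s) (at s within {0..t}))"
proof -
  have "continuous_on UNIV (\<lambda>(x, s). - b x (t - s))"
    using continuous_on_minus[OF continuous_on_compose2[OF cont, of UNIV "\<lambda>p. (fst p, t - snd p)"]]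
    by (simp add: case_prod_beta continuous_on_Pair continuous_on_fst continuous_on_snd continuous_on_diff)
  moreover have "\<bar>- b x (t - s) - - b y (t - s)\<bar> \<le> B * \<bar>x - y\<bar>" for x y s
    using lip[of y "t - s" x] by (simp add: abs_minus_commute)
  ultimately obtain y where y: "y 0 = x0"
    "\<And>s. s \<in> {0..0 + t} \<Longrightarrow> (y has_real_derivative - b (y s) (t - s)) (at s within {0..0 + t})"
    using ode_forward[of "\<lambda>x s. - b x (t - s)" B t 0 x0] S by metis
  have "((\<lambda>s. y (t - s)) has_real_derivative b (y (t - s)) s) (at s within {0..t})" if "s \<in> {0..t}" for s
    using has_real_derivative_reflect[of y "- b (y (t - s)) s" t s 0 t] y(2)[of "t - s"] that by auto
  then show ?thesis using y(1) by (intro exI[of _ "\<lambda>s. y (t - s)"]) auto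
qed


section \<open>Transport along characteristics\<close>

definition characteristic :: "(real \<Rightarrow> real \<Rightarrow> real) \<Rightarrow> real \<Rightarrow> (real \<Rightarrow> real) \<Rightarrow> bool" where
  "characteristic b t y \<longleftrightarrow>
     (\<forall>s\<in>{0..t}. (y has_real_derivative b (y s) s) (at s within {0..t}))"

text \<open>The transport equation \<open>g\<^sub>t + b g\<^sub>x = f\<close> in a form that makes sense for functions that are not
  differentiable: only the derivative along the characteristics is required to exist.\<close>

definition transported ::
  "(real \<Rightarrow> real \<Rightarrow> real) \<Rightarrow> (real \<Rightarrow> real \<Rightarrow> real) \<Rightarrow> (real \<Rightarrow> real) \<Rightarrow> real \<Rightarrow> (real \<Rightarrow> real \<Rightarrow> real) \<Rightarrow> bool"
where
  "transported b f g0 d g \<longleftrightarrow>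
     (\<forall>x. g x 0 = g0 x) \<and>
     (\<forall>t y. 0 \<le> t \<longrightarrow> t \<le> d \<longrightarrow> characteristic b t y \<longrightarrow>
        (\<forall>s\<in>{0..t}. ((\<lambda>s. g (y s) s) has_real_derivative f (y s) s) (at s within {0..t})))"

lemma characteristic_restrict:
  "characteristic b t y \<Longrightarrow> s \<le> t \<Longrightarrow> characteristic b s y"
  unfolding characteristic_def
  by (intro ballI has_field_derivative_subset[of y _ _ "{0..t}" "{0..s}"]) auto

lemma characteristic_continuous: "characteristic b t y \<Longrightarrow> continuous_on {0..t} y"
  unfolding characteristic_def by (intro DERIV_continuous_on) auto

lemma continuous_on_compose_curried:
  assumes "continuous_on UNIV (\<lambda>(x, t). b x t)" "continuous_on X f" "continuous_on X g"
  shows "continuous_on X (\<lambda>r. b (f r) (g r :: real) :: real)"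
  using continuous_on_compose2[OF assms(1) continuous_on_Pair[OF assms(2,3)]] by simp

lemma characteristic_perturbation:
  assumes y: "characteristic b t y" and z: "characteristic b2 t z"
    and lip: "\<And>x y s. \<bar>b x s - b y s\<bar> \<le> B * \<bar>x - y\<bar>"
    and diff: "\<And>x s. \<bar>b x s - b2 x s\<bar> \<le> e"
    and "0 \<le> B" "0 \<le> e" "0 \<le> s" "s \<le> t"
  shows "\<bar>y s - z s\<bar> \<le> (\<bar>y t - z t\<bar> + e * (t - s)) * exp (B * (t - s))"
proof (rule gronwall_backward[where a = 0 and y = "\<lambda>s. y s - z s" and y' = "\<lambda>s. b (y s) s - b2 (z s) s"])
  fix r assume r: "r \<in> {0..t}"
  show "((\<lambda>s. y s - z s) has_real_derivative b (y r) r - b2 (z r) r) (at r within {0..t})"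
    using y z r unfolding characteristic_def by (intro DERIV_diff) auto
  show "\<bar>b (y r) r - b2 (z r) r\<bar> \<le> B * \<bar>y r - z r\<bar> + e"
    using lip[of "y r" r "z r"] diff[of "z r" r] by linarith
qed (use assms in auto)

lemma bounded_increment:
  fixes h h' :: "real \<Rightarrow> real"
  assumes "\<And>s. s \<in> {a..b} \<Longrightarrow> (h has_real_derivative h' s) (at s within {a..b})"
    and "\<And>s. s \<in> {a..b} \<Longrightarrow> \<bar>h' s\<bar> \<le> e" and "a \<le> b"
  shows "\<bar>h b - h a\<bar> \<le> e * (b - a)"
proof -
  have "0 \<le> e" using assms(2)[of a] assms(3) by auto
  have "\<bar>h b - h a\<bar> \<le> (\<bar>h a - h a\<bar> + e * (b - a)) * exp (0 * (b - a))"
    by (rule gronwall_forward[where y = "\<lambda>s. h s - h a" and y' = h' and b = b])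
      (use assms \<open>0 \<le> e\<close> in \<open>auto intro!: derivative_eq_intros\<close>)
  then show ?thesis by simp
qed

locale transport_equation =
  fixes b f :: "real \<Rightarrow> real \<Rightarrow> real" and g0 :: "real \<Rightarrow> real" and B F F1 G G0 Lam d E :: real
  assumes b_cont: "continuous_on UNIV (\<lambda>(x, t). b x t)"
    and b_lip: "\<And>x y t. \<bar>b x t - b y t\<bar> \<le> B * \<bar>x - y\<bar>"
    and b_bound: "\<And>x t. \<bar>b x t\<bar> \<le> Lam"
    and f_cont: "continuous_on UNIV (\<lambda>(x, t). f x t)"
    and f_bound: "\<And>x t. \<bar>f x t\<bar> \<le> F"
    and f_lip: "\<And>x y t. 0 \<le> t \<Longrightarrow> t \<le> d \<Longrightarrow> \<bar>f x t - f y t\<bar> \<le> F1 * \<bar>x - y\<bar>"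
    and g0_bound: "\<And>x. \<bar>g0 x\<bar> \<le> G0"
    and g0_lip: "\<And>x y. \<bar>g0 x - g0 y\<bar> \<le> G * \<bar>x - y\<bar>"
    and nonneg: "0 \<le> B" "0 \<le> F1" "0 \<le> G"
    and E: "exp (B * d) \<le> E"
begin

lemma characteristic_exists:
  assumes "0 \<le> t"
  obtains y where "characteristic b t y" "y t = x"
  using ode_backward[OF b_cont b_lip assms, of x] unfolding characteristic_def by blast

lemma characteristics_spread:
  assumes "characteristic b t y" "characteristic b t z" "0 \<le> s" "s \<le> t" "t \<le> d"
  shows "\<bar>y s - z s\<bar> \<le> E * \<bar>y t - z t\<bar>"
proof -
  have "\<bar>y s - z s\<bar> \<le> (\<bar>y t - z t\<bar> + 0 * (t - s)) * exp (B * (t - s))"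
    by (rule characteristic_perturbation[OF assms(1,2) b_lip]) (use nonneg assms in auto)
  also have "\<dots> \<le> \<bar>y t - z t\<bar> * E"
    using assms nonneg by (auto intro!: mult_left_mono order_trans[OF _ E] mult_left_mono)
  finally show ?thesis by (simp add: mult.commute)
qed

text \<open>The value at \<open>(x, t)\<close> is the initial value at the foot of the characteristic through that point plus
  the integral of the source along it.  Uniqueness of characteristics makes the feet of all points of
  one characteristic coincide.\<close>

lemma transported_exists: "\<exists>g. transported b f g0 d g"
proof -
  define Y where "Y x t = (SOME y. characteristic b t y \<and> y t = x)" for x t
  have Y: "characteristic b t (Y x t)" "Y x t t = x" if "0 \<le> t" for x t
  proof -
    have "\<exists>y. characteristic b t y \<and> y t = x" using characteristic_exists[OF that] by blast
    from someI_ex[OF this] show "characteristic b t (Y x t)" "Y x t t = x" unfolding Y_def by auto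
  qed
  define g where "g x t = g0 (Y x t 0) + integral {0..t} (\<lambda>s. f (Y x t s) s)" for x t
  have "((\<lambda>s. g (y s) s) has_real_derivative f (y s) s) (at s within {0..t})"
    if y: "characteristic b t y" and t: "0 \<le> t" "t \<le> d" and s: "s \<in> {0..t}" for t y s
  proof -
    have same: "Y (y r) r q = y q" if "r \<in> {0..t}" "q \<in> {0..r}" for r q
      using characteristics_spread[of r "Y (y r) r" y q] Y[of r "y r"] that t
        characteristic_restrict[OF y, of r] by auto
    have g_eq: "g (y r) r = g0 (y 0) + integral {0..r} (\<lambda>q. f (y q) q)" if "r \<in> {0..t}" for r
      unfolding g_def using same[OF that] that by (auto intro!: integral_cong)
    have "continuous_on {0..t} (\<lambda>q. f (y q) q)"
      by (intro continuous_on_compose_curried[OF f_cont] characteristic_continuous[OF y] continuous_on_id)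
    then have "((\<lambda>r. g0 (y 0) + integral {0..r} (\<lambda>q. f (y q) q)) has_real_derivative 0 + f (y s) s) (at s within {0..t})"
      by (intro DERIV_add DERIV_const integral_has_real_derivative s)
    then show ?thesis
      using has_field_derivative_transform_within[OF _ zero_less_one s, of _ _ "\<lambda>s. g (y s) s"] g_eq by simp
  qed
  moreover have "g x 0 = g0 x" for x using Y(2)[of 0 x] by (simp add: g_def)
  ultimately show ?thesis unfolding transported_def by blast
qed

lemma transported_bound:
  assumes g: "transported b f g0 d g" and t: "0 \<le> t" "t \<le> d"
  shows "\<bar>g x t\<bar> \<le> G0 + F * d"
proof -
  obtain y where y: "characteristic b t y" "y t = x" using characteristic_exists[OF t(1)] .
  have "\<bar>g (y t) t - g (y 0) 0\<bar> \<le> F * (t - 0)"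
    by (rule bounded_increment[where h = "\<lambda>s. g (y s) s" and h' = "\<lambda>s. f (y s) s"])
      (use g y t f_bound in \<open>auto simp: transported_def\<close>)
  moreover have "F * t \<le> F * d" using t f_bound[of 0 0] by (intro mult_left_mono) auto
  moreover have "g (y 0) 0 = g0 (y 0)" using g by (simp add: transported_def)
  ultimately show ?thesis using g0_bound[of "y 0"] y by auto
qed

text \<open>Two characteristics that end at distance \<open>\<bar>x - x'\<bar>\<close> stay within \<open>E\<close> times that distance, which
  controls both the initial values and the sources.\<close>

lemma transported_lip:
  assumes g: "transported b f g0 d g" and t: "0 \<le> t" "t \<le> d"
  shows "\<bar>g x t - g x' t\<bar> \<le> E * (G + F1 * d) * \<bar>x - x'\<bar>"
proof -
  obtain y where y: "characteristic b t y" "y t = x" using characteristic_exists[OF t(1)] .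
  obtain z where z: "characteristic b t z" "z t = x'" using characteristic_exists[OF t(1)] .
  have sp: "\<bar>y s - z s\<bar> \<le> E * \<bar>x - x'\<bar>" if "s \<in> {0..t}" for s
    using characteristics_spread[OF y(1) z(1), of s] y z t that by auto
  have E0: "0 \<le> E" using order_trans[OF exp_ge_zero E] .
  have "\<bar>(g (y t) t - g (z t) t) - (g (y 0) 0 - g (z 0) 0)\<bar> \<le> F1 * (E * \<bar>x - x'\<bar>) * (t - 0)"
  proof (rule bounded_increment[where h = "\<lambda>s. g (y s) s - g (z s) s" and h' = "\<lambda>s. f (y s) s - f (z s) s"])
    fix s assume s: "s \<in> {0..t}"
    show "((\<lambda>s. g (y s) s - g (z s) s) has_real_derivative f (y s) s - f (z s) s) (at s within {0..t})"
      using g y z t s unfolding transported_def by (intro DERIV_diff) auto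
    show "\<bar>f (y s) s - f (z s) s\<bar> \<le> F1 * (E * \<bar>x - x'\<bar>)"
      using order_trans[OF f_lip mult_left_mono[OF sp[OF s] nonneg(2)]] s t by auto
  qed (use t in auto)
  also have "\<dots> \<le> F1 * (E * \<bar>x - x'\<bar>) * d" using t nonneg E0 by (intro mult_left_mono) auto
  finally have "\<bar>g (y t) t - g (z t) t\<bar> \<le> \<bar>g (y 0) 0 - g (z 0) 0\<bar> + F1 * (E * \<bar>x - x'\<bar>) * d" by linarith
  moreover have "\<bar>g (y 0) 0 - g (z 0) 0\<bar> \<le> G * (E * \<bar>x - x'\<bar>)"
    using g order_trans[OF g0_lip mult_left_mono[OF sp[of 0] nonneg(3)]] t by (auto simp: transported_def)
  ultimately show ?thesis using y z by (simp add: algebra_simps)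
qed

text \<open>The characteristic through \<open>(x, t')\<close> is at distance at most \<open>Lam (t' - t)\<close> from \<open>x\<close> at time \<open>t\<close>, so
  continuity in time is inherited from that in space.\<close>

lemma transported_lip_time:
  assumes g: "transported b f g0 d g" and t: "0 \<le> t" "t \<le> t'" "t' \<le> d"
  shows "\<bar>g x t' - g x t\<bar> \<le> (F + E * (G + F1 * d) * Lam) * (t' - t)"
proof -
  have t'0: "0 \<le> t'" using t by simp
  obtain y where y: "characteristic b t' y" "y t' = x" using characteristic_exists[OF t'0] .
  have "\<bar>g (y t') t' - g (y t) t\<bar> \<le> F * (t' - t)"
    by (rule bounded_increment[where h = "\<lambda>s. g (y s) s" and h' = "\<lambda>s. f (y s) s"])
      (use g y t f_bound in \<open>auto simp: transported_def intro: has_field_derivative_subset[of _ _ _ "{0..t'}"]\<close>)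
  moreover have "\<bar>y t' - y t\<bar> \<le> Lam * (t' - t)"
    by (rule bounded_increment[where h' = "\<lambda>s. b (y s) s"])
      (use y t b_bound in \<open>auto simp: characteristic_def intro: has_field_derivative_subset[of _ _ _ "{0..t'}"]\<close>)
  moreover have "\<bar>g (y t) t - g x t\<bar> \<le> E * (G + F1 * d) * \<bar>y t - x\<bar>"
    using transported_lip[OF g] t by auto
  moreover have "0 \<le> E * (G + F1 * d)"
    using nonneg t order_trans[OF exp_ge_zero E] by (intro mult_nonneg_nonneg add_nonneg_nonneg) auto
  ultimately have "\<bar>g x t' - g x t\<bar> \<le> F * (t' - t) + E * (G + F1 * d) * (Lam * (t' - t))"
    using y(2) mult_left_mono[of "\<bar>y t - x\<bar>" "Lam * (t' - t)" "E * (G + F1 * d)"] by (auto simp: abs_minus_commute)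
  then show ?thesis by (simp add: algebra_simps)
qed

end

lemma continuous_on_lipschitz_both:
  fixes g :: "real \<Rightarrow> real \<Rightarrow> real"
  assumes "\<And>x y t. t \<in> T \<Longrightarrow> \<bar>g x t - g y t\<bar> \<le> P * \<bar>x - y\<bar>"
    and "\<And>x s t. s \<in> T \<Longrightarrow> t \<in> T \<Longrightarrow> s \<le> t \<Longrightarrow> \<bar>g x t - g x s\<bar> \<le> Q * (t - s)"
  shows "continuous_on (UNIV \<times> T) (\<lambda>(x, t). g x t)"
proof -
  have *: "\<bar>g x t - g y s\<bar> \<le> P * \<bar>x - y\<bar> + Q * \<bar>t - s\<bar>" if "s \<in> T" "t \<in> T" for x y s t
    using assms(1)[OF that(2), of x y] assms(2)[of s t y] assms(2)[of t s y] that by (cases "s \<le> t") auto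
  have "((\<lambda>(x, t). g x t) \<longlongrightarrow> g y s) (at (y, s) within UNIV \<times> T)" if "s \<in> T" for y s
  proof (subst Lim_null, rule Lim_null_comparison)
    show "((\<lambda>p. P * \<bar>fst p - y\<bar> + Q * \<bar>snd p - s\<bar>) \<longlongrightarrow> 0) (at (y, s) within UNIV \<times> T)"
      by (rule tendsto_eq_intros refl | simp)+
    show "\<forall>\<^sub>F p in at (y, s) within UNIV \<times> T. norm ((case p of (x, t) \<Rightarrow> g x t) - g y s) \<le> P * \<bar>fst p - y\<bar> + Q * \<bar>snd p - s\<bar>"
      unfolding eventually_at_filter by (rule always_eventually) (use *[OF that] in auto)
  qed
  then show ?thesis by (auto simp: continuous_on_def)
qed


section \<open>Lipschitz solutions of the diagonal system\<close>

text \<open>The domain has to be an arbitrary topological space, because the functions below also depend on a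
  truth value that selects the family of characteristics.\<close>

lemma closed_imp_complete_bcontfun:
  fixes S :: "('a::topological_space \<Rightarrow>\<^sub>C 'b::complete_space) set"
  assumes "closed S"
  shows "complete S"
proof (rule completeI)
  fix f :: "nat \<Rightarrow> ('a, 'b) bcontfun"
  assume S: "\<forall>n. f n \<in> S" and f: "Cauchy f"
  from f obtain g where "uniform_limit UNIV f g sequentially"
    using uniformly_convergent_eq_cauchy[of "\<lambda>_. True" f]
    unfolding Cauchy_def uniform_limit_sequentially_iff
    by (metis dist_fun_lt_imp_dist_val_lt)
  from uniform_limit_bcontfunE[OF this sequentially_bot]
  obtain l where "f \<longlonglongrightarrow> l" by metis
  then show "\<exists>l\<in>S. f \<longlonglongrightarrow> l"
    using closed_sequentially[OF assms] S by blast
qed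

definition sg :: "bool \<Rightarrow> real" where "sg \<sigma> = (if \<sigma> then 1 else -1)"

lemma abs_sg [simp]: "\<bar>sg \<sigma>\<bar> = 1" "\<bar>sg \<sigma> * r\<bar> = \<bar>r\<bar>"
  by (auto simp: sg_def abs_mult)

text \<open>The two invariants are \<open>v True = u + \<phi>\<close> and \<open>v False = u - \<phi>\<close>.  So \<open>half_diff\<close> recovers \<open>\<phi>\<close>,
  \<open>half_sum\<close> recovers \<open>u\<close>, and \<open>sg \<sigma>\<close> is the direction in which \<open>v \<sigma>\<close> is transported.\<close>

definition half_diff :: "(bool \<Rightarrow> real \<Rightarrow> real \<Rightarrow> real) \<Rightarrow> real \<Rightarrow> real \<Rightarrow> real" where
  "half_diff v x t = (v True x t - v False x t) / 2"

definition half_sum :: "(bool \<Rightarrow> real \<Rightarrow> real \<Rightarrow> real) \<Rightarrow> real \<Rightarrow> real \<Rightarrow> real" where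
  "half_sum v x t = (v True x t + v False x t) / 2"

lemma half_diff_bound:
  assumes "\<And>\<sigma>. \<bar>v \<sigma> x t\<bar> \<le> r"
  shows "\<bar>half_diff v x t\<bar> \<le> r"
  using assms[of True] assms[of False] by (simp add: half_diff_def abs_le_iff field_simps)

lemma half_sum_bound:
  assumes "\<And>\<sigma>. \<bar>v \<sigma> x t\<bar> \<le> r"
  shows "\<bar>half_sum v x t\<bar> \<le> r"
  using assms[of True] assms[of False] by (simp add: half_sum_def abs_le_iff field_simps)

lemma half_diff_dist:
  assumes "\<And>\<sigma>. \<bar>v \<sigma> x t - w \<sigma> y s\<bar> \<le> r"
  shows "\<bar>half_diff v x t - half_diff w y s\<bar> \<le> r"
  using assms[of True] assms[of False] by (simp add: half_diff_def abs_le_iff field_simps)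

lemma half_sum_dist:
  assumes "\<And>\<sigma>. \<bar>v \<sigma> x t - w \<sigma> y s\<bar> \<le> r"
  shows "\<bar>half_sum v x t - half_sum w y s\<bar> \<le> r"
  using assms[of True] assms[of False] by (simp add: half_sum_def abs_le_iff field_simps)

text \<open>Data for the diagonal system, with a life span \<open>d\<close> that depends only on the bounds.  The conditions
  on \<open>d\<close> serve, in this order, to keep characteristics from separating by more than a factor \<open>2\<close>, to
  preserve the Lipschitz bound \<open>2 M + 1\<close> and the bound \<open>N + 1\<close>, to obtain a contraction, and to absorb
  the distance of two difference quotients.  The speed \<open>c\<close> need only be \<open>C\<^sup>1\<close>, as the speed of sound
  is no smoother than that at the vacuum \<open>\<phi> = 0\<close>.\<close>

locale cauchy_data =
  fixes c c' a :: "real \<Rightarrow> real" and v0 v0' :: "bool \<Rightarrow> real \<Rightarrow> real"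
    and N M A L Lam d :: real
  assumes c_deriv: "\<And>y. (c has_real_derivative c' y) (at y)"
    and c'_cont: "continuous_on UNIV c'"
    and a_cont: "continuous_on UNIV a"
    and v0_deriv: "\<And>\<sigma> x. (v0 \<sigma> has_real_derivative v0' \<sigma> x) (at x)"
    and v0'_cont: "\<And>\<sigma>. continuous_on UNIV (v0' \<sigma>)"
    and c_bound: "\<And>y. \<bar>y\<bar> \<le> N + 1 \<Longrightarrow> \<bar>c y\<bar> \<le> Lam"
    and c'_bound: "\<And>y. \<bar>y\<bar> \<le> N + 1 \<Longrightarrow> \<bar>c' y\<bar> \<le> L"
    and a_bound: "\<And>t. \<bar>a t\<bar> \<le> A"
    and v0_bound: "\<And>\<sigma> x. \<bar>v0 \<sigma> x\<bar> \<le> N"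
    and v0'_bound: "\<And>\<sigma> x. \<bar>v0' \<sigma> x\<bar> \<le> M"
    and d: "0 < d"
    and d_exp: "exp (L * (2 * M + 1) * d) \<le> 2"
    and d_lip: "2 * d * A * (2 * M + 1) \<le> 1"
    and d_bound: "d * A * (N + 1) \<le> 1"
    and d_contr: "M * (2 * L * d) + d * A * (1 + (2 * M + 1) * (2 * L * d)) \<le> 1/2"
    and d_quot: "d * (A + 2 * L * (2 * M + 1)) \<le> 1/2"
begin

definition speed :: "(bool \<Rightarrow> real \<Rightarrow> real \<Rightarrow> real) \<Rightarrow> bool \<Rightarrow> real \<Rightarrow> real \<Rightarrow> real" where
  "speed v \<sigma> x t = sg \<sigma> * c (half_diff v x t)"

definition source :: "(bool \<Rightarrow> real \<Rightarrow> real \<Rightarrow> real) \<Rightarrow> real \<Rightarrow> real \<Rightarrow> real" where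
  "source v x t = - a t * half_sum v x t"

definition admissible :: "(bool \<Rightarrow> real \<Rightarrow> real \<Rightarrow> real) \<Rightarrow> bool" where
  "admissible v \<longleftrightarrow> (\<forall>\<sigma>. continuous_on UNIV (\<lambda>(x, t). v \<sigma> x t)) \<and>
     (\<forall>\<sigma> x t. \<bar>v \<sigma> x t\<bar> \<le> N + 1) \<and>
     (\<forall>\<sigma> x y t. \<bar>v \<sigma> x t - v \<sigma> y t\<bar> \<le> (2 * M + 1) * \<bar>x - y\<bar>)"

lemma nonneg: "0 \<le> N" "0 \<le> M" "0 \<le> A" "0 \<le> L" "0 \<le> Lam"
proof -
  show N: "0 \<le> N" using order_trans[OF abs_ge_zero v0_bound] .
  show "0 \<le> M" using order_trans[OF abs_ge_zero v0'_bound] .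
  show "0 \<le> A" using order_trans[OF abs_ge_zero a_bound] .
  show "0 \<le> L" using order_trans[OF abs_ge_zero c'_bound[of 0]] N by simp
  show "0 \<le> Lam" using order_trans[OF abs_ge_zero c_bound[of 0]] N by simp
qed

lemma c_lip: "\<bar>y\<bar> \<le> N + 1 \<Longrightarrow> \<bar>z\<bar> \<le> N + 1 \<Longrightarrow> \<bar>c y - c z\<bar> \<le> L * \<bar>y - z\<bar>"
  using field_differentiable_bound[of "{-(N+1)..N+1}" c c' L z y] c'_bound c_deriv
  by (auto simp: has_field_derivative_at_within abs_le_iff abs_minus_commute[of z y])

lemma v0_lip: "\<bar>v0 \<sigma> x - v0 \<sigma> y\<bar> \<le> M * \<bar>x - y\<bar>"
  using field_differentiable_bound[of UNIV "v0 \<sigma>" "v0' \<sigma>" M y x] v0'_bound v0_deriv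
  by (auto simp: abs_minus_commute)

lemma c_cont: "continuous_on X c"
  using c_deriv by (meson DERIV_continuous_on has_field_derivative_at_within)

context
  fixes v assumes v: "admissible v"
begin

lemma v_cont: "continuous_on UNIV (\<lambda>(x, t). v \<sigma> x t)"
  and v_bound: "\<bar>v \<sigma> x t\<bar> \<le> N + 1"
  and v_lip: "\<bar>v \<sigma> x t - v \<sigma> y t\<bar> \<le> (2 * M + 1) * \<bar>x - y\<bar>"
  using v by (auto simp: admissible_def)

lemma half_diff_cont: "continuous_on UNIV (\<lambda>(x, t). half_diff v x t)"
  using v_cont[of True] v_cont[of False] unfolding half_diff_def case_prod_beta
  by (intro continuous_intros) auto

lemma half_sum_cont: "continuous_on UNIV (\<lambda>(x, t). half_sum v x t)"
  using v_cont[of True] v_cont[of False] unfolding half_sum_def case_prod_beta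
  by (intro continuous_intros) auto

lemma phi_bound: "\<bar>half_diff v x t\<bar> \<le> N + 1"
  using half_diff_bound[of v x t] v_bound by blast

lemma speed_cont: "continuous_on UNIV (\<lambda>(x, t). speed v \<sigma> x t)"
  using continuous_on_compose2[OF c_cont half_diff_cont, of UNIV] unfolding speed_def case_prod_beta
  by (intro continuous_intros) auto

lemma speed_bound: "\<bar>speed v \<sigma> x t\<bar> \<le> Lam"
  unfolding speed_def using c_bound[OF phi_bound] by simp

lemma speed_diff:
  assumes "\<And>\<sigma>. \<bar>w \<sigma> y s\<bar> \<le> N + 1"
  shows "\<bar>speed v \<sigma> x t - speed w \<sigma> y s\<bar> \<le> L * \<bar>half_diff v x t - half_diff w y s\<bar>"
  using c_lip[OF phi_bound half_diff_bound[of w y s, OF assms]] unfolding speed_def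
  by (auto simp flip: right_diff_distrib)

lemma speed_lip: "\<bar>speed v \<sigma> x t - speed v \<sigma> y t\<bar> \<le> L * (2 * M + 1) * \<bar>x - y\<bar>"
  using order_trans[OF speed_diff[of v, OF v_bound] mult_left_mono[OF half_diff_dist[of v _ _ v, OF v_lip] nonneg(4)]]
  by (simp add: mult.assoc)

lemma source_cont: "continuous_on UNIV (\<lambda>(x, t). source v x t)"
  unfolding source_def case_prod_beta using half_sum_cont
  by (intro continuous_intros continuous_on_compose2[OF a_cont]) (auto simp: case_prod_beta)

lemma source_bound: "\<bar>source v x t\<bar> \<le> A * (N + 1)"
  unfolding source_def abs_mult abs_minus_cancel
  by (intro mult_mono a_bound half_sum_bound[of v, OF v_bound]) (use nonneg in auto)

lemma source_diff: "\<bar>source v x t - source w y t\<bar> \<le> A * \<bar>half_sum v x t - half_sum w y t\<bar>"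
proof -
  have "\<bar>source v x t - source w y t\<bar> = \<bar>a t\<bar> * \<bar>half_sum v x t - half_sum w y t\<bar>"
    unfolding source_def abs_mult[symmetric] by (simp add: algebra_simps abs_minus_commute)
  then show ?thesis using mult_right_mono[OF a_bound] by simp
qed

lemma source_lip: "\<bar>source v x t - source v y t\<bar> \<le> A * (2 * M + 1) * \<bar>x - y\<bar>"
  using order_trans[OF source_diff mult_left_mono[OF half_sum_dist[of v _ _ v, OF v_lip] nonneg(3)]]
  by (simp add: mult.assoc)

lemma Mpos: "0 \<le> 2 * M + 1" using nonneg by simp

lemma transport_equation:
  "transport_equation (speed v \<sigma>) (source v) (v0 \<sigma>) (L * (2 * M + 1)) (A * (N + 1))
     (A * (2 * M + 1)) M N Lam d 2"
  using speed_cont speed_lip speed_bound source_cont source_bound source_lip v0_bound v0_lip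
    nonneg d_exp
  by unfold_locales auto

lemma transported_stays_bounded:
  assumes "transported (speed v \<sigma>) (source v) (v0 \<sigma>) d g" "0 \<le> t" "t \<le> d"
  shows "\<bar>g x t\<bar> \<le> N + 1"
  using transport_equation.transported_bound[OF transport_equation assms, of x] d_bound
  by (simp add: mult_ac)

lemma transported_stays_lipschitz:
  assumes "transported (speed v \<sigma>) (source v) (v0 \<sigma>) d g" "0 \<le> t" "t \<le> d"
  shows "\<bar>g x t - g y t\<bar> \<le> (2 * M + 1) * \<bar>x - y\<bar>"
proof -
  have "\<bar>g x t - g y t\<bar> \<le> 2 * (M + A * (2 * M + 1) * d) * \<bar>x - y\<bar>"
    using transport_equation.transported_lip[OF transport_equation assms] .
  also have "\<dots> \<le> (2 * M + 1) * \<bar>x - y\<bar>"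
    using d_lip by (intro mult_right_mono) (auto simp: algebra_simps)
  finally show ?thesis .
qed

end

definition clip :: "real \<Rightarrow> real" where "clip t = max 0 (min t d)"

lemma clip: "0 \<le> clip t" "clip t \<le> d" "0 \<le> t \<Longrightarrow> t \<le> d \<Longrightarrow> clip t = t"
  using d by (auto simp: clip_def)

text \<open>One step of the iteration: the characteristics and the source are taken from \<open>v\<close>.  Clipping time to
  \<open>[0, d]\<close> gives functions on the whole plane.\<close>

definition step :: "(bool \<Rightarrow> real \<Rightarrow> real \<Rightarrow> real) \<Rightarrow> bool \<Rightarrow> real \<Rightarrow> real \<Rightarrow> real" where
  "step v \<sigma> x t = (SOME g. transported (speed v \<sigma>) (source v) (v0 \<sigma>) d g) x (clip t)"

lemma transported_step:
  assumes "admissible v"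
  shows "transported (speed v \<sigma>) (source v) (v0 \<sigma>) d (step v \<sigma>)"
proof -
  let ?g = "SOME g. transported (speed v \<sigma>) (source v) (v0 \<sigma>) d g"
  have g: "transported (speed v \<sigma>) (source v) (v0 \<sigma>) d ?g"
    using transport_equation.transported_exists[OF transport_equation[OF assms]] by (rule someI_ex)
  have "((\<lambda>s. step v \<sigma> (y s) s) has_real_derivative source v (y s) s) (at s within {0..t})"
    if "0 \<le> t" "t \<le> d" "characteristic (speed v \<sigma>) t y" "s \<in> {0..t}" for t y s
    by (rule has_field_derivative_transform_within[where f = "\<lambda>s. ?g (y s) s" and d = 1])
      (use g that in \<open>auto simp: transported_def step_def clip\<close>)
  moreover have "step v \<sigma> x 0 = v0 \<sigma> x" for x
    using g d by (auto simp: transported_def step_def clip)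
  ultimately show ?thesis by (auto simp: transported_def)
qed

lemma admissible_step:
  assumes v: "admissible v" shows "admissible (step v)"
  unfolding admissible_def
proof (intro conjI allI)
  fix \<sigma>
  note g = transported_step[OF v, of \<sigma>]
  have st: "step v \<sigma> x t = step v \<sigma> x (clip t)" for x t
    by (simp add: step_def clip)
  show "\<bar>step v \<sigma> x t\<bar> \<le> N + 1" for x t
    using transported_stays_bounded[OF v g] st[of x t] clip by simp
  show "\<bar>step v \<sigma> x t - step v \<sigma> y t\<bar> \<le> (2 * M + 1) * \<bar>x - y\<bar>" for x y t
    using transported_stays_lipschitz[OF v g] st[of _ t] clip by simp
  have "continuous_on (UNIV \<times> {0..d}) (\<lambda>(x, t). step v \<sigma> x t)"
    by (rule continuous_on_lipschitz_both) (use transported_stays_lipschitz[OF v g] transport_equation.transported_lip_time[OF transport_equation[OF v] g] in auto)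
  then have "continuous_on UNIV (\<lambda>p. case (fst p, clip (snd p)) of (x, t) \<Rightarrow> step v \<sigma> x t)"
    by (rule continuous_on_compose2) (use clip in \<open>auto simp: clip_def intro!: continuous_intros\<close>)
  then show "continuous_on UNIV (\<lambda>(x, t). step v \<sigma> x t)"
    by (simp add: case_prod_beta st[symmetric])
qed

text \<open>No derivative is lost in the uniform norm: the characteristics for \<open>v\<close> and \<open>w\<close> differ by a multiple
  of \<open>d\<close> times the distance of \<open>v\<close> and \<open>w\<close>, and the Lipschitz bounds convert this into a difference
  of values.\<close>

lemma step_contraction:
  assumes v: "admissible v" and w: "admissible w"
    and e: "\<And>\<sigma> x t. \<bar>v \<sigma> x t - w \<sigma> x t\<bar> \<le> e"
  shows "\<bar>step v \<sigma> x t - step w \<sigma> x t\<bar> \<le> e / 2"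
proof -
  have e0: "0 \<le> e" using order_trans[OF abs_ge_zero e] .
  define r where "r = clip t"
  have r: "0 \<le> r" "r \<le> d" using clip by (auto simp: r_def)
  note g = transported_step[OF v, of \<sigma>] and h = transported_step[OF w, of \<sigma>]
  obtain y where y: "characteristic (speed v \<sigma>) r y" "y r = x"
    using transport_equation.characteristic_exists[OF transport_equation[OF v] r(1)] .
  obtain z where z: "characteristic (speed w \<sigma>) r z" "z r = x"
    using transport_equation.characteristic_exists[OF transport_equation[OF w] r(1)] .
  have near: "\<bar>y s - z s\<bar> \<le> 2 * L * d * e" if s: "s \<in> {0..r}" for s
  proof -
    have "\<bar>speed v \<sigma> x s - speed w \<sigma> x s\<bar> \<le> L * e" for x s
      using order_trans[OF speed_diff[of v w, OF v v_bound[OF w]] mult_left_mono[OF half_diff_dist[of v _ _ w, OF e] nonneg(4)]] .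
    then have "\<bar>y s - z s\<bar> \<le> (\<bar>y r - z r\<bar> + L * e * (r - s)) * exp (L * (2 * M + 1) * (r - s))"
      using s nonneg e0 by (intro characteristic_perturbation[OF y(1) z(1) speed_lip[OF v]]) auto
    also have "\<dots> \<le> (L * e * d) * 2"
    proof (rule mult_mono)
      show "\<bar>y r - z r\<bar> + L * e * (r - s) \<le> L * e * d"
        using y z s r nonneg e0 by (auto intro!: mult_left_mono)
      show "exp (L * (2 * M + 1) * (r - s)) \<le> 2"
        using s r nonneg by (intro order_trans[OF _ d_exp]) (auto intro!: mult_left_mono)
    qed (use nonneg e0 d in auto)
    finally show ?thesis by (simp add: mult_ac)
  qed
  have "\<bar>(step v \<sigma> (y r) r - step w \<sigma> (z r) r) - (step v \<sigma> (y 0) 0 - step w \<sigma> (z 0) 0)\<bar>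
    \<le> A * (e + (2 * M + 1) * (2 * L * d * e)) * (r - 0)"
  proof (rule bounded_increment[where h = "\<lambda>s. step v \<sigma> (y s) s - step w \<sigma> (z s) s"
        and h' = "\<lambda>s. source v (y s) s - source w (z s) s"])
    fix s assume s: "s \<in> {0..r}"
    show "((\<lambda>s. step v \<sigma> (y s) s - step w \<sigma> (z s) s) has_real_derivative
        source v (y s) s - source w (z s) s) (at s within {0..r})"
      using g h y z r s by (intro DERIV_diff) (auto simp: transported_def)
    have "\<bar>v \<tau> (y s) s - w \<tau> (z s) s\<bar> \<le> e + (2 * M + 1) * (2 * L * d * e)" for \<tau>
      using e[of \<tau> "z s" s] v_lip[OF v, of \<tau> "y s" s "z s"]
        mult_left_mono[OF near[OF s] Mpos[OF v]] by linarith
    from order_trans[OF source_diff[OF v] mult_left_mono[OF half_sum_dist[of v _ _ w, OF this] nonneg(3)]]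
    show "\<bar>source v (y s) s - source w (z s) s\<bar> \<le> A * (e + (2 * M + 1) * (2 * L * d * e))" .
  qed (use r in auto)
  also have "\<dots> \<le> A * (e + (2 * M + 1) * (2 * L * d * e)) * d"
    using r nonneg e0 d by (intro mult_left_mono) auto
  finally have 1: "\<bar>step v \<sigma> (y r) r - step w \<sigma> (z r) r\<bar> \<le>
     \<bar>step v \<sigma> (y 0) 0 - step w \<sigma> (z 0) 0\<bar> + A * (e + (2 * M + 1) * (2 * L * d * e)) * d"
    by linarith
  have "\<bar>step v \<sigma> (y 0) 0 - step w \<sigma> (z 0) 0\<bar> \<le> M * (2 * L * d * e)"
    using g h order_trans[OF v0_lip mult_left_mono[OF near nonneg(2)]] r by (auto simp: transported_def)
  with 1 have "\<bar>step v \<sigma> x r - step w \<sigma> x r\<bar> \<le>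
     e * (M * (2 * L * d) + d * A * (1 + (2 * M + 1) * (2 * L * d)))"
    using y z by (simp add: algebra_simps)
  also have "\<dots> \<le> e * (1/2)" using e0 d_contr by (intro mult_left_mono)
  finally show ?thesis by (simp add: r_def step_def clip)
qed

text \<open>The admissible functions form a closed set of bounded continuous functions of \<open>(\<sigma>, x, t)\<close>.\<close>

lemma fixed_point_exists:
  "\<exists>v. admissible v \<and> (\<forall>\<sigma>. transported (speed v \<sigma>) (source v) (v0 \<sigma>) d (v \<sigma>))"
proof -
  define cur where "cur V \<sigma> x t = apply_bcontfun V (\<sigma>, x, t)"
    for V :: "(bool \<times> real \<times> real) \<Rightarrow>\<^sub>C real" and \<sigma> x t
  define S where "S = {V. admissible (cur V)}"
  define Psi where "Psi V = Bcontfun (\<lambda>(\<sigma>, x, t). step (cur V) \<sigma> x t)" for V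
  have bc: "(\<lambda>(\<sigma>, x, t). v \<sigma> x t) \<in> bcontfun" if "admissible v" for v
  proof (rule bcontfun_normI)
    show "norm (case p of (\<sigma>, x, t) \<Rightarrow> v \<sigma> x t) \<le> N + 1" for p
      using v_bound[OF that] by (auto split: prod.split)
    have part: "continuous_on ({\<sigma>} \<times> UNIV) (\<lambda>(\<sigma>, x, t). v \<sigma> x t)" for \<sigma>
    proof -
      have "continuous_on ({\<sigma>} \<times> UNIV) (\<lambda>p. (\<lambda>(x, t). v \<sigma> x t) (snd p))"
        by (rule continuous_on_compose2[OF v_cont[OF that, of \<sigma>]]) (auto intro!: continuous_intros)
      then show ?thesis
        by (rule continuous_on_cong[THEN iffD1, rotated -1]) auto
    qed
    have "continuous_on (({True} \<times> UNIV) \<union> ({False} \<times> UNIV)) (\<lambda>(\<sigma>, x, t). v \<sigma> x t)"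
      by (intro continuous_on_open_Un open_Times open_discrete part) auto
    moreover have "({True} \<times> UNIV) \<union> ({False} \<times> UNIV) = (UNIV :: (bool \<times> real \<times> real) set)" by auto
    ultimately show "continuous_on UNIV (\<lambda>(\<sigma>, x, t). v \<sigma> x t)" by simp
  qed
  have curv: "cur (Bcontfun (\<lambda>(\<sigma>, x, t). v \<sigma> x t)) = v" if "admissible v" for v
    using bc[OF that] by (auto simp: cur_def Bcontfun_inverse intro!: ext)
  have "\<exists>!V\<in>S. Psi V = V"
  proof (rule Banach_fix[where c = "1/2" and f = Psi and S = S])
    have "S = (\<Inter>p. {V. \<bar>apply_bcontfun V p\<bar> \<le> N + 1}) \<inter>
       (\<Inter>\<sigma>. \<Inter>x. \<Inter>y. \<Inter>t. {V. \<bar>apply_bcontfun V (\<sigma>, x, t) - apply_bcontfun V (\<sigma>, y, t)\<bar> \<le> (2 * M + 1) * \<bar>x - y\<bar>})"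
    proof -
      have cc: "continuous_on UNIV (\<lambda>(x, t). cur V \<sigma> x t)" for V \<sigma>
        unfolding cur_def case_prod_beta
        by (rule continuous_on_compose2[OF continuous_on_apply_bcontfun[of UNIV V]])
          (auto intro!: continuous_intros)
      show ?thesis
        unfolding S_def admissible_def using cc by (simp add: set_eq_iff) (simp add: cur_def)
    qed
    moreover have "continuous_on UNIV (\<lambda>V. apply_bcontfun V p)" for p :: "bool \<times> real \<times> real"
      by (auto simp: continuous_on_iff intro!: dist_fun_lt_imp_dist_val_lt)
    ultimately have "closed S"
      by (simp only:) (intro closed_Int closed_INT ballI closed_Collect_le continuous_intros)
    then show "complete S" by (rule closed_imp_complete_bcontfun)
    have "admissible (\<lambda>_ _ _. 0)" using nonneg by (auto simp: admissible_def)
    then show "S \<noteq> {}" using curv by (auto simp: S_def intro!: exI[of _ "Bcontfun (\<lambda>(\<sigma>, x, t). 0)"])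
    show "Psi ` S \<subseteq> S"
      by (auto simp: S_def Psi_def curv admissible_step)
    fix V W assume VW: "V \<in> S" "W \<in> S"
    then have VW': "admissible (cur V)" "admissible (cur W)" by (auto simp: S_def)
    show "dist (Psi V) (Psi W) \<le> 1/2 * dist V W"
    proof (rule dist_bound)
      fix p :: "bool \<times> real \<times> real"
      obtain \<sigma> x t where p: "p = (\<sigma>, x, t)" by (cases p)
      have "\<bar>cur V \<sigma> x t - cur W \<sigma> x t\<bar> \<le> dist V W" for \<sigma> x t
        using dist_bounded[of V "(\<sigma>, x, t)" W] by (simp add: cur_def dist_real_def)
      from step_contraction[OF VW' this]
      show "dist (apply_bcontfun (Psi V) p) (apply_bcontfun (Psi W) p) \<le> 1/2 * dist V W"
        unfolding Psi_def p using bc[OF admissible_step[OF VW'(1)]] bc[OF admissible_step[OF VW'(2)]]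
        by (simp add: Bcontfun_inverse dist_real_def)
    qed
  qed auto
  then obtain V where V: "V \<in> S" "Psi V = V" by blast
  then have adm: "admissible (cur V)" by (simp add: S_def)
  have "cur V = step (cur V)"
    using arg_cong[OF V(2), of cur] curv[OF admissible_step[OF adm]] by (simp add: Psi_def)
  then show ?thesis using adm transported_step[OF adm] by auto
qed

end


section \<open>Uniform convergence of the difference quotients\<close>

lemma uniform_modulus:
  fixes f :: "real \<Rightarrow> real"
  assumes "continuous_on UNIV f" "0 < w"
  obtains r where "0 < r" "\<And>x y. \<bar>x\<bar> \<le> R \<Longrightarrow> \<bar>y\<bar> \<le> R \<Longrightarrow> \<bar>x - y\<bar> \<le> r \<Longrightarrow> \<bar>f x - f y\<bar> \<le> w"
proof -
  have "uniformly_continuous_on {-R..R} f"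
    using assms(1) by (intro compact_uniformly_continuous) (auto intro: continuous_on_subset)
  then obtain r where r: "0 < r" "\<And>x y. x \<in> {-R..R} \<Longrightarrow> y \<in> {-R..R} \<Longrightarrow> dist y x < r \<Longrightarrow> dist (f y) (f x) < w"
    using assms(2) unfolding uniformly_continuous_on_def by metis
  show ?thesis
  proof (rule that[of "r/2"])
    fix x y assume "\<bar>x\<bar> \<le> R" "\<bar>y\<bar> \<le> R" "\<bar>x - y\<bar> \<le> r/2"
    then show "\<bar>f x - f y\<bar> \<le> w" using r(2)[of y x] r(1) by (auto simp: dist_real_def abs_le_iff)
  qed (use r in auto)
qed

lemma linearization_error:
  fixes f f' :: "real \<Rightarrow> real"
  assumes f': "\<And>x. (f has_real_derivative f' x) (at x)"
    and w: "\<And>z. z \<in> closed_segment x y \<Longrightarrow> \<bar>f' z - m\<bar> \<le> w"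
  shows "\<bar>f y - f x - m * (y - x)\<bar> \<le> w * \<bar>y - x\<bar>"
proof -
  have "norm ((f y - m * y) - (f x - m * x)) \<le> w * norm (y - x)"
    by (rule field_differentiable_bound[of "closed_segment x y" _ "\<lambda>z. f' z - m"])
      (use w in \<open>auto intro!: derivative_eq_intros has_field_derivative_at_within[OF f']\<close>)
  then show ?thesis by (simp add: algebra_simps)
qed

context cauchy_data
begin

context
  fixes v assumes v: "admissible v"
    and tr: "\<And>\<sigma>. transported (speed v \<sigma>) (source v) (v0 \<sigma>) d (v \<sigma>)"
begin

definition quot :: "bool \<Rightarrow> real \<Rightarrow> real \<Rightarrow> real \<Rightarrow> real" where
  "quot \<sigma> h x t = (v \<sigma> (x + h) t - v \<sigma> x t) / h"

lemma quot_bound: "\<bar>quot \<sigma> h x t\<bar> \<le> 2 * M + 1"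
proof (cases "h = 0")
  case False
  then show ?thesis using v_lip[OF v, of \<sigma> "x + h" t x] by (simp add: quot_def abs_divide divide_le_eq)
qed (use nonneg in \<open>simp add: quot_def\<close>)

lemma characteristic_cone:
  assumes "characteristic (speed v \<sigma>) t y" "0 \<le> s" "s \<le> t"
  shows "\<bar>y t - y s\<bar> \<le> Lam * (t - s)"
  by (rule bounded_increment[where h' = "\<lambda>s. speed v \<sigma> (y s) s"])
    (use assms speed_bound[OF v] in
      \<open>auto simp: characteristic_def intro: has_field_derivative_subset[of _ _ _ "{0..t}"]\<close>)

text \<open>Uniqueness, used to divide by the distance of two characteristics.\<close>

lemma characteristic_separated:
  assumes y: "characteristic (speed v \<sigma>) t y" and z: "characteristic (speed v \<sigma>) t z"
    and s: "0 \<le> s" "s \<le> t" and ne: "y t \<noteq> z t"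
  shows "y s \<noteq> z s"
proof
  assume "y s = z s"
  have "\<bar>y t - z t\<bar> \<le> (\<bar>y s - z s\<bar> + 0 * (t - s)) * exp (L * (2 * M + 1) * (t - s))"
  proof (rule gronwall_forward[where y = "\<lambda>s. y s - z s" and b = t
        and y' = "\<lambda>r. speed v \<sigma> (y r) r - speed v \<sigma> (z r) r"])
    fix r assume r: "r \<in> {s..t}"
    have "((\<lambda>s. y s - z s) has_real_derivative speed v \<sigma> (y r) r - speed v \<sigma> (z r) r) (at r within {0..t})"
      using y z r s unfolding characteristic_def by (intro DERIV_diff) auto
    then show "((\<lambda>s. y s - z s) has_real_derivative speed v \<sigma> (y r) r - speed v \<sigma> (z r) r) (at r within {s..t})"
      by (rule has_field_derivative_subset) (use s in auto)
    show "\<bar>speed v \<sigma> (y r) r - speed v \<sigma> (z r) r\<bar> \<le> L * (2 * M + 1) * \<bar>y r - z r\<bar> + 0"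
      using speed_lip[OF v] by simp
  qed (use s nonneg in auto)
  then show False using \<open>y s = z s\<close> ne by simp
qed

context
  fixes R w eps D :: real
  assumes w: "0 < w" and eps: "0 < eps" "eps \<le> 1"
    and mod_v0: "\<And>\<sigma> x y. \<bar>x\<bar> \<le> R + 1 \<Longrightarrow> \<bar>y\<bar> \<le> R + 1 \<Longrightarrow> \<bar>x - y\<bar> \<le> eps \<Longrightarrow> \<bar>v0' \<sigma> x - v0' \<sigma> y\<bar> \<le> w"
    and mod_c: "\<And>x y. \<bar>x\<bar> \<le> N + 1 \<Longrightarrow> \<bar>y\<bar> \<le> N + 1 \<Longrightarrow> \<bar>x - y\<bar> \<le> (2 * M + 1) * eps \<Longrightarrow> \<bar>c' x - c' y\<bar> \<le> w"
    and D: "\<And>\<sigma> x t h k. 0 \<le> t \<Longrightarrow> t \<le> d \<Longrightarrow> \<bar>x\<bar> + Lam * t \<le> R \<Longrightarrow>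
        h \<noteq> 0 \<Longrightarrow> \<bar>h\<bar> \<le> eps * exp (- (L * (2 * M + 1) * t)) \<Longrightarrow>
        k \<noteq> 0 \<Longrightarrow> \<bar>k\<bar> \<le> eps * exp (- (L * (2 * M + 1) * t)) \<Longrightarrow>
        \<bar>quot \<sigma> h x t - quot \<sigma> k x t\<bar> \<le> D"
begin

text \<open>Let \<open>h s\<close> be the distance of two characteristics of one family.  The difference quotient over
  \<open>h s\<close> satisfies an equation in which the quotients of the source and of the speed occur.  The first
  is a combination of the quotients of both invariants over the same increment; the second is
  \<open>sg \<sigma> * c' * q\<close> up to a small error.  So the equation closes, without any derivative of \<open>v\<close>.  The bound on
  \<open>h s\<close> shows that the pair consisting of base point and increment never leaves the set on which
  quotients are compared.\<close>

lemma quot_along_characteristic: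
  assumes y: "characteristic (speed v \<sigma>) t y" and z: "characteristic (speed v \<sigma>) t z"
    and t: "0 \<le> t" "t \<le> d" and cone: "\<bar>y t\<bar> + Lam * t \<le> R"
    and ne: "z t \<noteq> y t" and small: "\<bar>z t - y t\<bar> \<le> eps * exp (- (L * (2 * M + 1) * t))"
    and s: "s \<in> {0..t}"
  defines "h \<equiv> \<lambda>s. z s - y s"
  defines "q \<equiv> \<lambda>s. (quot True (h s) (y s) s - quot False (h s) (y s) s) / 2"
  shows "h s \<noteq> 0" "\<bar>h s\<bar> \<le> eps * exp (- (L * (2 * M + 1) * s))" "\<bar>y s\<bar> + Lam * s \<le> R"
    "\<exists>\<beta>. \<bar>\<beta>\<bar> \<le> L * (2 * M + 1) \<and> \<bar>\<beta> - sg \<sigma> * c' (half_diff v (y s) s) * q s\<bar> \<le> w * (2 * M + 1) \<and>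
      ((\<lambda>s. quot \<sigma> (h s) (y s) s) has_real_derivative
        - a s * ((quot True (h s) (y s) s + quot False (h s) (y s) s) / 2)
        - quot \<sigma> (h s) (y s) s * \<beta>) (at s within {0..t})"
proof -
  let ?B = "L * (2 * M + 1)"
  have h_ne: "h s \<noteq> 0" if "s \<in> {0..t}" for s
    using characteristic_separated[OF z y _ _ ne, of s] that by (auto simp: h_def)
  show hs: "h s \<noteq> 0" using h_ne[OF s] .
  have "\<bar>h s\<bar> \<le> (\<bar>z t - y t\<bar> + 0 * (t - s)) * exp (?B * (t - s))"
    unfolding h_def
    by (rule characteristic_perturbation[OF z y speed_lip[OF v]]) (use s nonneg in auto)
  also have "\<dots> \<le> (eps * exp (- (?B * t))) * exp (?B * (t - s))"
    using small by (intro mult_right_mono) auto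
  also have "\<dots> = eps * exp (- (?B * s))"
    by (simp add: mult_exp_exp algebra_simps)
  finally show h_small: "\<bar>h s\<bar> \<le> eps * exp (- (?B * s))" .
  moreover have "exp (- (?B * s)) \<le> 1" using s nonneg by simp
  ultimately have h_eps: "\<bar>h s\<bar> \<le> eps" using eps mult_left_le[of "exp (- (?B * s))" eps] by linarith
  show "\<bar>y s\<bar> + Lam * s \<le> R"
    using characteristic_cone[OF y, of s] s cone by (simp add: algebra_simps abs_le_iff)
  have z_eq: "z s = y s + h s" for s by (simp add: h_def)
  define p where "p = half_diff v (y s) s"
  define p1 where "p1 = half_diff v (z s) s"
  have p1p: "p1 - p = h s * q s"
    using hs by (simp add: p_def p1_def q_def half_diff_def quot_def z_eq field_simps)
  have q: "\<bar>q s\<bar> \<le> 2 * M + 1"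
    using quot_bound[of True "h s" "y s" s] quot_bound[of False "h s" "y s" s]
    by (simp add: q_def abs_le_iff field_simps)
  define \<beta> where "\<beta> = (speed v \<sigma> (z s) s - speed v \<sigma> (y s) s) / h s"
  have "\<bar>\<beta>\<bar> \<le> ?B"
    using speed_lip[OF v, of \<sigma> "z s" s "y s"] hs by (simp add: \<beta>_def abs_divide divide_le_eq h_def)
  moreover have "\<bar>\<beta> - sg \<sigma> * c' p * q s\<bar> \<le> w * (2 * M + 1)"
  proof -
    have bd: "\<bar>p\<bar> \<le> N + 1" "\<bar>p1\<bar> \<le> N + 1" using phi_bound[OF v] by (auto simp: p_def p1_def)
    have "\<bar>p1 - p\<bar> \<le> (2 * M + 1) * eps"
      unfolding p1p abs_mult using mult_mono[OF h_eps q] eps by (simp add: mult.commute)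
    then have "\<bar>c' r - c' p\<bar> \<le> w" if "r \<in> closed_segment p p1" for r
      using that bd by (intro mod_c) (auto simp: closed_segment_eq_real_ivl split: if_splits)
    from linearization_error[OF c_deriv this]
    have "\<bar>c p1 - c p - c' p * (p1 - p)\<bar> \<le> w * \<bar>p1 - p\<bar>" .
    then have "\<bar>(c p1 - c p - c' p * (h s * q s)) / h s\<bar> \<le> w * \<bar>q s\<bar>"
      unfolding p1p using hs by (simp add: abs_mult abs_divide divide_le_eq mult_ac)
    moreover have "\<beta> - sg \<sigma> * c' p * q s = sg \<sigma> * ((c p1 - c p - c' p * (h s * q s)) / h s)"
      using hs by (simp add: \<beta>_def speed_def p_def p1_def field_simps)
    ultimately have "\<bar>\<beta> - sg \<sigma> * c' p * q s\<bar> \<le> w * \<bar>q s\<bar>" by simp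
    also have "\<dots> \<le> w * (2 * M + 1)" using q w by (intro mult_left_mono) auto
    finally show ?thesis .
  qed
  moreover have "((\<lambda>s. quot \<sigma> (h s) (y s) s) has_real_derivative
        - a s * ((quot True (h s) (y s) s + quot False (h s) (y s) s) / 2)
        - quot \<sigma> (h s) (y s) s * \<beta>) (at s within {0..t})"
  proof -
    have dv: "((\<lambda>s. v \<sigma> (y s) s) has_real_derivative source v (y s) s) (at s within {0..t})"
      if "characteristic (speed v \<sigma>) t y" for y
      using tr[of \<sigma>] that t s unfolding transported_def by blast
    have dh: "(h has_real_derivative speed v \<sigma> (z s) s - speed v \<sigma> (y s) s) (at s within {0..t})"
      unfolding h_def using y z s unfolding characteristic_def by (intro DERIV_diff) auto
    have "((\<lambda>s. (v \<sigma> (z s) s - v \<sigma> (y s) s) / h s) has_real_derivative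
        ((source v (z s) s - source v (y s) s) * h s
          - (v \<sigma> (z s) s - v \<sigma> (y s) s) * (speed v \<sigma> (z s) s - speed v \<sigma> (y s) s)) / (h s * h s))
       (at s within {0..t})"
      by (rule DERIV_divide[OF DERIV_diff[OF dv[OF z] dv[OF y]] dh hs])
    moreover have "((source v (z s) s - source v (y s) s) * h s
          - (v \<sigma> (z s) s - v \<sigma> (y s) s) * (speed v \<sigma> (z s) s - speed v \<sigma> (y s) s)) / (h s * h s)
      = - a s * ((quot True (h s) (y s) s + quot False (h s) (y s) s) / 2)
        - quot \<sigma> (h s) (y s) s * \<beta>"
      unfolding \<beta>_def quot_def source_def half_sum_def z_eq using hs by (simp add: field_simps)
    moreover have "(\<lambda>s. (v \<sigma> (z s) s - v \<sigma> (y s) s) / h s) = (\<lambda>s. quot \<sigma> (h s) (y s) s)"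
      by (auto simp: quot_def z_eq)
    ultimately show ?thesis by simp
  qed
  ultimately show "\<exists>\<beta>. \<bar>\<beta>\<bar> \<le> L * (2 * M + 1) \<and> \<bar>\<beta> - sg \<sigma> * c' (half_diff v (y s) s) * q s\<bar> \<le> w * (2 * M + 1) \<and>
      ((\<lambda>s. quot \<sigma> (h s) (y s) s) has_real_derivative
        - a s * ((quot True (h s) (y s) s + quot False (h s) (y s) s) / 2)
        - quot \<sigma> (h s) (y s) s * \<beta>) (at s within {0..t})"
    by (auto simp: p_def)
qed

lemma quot_initial:
  assumes "\<bar>x\<bar> \<le> R" "h \<noteq> 0" "\<bar>h\<bar> \<le> eps"
  shows "\<bar>quot \<sigma> h x 0 - v0' \<sigma> x\<bar> \<le> w"
proof -
  have "\<bar>v0 \<sigma> (x + h) - v0 \<sigma> x - v0' \<sigma> x * (x + h - x)\<bar> \<le> w * \<bar>x + h - x\<bar>"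
    by (rule linearization_error[OF v0_deriv], rule mod_v0)
      (use assms eps in \<open>auto simp: closed_segment_eq_real_ivl abs_le_iff split: if_splits\<close>)
  moreover have "quot \<sigma> h x 0 - v0' \<sigma> x = (v0 \<sigma> (x + h) - v0 \<sigma> x - v0' \<sigma> x * h) / h"
    using tr[of \<sigma>] assms by (simp add: quot_def transported_def field_simps)
  ultimately show ?thesis using assms by (simp add: abs_divide divide_le_eq)
qed

text \<open>The equations for the quotients with increments \<open>h\<close> and \<open>k\<close> are subtracted along the common
  characteristic through \<open>(x, t)\<close>.  By the last condition on \<open>d\<close> a bound \<open>D\<close> for the distance of all
  quotients is improved to \<open>D / 2\<close> plus an error of the order of the moduli of continuity \<open>w\<close> of
  \<open>v0'\<close> and \<open>c'\<close>.\<close>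

lemma quot_improved:
  assumes t: "0 \<le> t" "t \<le> d" and cone: "\<bar>x\<bar> + Lam * t \<le> R"
    and h: "h \<noteq> 0" "\<bar>h\<bar> \<le> eps * exp (- (L * (2 * M + 1) * t))"
    and k: "k \<noteq> 0" "\<bar>k\<bar> \<le> eps * exp (- (L * (2 * M + 1) * t))"
  shows "\<bar>quot \<sigma> h x t - quot \<sigma> k x t\<bar> \<le> D / 2 + w * (2 + 2 * d * (2 * M + 1)\<^sup>2)"
proof -
  let ?B = "L * (2 * M + 1)"
  obtain y where y: "characteristic (speed v \<sigma>) t y" "y t = x"
    using transport_equation.characteristic_exists[OF transport_equation[OF v] t(1)] .
  obtain yh where yh: "characteristic (speed v \<sigma>) t yh" "yh t = x + h"
    using transport_equation.characteristic_exists[OF transport_equation[OF v] t(1)] .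
  obtain yk where yk: "characteristic (speed v \<sigma>) t yk" "yk t = x + k"
    using transport_equation.characteristic_exists[OF transport_equation[OF v] t(1)] .
  note H = quot_along_characteristic[OF y(1) yh(1) t, unfolded y(2) yh(2) add_diff_cancel_left', OF cone _ h(2)]
  note K = quot_along_characteristic[OF y(1) yk(1) t, unfolded y(2) yk(2) add_diff_cancel_left', OF cone _ k(2)]
  have hk: "x + h \<noteq> x" "x + k \<noteq> x" using h k by auto
  define Qh where "Qh \<tau> s = quot \<tau> (yh s - y s) (y s) s" for \<tau> s
  define Qk where "Qk \<tau> s = quot \<tau> (yk s - y s) (y s) s" for \<tau> s
  have QD: "\<bar>Qh \<tau> s - Qk \<tau> s\<bar> \<le> D" if "s \<in> {0..t}" for \<tau> s
    unfolding Qh_def Qk_def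
    by (rule D) (use H(1-3)[OF hk(1) that] K(1-3)[OF hk(2) that] that t in auto)
  have D0: "0 \<le> D" using order_trans[OF abs_ge_zero QD[of t]] t by simp
  have ex: "\<exists>r. ((\<lambda>s. Qh \<sigma> s - Qk \<sigma> s) has_real_derivative r) (at s within {0..t}) \<and>
      \<bar>r\<bar> \<le> (A + 2 * L * (2 * M + 1)) * D + 2 * w * (2 * M + 1)\<^sup>2"
    if s: "s \<in> {0..t}" for s
  proof -
    define qh where "qh = (Qh True s - Qh False s) / 2"
    define qk where "qk = (Qk True s - Qk False s) / 2"
    define g where "g = sg \<sigma> * c' (half_diff v (y s) s)"
    have g: "\<bar>g\<bar> \<le> L" using c'_bound[OF phi_bound[OF v]] by (simp add: g_def)
    obtain bh where bh: "\<bar>bh\<bar> \<le> ?B" "\<bar>bh - g * qh\<bar> \<le> w * (2 * M + 1)"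
      "(Qh \<sigma> has_real_derivative - a s * ((Qh True s + Qh False s) / 2) - Qh \<sigma> s * bh) (at s within {0..t})"
      using H(4)[OF hk(1) s] unfolding Qh_def qh_def g_def by blast
    obtain bk where bk: "\<bar>bk\<bar> \<le> ?B" "\<bar>bk - g * qk\<bar> \<le> w * (2 * M + 1)"
      "(Qk \<sigma> has_real_derivative - a s * ((Qk True s + Qk False s) / 2) - Qk \<sigma> s * bk) (at s within {0..t})"
      using K(4)[OF hk(2) s] unfolding Qk_def qk_def g_def by blast
    have "\<bar>qh - qk\<bar> \<le> D" using QD[OF s, of True] QD[OF s, of False]
      by (simp add: qh_def qk_def abs_le_iff field_simps)
    then have "\<bar>g * (qh - qk)\<bar> \<le> L * D"
      unfolding abs_mult using g nonneg by (intro mult_mono) auto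
    moreover have "bh - bk = (bh - g * qh) - (bk - g * qk) + g * (qh - qk)" by (simp add: algebra_simps)
    ultimately have bb: "\<bar>bh - bk\<bar> \<le> L * D + 2 * (w * (2 * M + 1))" using bh bk by linarith
    have "\<bar>(Qh \<sigma> s - Qk \<sigma> s) * bh\<bar> \<le> D * ?B"
      unfolding abs_mult using QD[OF s] bh D0 by (intro mult_mono) auto
    moreover have "\<bar>Qk \<sigma> s * (bh - bk)\<bar> \<le> (2 * M + 1) * (L * D + 2 * (w * (2 * M + 1)))"
      unfolding abs_mult using quot_bound bb nonneg by (intro mult_mono) (auto simp: Qk_def)
    moreover have "\<bar>a s * ((Qh True s - Qk True s + (Qh False s - Qk False s)) / 2)\<bar> \<le> A * D"
      unfolding abs_mult using QD[OF s, of True] QD[OF s, of False] nonneg a_bound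
      by (intro mult_mono) (auto simp: abs_le_iff field_simps)
    moreover have "(- a s * ((Qh True s + Qh False s) / 2) - Qh \<sigma> s * bh)
        - (- a s * ((Qk True s + Qk False s) / 2) - Qk \<sigma> s * bk)
      = - (a s * ((Qh True s - Qk True s + (Qh False s - Qk False s)) / 2))
        - (Qh \<sigma> s - Qk \<sigma> s) * bh - Qk \<sigma> s * (bh - bk)"
      by (simp add: field_simps)
    ultimately have "\<bar>(- a s * ((Qh True s + Qh False s) / 2) - Qh \<sigma> s * bh)
        - (- a s * ((Qk True s + Qk False s) / 2) - Qk \<sigma> s * bk)\<bar>
      \<le> A * D + D * ?B + (2 * M + 1) * (L * D + 2 * (w * (2 * M + 1)))"
      by linarith
    then show ?thesis using DERIV_diff[OF bh(3) bk(3)]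
      by (intro exI conjI) (auto simp: algebra_simps power2_eq_square)
  qed
  then obtain r where r: "\<And>s. s \<in> {0..t} \<Longrightarrow> ((\<lambda>s. Qh \<sigma> s - Qk \<sigma> s) has_real_derivative r s) (at s within {0..t})"
      "\<And>s. s \<in> {0..t} \<Longrightarrow> \<bar>r s\<bar> \<le> (A + 2 * L * (2 * M + 1)) * D + 2 * w * (2 * M + 1)\<^sup>2"
    by metis
  have "\<bar>(Qh \<sigma> t - Qk \<sigma> t) - (Qh \<sigma> 0 - Qk \<sigma> 0)\<bar> \<le> ((A + 2 * L * (2 * M + 1)) * D + 2 * w * (2 * M + 1)\<^sup>2) * (t - 0)"
    by (rule bounded_increment[where h = "\<lambda>s. Qh \<sigma> s - Qk \<sigma> s", OF r t(1)])
  also have "\<dots> \<le> ((A + 2 * L * (2 * M + 1)) * D + 2 * w * (2 * M + 1)\<^sup>2) * d"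
    using t nonneg D0 w by (intro mult_left_mono) auto
  also have "\<dots> \<le> D / 2 + w * (2 * d * (2 * M + 1)\<^sup>2)"
    using mult_left_mono[OF d_quot D0] by (simp add: algebra_simps)
  finally have "\<bar>Qh \<sigma> t - Qk \<sigma> t\<bar> \<le> \<bar>Qh \<sigma> 0 - Qk \<sigma> 0\<bar> + D / 2 + w * (2 * d * (2 * M + 1)\<^sup>2)" by linarith
  moreover have "\<bar>Qh \<sigma> 0 - v0' \<sigma> (y 0)\<bar> \<le> w"
    unfolding Qh_def using H(1-3)[OF hk(1), of 0] t by (intro quot_initial) auto
  moreover have "\<bar>Qk \<sigma> 0 - v0' \<sigma> (y 0)\<bar> \<le> w"
    unfolding Qk_def using K(1-3)[OF hk(2), of 0] t by (intro quot_initial) auto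
  moreover have "Qh \<sigma> t = quot \<sigma> h x t" "Qk \<sigma> t = quot \<sigma> k x t"
    using y yh yk by (auto simp: Qh_def Qk_def)
  ultimately show ?thesis by (simp add: algebra_simps)
qed

end

text \<open>Taking for \<open>D\<close> the supremum of the distances, which is finite by the Lipschitz bound, gives
  \<open>D \<le> D / 2 + w m\<close>, hence smallness of \<open>D\<close>.\<close>

lemma quot_uniformly_Cauchy:
  assumes e: "0 < e"
  obtains r where "0 < r" "\<And>\<sigma> x t h k. 0 \<le> t \<Longrightarrow> t \<le> d \<Longrightarrow> \<bar>x\<bar> \<le> R0 \<Longrightarrow>
     h \<noteq> 0 \<Longrightarrow> \<bar>h\<bar> \<le> r \<Longrightarrow> k \<noteq> 0 \<Longrightarrow> \<bar>k\<bar> \<le> r \<Longrightarrow> \<bar>quot \<sigma> h x t - quot \<sigma> k x t\<bar> \<le> e"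
proof -
  define R where "R = R0 + Lam * d"
  let ?B = "L * (2 * M + 1)"
  define m where "m = 2 + 2 * d * (2 * M + 1)\<^sup>2"
  have m: "0 < m" using d by (auto simp: m_def intro!: add_pos_nonneg)
  \<comment> \<open>so that \<open>D \<le> D / 2 + w m\<close> gives \<open>D \<le> e\<close>\<close>
  define w where "w = e / (2 * m)"
  have w: "0 < w" using e m by (simp add: w_def)
  obtain r1 where r1: "0 < r1" "\<And>x y. \<bar>x\<bar> \<le> R + 1 \<Longrightarrow> \<bar>y\<bar> \<le> R + 1 \<Longrightarrow> \<bar>x - y\<bar> \<le> r1 \<Longrightarrow> \<bar>v0' True x - v0' True y\<bar> \<le> w"
    using uniform_modulus[OF v0'_cont w] by metis
  obtain r2 where r2: "0 < r2" "\<And>x y. \<bar>x\<bar> \<le> R + 1 \<Longrightarrow> \<bar>y\<bar> \<le> R + 1 \<Longrightarrow> \<bar>x - y\<bar> \<le> r2 \<Longrightarrow> \<bar>v0' False x - v0' False y\<bar> \<le> w"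
    using uniform_modulus[OF v0'_cont w] by metis
  obtain r3 where r3: "0 < r3" "\<And>x y. \<bar>x\<bar> \<le> N + 1 \<Longrightarrow> \<bar>y\<bar> \<le> N + 1 \<Longrightarrow> \<bar>x - y\<bar> \<le> r3 \<Longrightarrow> \<bar>c' x - c' y\<bar> \<le> w"
    using uniform_modulus[OF c'_cont w] by metis
  define eps where "eps = Min {1, r1, r2, r3 / (2 * M + 1)}"
  have M1: "0 < 2 * M + 1" using nonneg by simp
  have eps: "0 < eps" "eps \<le> 1" "eps \<le> r1" "eps \<le> r2" "eps \<le> r3 / (2 * M + 1)"
    using r1 r2 r3 M1 by (auto simp: eps_def)
  have eps3: "(2 * M + 1) * eps \<le> r3" using eps(5) M1 by (simp add: field_simps)
  \<comment> \<open>the admissible size of the increments shrinks with \<open>t\<close> at the rate at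
    which characteristics separate, so a pair of characteristics that ends in
    \<open>Z\<close> stays in \<open>Z\<close>\<close>
  define Z where "Z = {(\<sigma>::bool, x, t, h, k). 0 \<le> t \<and> t \<le> d \<and> \<bar>x\<bar> + Lam * t \<le> R \<and>
     h \<noteq> 0 \<and> \<bar>h\<bar> \<le> eps * exp (- (?B * t)) \<and> k \<noteq> 0 \<and> \<bar>k\<bar> \<le> eps * exp (- (?B * t))}"
  define f where "f = (\<lambda>(\<sigma>, x, t, h, k). \<bar>quot \<sigma> h x t - quot \<sigma> k x t\<bar>)"
  have bdd: "bdd_above (f ` Z)"
  proof (rule bdd_aboveI)
    fix r assume "r \<in> f ` Z"
    then obtain \<sigma> x t h k where "r = \<bar>quot \<sigma> h x t - quot \<sigma> k x t\<bar>" by (auto simp: f_def)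
    then show "r \<le> 2 * (2 * M + 1)" using quot_bound[of \<sigma> h x t] quot_bound[of \<sigma> k x t]
        abs_triangle_ineq4[of "quot \<sigma> h x t" "quot \<sigma> k x t"] by simp
  qed
  have upper: "\<bar>quot \<sigma> h x t - quot \<sigma> k x t\<bar> \<le> (SUP z\<in>Z. f z)" if "(\<sigma>, x, t, h, k) \<in> Z" for \<sigma> x t h k
    using cSUP_upper[OF that bdd] by (simp add: f_def)
  have improved: "f z \<le> (SUP z\<in>Z. f z) / 2 + w * m" if "z \<in> Z" for z
  proof -
    obtain \<sigma> x t h k where z: "z = (\<sigma>, x, t, h, k)" by (cases z)
    have mv0: "\<bar>v0' \<sigma> x - v0' \<sigma> y\<bar> \<le> w" if "\<bar>x\<bar> \<le> R + 1" "\<bar>y\<bar> \<le> R + 1" "\<bar>x - y\<bar> \<le> eps" for \<sigma> x y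
      using r1(2)[of x y] r2(2)[of x y] that eps by (cases \<sigma>) auto
    have mc: "\<bar>c' x - c' y\<bar> \<le> w" if "\<bar>x\<bar> \<le> N + 1" "\<bar>y\<bar> \<le> N + 1" "\<bar>x - y\<bar> \<le> (2 * M + 1) * eps" for x y
      using r3(2)[of x y] that eps3 by auto
    have "\<bar>quot \<sigma> h x t - quot \<sigma> k x t\<bar> \<le> (SUP z\<in>Z. f z) / 2 + w * (2 + 2 * d * (2 * M + 1)\<^sup>2)"
      by (rule quot_improved[OF w eps(1,2) mv0 mc upper])
        (use that in \<open>auto simp: Z_def z\<close>)
    moreover have "f z = \<bar>quot \<sigma> h x t - quot \<sigma> k x t\<bar>" by (simp add: f_def z)
    ultimately show ?thesis by (simp add: m_def)
  qed
  have small: "f z \<le> e" if "z \<in> Z" for z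
  proof -
    have "(SUP z\<in>Z. f z) \<le> (SUP z\<in>Z. f z) / 2 + w * m"
      using that by (intro cSUP_least improved) auto
    then have "(SUP z\<in>Z. f z) \<le> e" using m by (simp add: w_def field_simps)
    then show ?thesis using cSUP_upper[OF that bdd] by simp
  qed
  show ?thesis
  proof (rule that[of "eps * exp (- (?B * d))"])
    show "0 < eps * exp (- (?B * d))" using eps by simp
    fix \<sigma> x t h k
    assume t: "0 \<le> t" "t \<le> d" and x: "\<bar>x\<bar> \<le> R0" and hk: "h \<noteq> 0" "\<bar>h\<bar> \<le> eps * exp (- (?B * d))"
      "k \<noteq> 0" "\<bar>k\<bar> \<le> eps * exp (- (?B * d))"
    have "eps * exp (- (?B * d)) \<le> eps * exp (- (?B * t))"
      using t eps nonneg by (auto intro!: mult_left_mono)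
    moreover have "Lam * t \<le> Lam * d" using t nonneg by (intro mult_left_mono)
    ultimately have "(\<sigma>, x, t, h, k) \<in> Z" using t x hk by (auto simp: Z_def R_def)
    from small[OF this] show "\<bar>quot \<sigma> h x t - quot \<sigma> k x t\<bar> \<le> e" by (simp add: f_def)
  qed
qed

end
end


section \<open>Local existence of differentiable solutions\<close>

lemma isCont_curried:
  fixes f :: "real \<Rightarrow> real \<Rightarrow> real"
  assumes "continuous_on U (\<lambda>(x, t). f x t)" "open U" "(x, t) \<in> U" "0 < e"
  obtains r where "0 < r" "\<And>y s. \<bar>y - x\<bar> \<le> r \<Longrightarrow> \<bar>s - t\<bar> \<le> r \<Longrightarrow> \<bar>f y s - f x t\<bar> \<le> e"
proof -
  have "isCont (\<lambda>(x, t). f x t) (x, t)"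
    using assms continuous_on_eq_continuous_at by blast
  then obtain r where r: "0 < r" "\<And>p. dist p (x, t) < r \<Longrightarrow> dist (case p of (x, t) \<Rightarrow> f x t) (f x t) < e"
    using assms(4) unfolding continuous_at_eps_delta by auto
  show ?thesis
  proof (rule that[of "r / 4"])
    fix y s assume *: "\<bar>y - x\<bar> \<le> r / 4" "\<bar>s - t\<bar> \<le> r / 4"
    have "dist (y, s) (x, t) \<le> dist y x + dist s t"
      unfolding dist_Pair_Pair by (rule sqrt_sum_squares_le_sum) auto
    also have "\<dots> < r" using * r(1) by (simp add: dist_real_def)
    finally show "\<bar>f y s - f x t\<bar> \<le> e" using r(2)[of "(y, s)"] by (simp add: dist_real_def)
  qed (use r in auto)
qed

text \<open>Both one-sided difference quotients are covered by increments from an earlier time \<open>s1\<close> to a later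
  time \<open>s2\<close>, one of which is \<open>t\<close>.  This suits functions that are followed along characteristics.\<close>

lemma DERIV_from_increments:
  fixes f :: "real \<Rightarrow> real"
  assumes "\<And>e. 0 < e \<Longrightarrow> \<exists>r>0. \<forall>s1 s2. s1 < s2 \<longrightarrow> (s1 = t \<or> s2 = t) \<longrightarrow> \<bar>s1 - t\<bar> \<le> r \<longrightarrow> \<bar>s2 - t\<bar> \<le> r \<longrightarrow>
     \<bar>f s2 - f s1 - m * (s2 - s1)\<bar> \<le> e * (s2 - s1)"
  shows "(f has_real_derivative m) (at t)"
  unfolding DERIV_def LIM_def
proof (intro allI impI)
  fix e :: real assume "0 < e"
  then have "0 < e / 2" by simp
  from assms[OF this] obtain r where r: "0 < r" "\<And>s1 s2. s1 < s2 \<Longrightarrow> s1 = t \<or> s2 = t \<Longrightarrow> \<bar>s1 - t\<bar> \<le> r \<Longrightarrow> \<bar>s2 - t\<bar> \<le> r \<Longrightarrow>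
     \<bar>f s2 - f s1 - m * (s2 - s1)\<bar> \<le> e / 2 * (s2 - s1)"
    by blast
  show "\<exists>r>0. \<forall>h. h \<noteq> 0 \<and> dist h 0 < r \<longrightarrow> dist ((f (t + h) - f t) / h) m < e"
  proof (intro exI[of _ r] conjI allI impI)
    fix h :: real assume h: "h \<noteq> 0 \<and> dist h 0 < r"
    have "\<bar>f (t + h) - f t - m * h\<bar> \<le> e / 2 * \<bar>h\<bar>"
      using r(2)[of t "t + h"] r(2)[of "t + h" t] h by (cases "0 < h") (auto simp: algebra_simps)
    moreover have "(f (t + h) - f t) / h - m = (f (t + h) - f t - m * h) / h"
      using h by (simp add: field_simps)
    ultimately have "\<bar>(f (t + h) - f t) / h - m\<bar> \<le> e / 2"
      using h by (simp add: abs_divide divide_le_eq)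
    then show "dist ((f (t + h) - f t) / h) m < e" using \<open>0 < e\<close> by (simp add: dist_real_def)
  qed (use r in auto)
qed

context cauchy_data
begin

context
  fixes v assumes v: "admissible v"
    and tr: "\<And>\<sigma>. transported (speed v \<sigma>) (source v) (v0 \<sigma>) d (v \<sigma>)"
begin

definition v_x :: "bool \<Rightarrow> real \<Rightarrow> real \<Rightarrow> real" where
  "v_x \<sigma> x t = lim (\<lambda>n. quot v \<sigma> (inverse (Suc n)) x t)"

lemma quot_tendsto:
  assumes e: "0 < e"
  obtains r where "0 < r" "\<And>\<sigma> x t h. 0 \<le> t \<Longrightarrow> t \<le> d \<Longrightarrow> \<bar>x\<bar> \<le> R \<Longrightarrow>
     h \<noteq> 0 \<Longrightarrow> \<bar>h\<bar> \<le> r \<Longrightarrow> \<bar>quot v \<sigma> h x t - v_x \<sigma> x t\<bar> \<le> e"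
proof -
  define f where "f = (\<lambda>\<sigma> x t n. quot v \<sigma> (inverse (Suc n)) x t)"
  have ev: "\<forall>\<^sub>F n in sequentially. inverse (real (Suc n)) \<le> r" if "0 < r" for r
    using LIMSEQ_inverse_real_of_nat that
    by (metis (mono_tags, lifting) eventually_mono less_imp_le order_tendstoD(2))
  have conv: "f \<sigma> x t \<longlonglongrightarrow> v_x \<sigma> x t" if t: "0 \<le> t" "t \<le> d" for \<sigma> x t
  proof -
    have "Cauchy (f \<sigma> x t)"
    proof (rule metric_CauchyI)
      fix e :: real assume "0 < e"
      then have "0 < e / 2" by simp
      from quot_uniformly_Cauchy[OF v tr this, where ?R0.0 = "\<bar>x\<bar>"]
      obtain r where r: "0 < r" "\<And>h k. h \<noteq> 0 \<Longrightarrow> \<bar>h\<bar> \<le> r \<Longrightarrow> k \<noteq> 0 \<Longrightarrow> \<bar>k\<bar> \<le> r \<Longrightarrow>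
          \<bar>quot v \<sigma> h x t - quot v \<sigma> k x t\<bar> \<le> e / 2"
        using t by (metis order_refl)
      obtain n0 where "\<And>n. n0 \<le> n \<Longrightarrow> inverse (real (Suc n)) \<le> r"
        using ev[OF r(1)] unfolding eventually_sequentially by blast
      then show "\<exists>M. \<forall>m\<ge>M. \<forall>n\<ge>M. dist (f \<sigma> x t m) (f \<sigma> x t n) < e"
        unfolding f_def dist_real_def
        by (intro exI[of _ n0] allI impI le_less_trans[OF r(2)]) (use \<open>0 < e\<close> in auto)
    qed
    then show ?thesis
      unfolding v_x_def f_def[symmetric] using Cauchy_convergent convergent_LIMSEQ_iff
      by (auto simp: f_def)
  qed
  from quot_uniformly_Cauchy[OF v tr e, where ?R0.0 = R]
  obtain r where r: "0 < r" "\<And>\<sigma> x t h k. 0 \<le> t \<Longrightarrow> t \<le> d \<Longrightarrow> \<bar>x\<bar> \<le> R \<Longrightarrow>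
     h \<noteq> 0 \<Longrightarrow> \<bar>h\<bar> \<le> r \<Longrightarrow> k \<noteq> 0 \<Longrightarrow> \<bar>k\<bar> \<le> r \<Longrightarrow> \<bar>quot v \<sigma> h x t - quot v \<sigma> k x t\<bar> \<le> e"
    by metis
  show ?thesis
  proof (rule that[OF r(1)])
    fix \<sigma> x t h assume *: "0 \<le> t" "t \<le> d" "\<bar>x\<bar> \<le> R" "h \<noteq> 0" "\<bar>h\<bar> \<le> r"
    have "(\<lambda>n. \<bar>quot v \<sigma> h x t - f \<sigma> x t n\<bar>) \<longlonglongrightarrow> \<bar>quot v \<sigma> h x t - v_x \<sigma> x t\<bar>"
      by (intro tendsto_intros conv *)
    then show "\<bar>quot v \<sigma> h x t - v_x \<sigma> x t\<bar> \<le> e"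
      by (rule tendsto_upperbound)
        (use r(2)[OF *] in \<open>auto simp: f_def intro!: eventually_mono[OF ev[OF r(1)]]\<close>)
  qed
qed

lemma v_x_deriv:
  assumes "0 \<le> t" "t \<le> d"
  shows "((\<lambda>x. v \<sigma> x t) has_real_derivative v_x \<sigma> x t) (at x)"
  unfolding DERIV_def LIM_def
proof (intro allI impI)
  fix e :: real assume e: "0 < e"
  then have "0 < e / 2" by simp
  from quot_tendsto[OF this, where R = "\<bar>x\<bar>"]
  obtain r where r: "0 < r" "\<And>h. h \<noteq> 0 \<Longrightarrow> \<bar>h\<bar> \<le> r \<Longrightarrow> \<bar>quot v \<sigma> h x t - v_x \<sigma> x t\<bar> \<le> e / 2"
    using assms by (metis order_refl)
  show "\<exists>r>0. \<forall>h. h \<noteq> 0 \<and> dist h 0 < r \<longrightarrow> dist ((v \<sigma> (x + h) t - v \<sigma> x t) / h) (v_x \<sigma> x t) < e"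
    unfolding quot_def[OF v tr, symmetric] dist_real_def
    by (intro exI[of _ r] conjI allI impI le_less_trans[OF r(2)]) (use r e in auto)
qed

text \<open>The difference quotients are continuous and converge locally uniformly.\<close>

lemma v_x_cont: "continuous_on (UNIV \<times> {0<..<d}) (\<lambda>(x, t). v_x \<sigma> x t)"
proof -
  have "continuous_on ({-R<..<R} \<times> {0<..<d}) (\<lambda>(x, t). v_x \<sigma> x t)" for R
  proof (rule uniform_limit_theorem)
    show "\<forall>\<^sub>F n in sequentially. continuous_on ({-R<..<R} \<times> {0<..<d}) (\<lambda>(x, t). quot v \<sigma> (inverse (Suc n)) x t)"
    proof (rule always_eventually, rule allI)
      fix n
      have "continuous_on ({-R<..<R} \<times> {0<..<d}) (\<lambda>p. case (fst p + h, snd p) of (x, t) \<Rightarrow> v \<sigma> x t)" for h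
        by (rule continuous_on_compose2[OF v_cont[OF v]]) (auto intro!: continuous_intros)
      from this[of "inverse (Suc n)"] this[of 0]
      show "continuous_on ({-R<..<R} \<times> {0<..<d}) (\<lambda>(x, t). quot v \<sigma> (inverse (Suc n)) x t)"
        unfolding quot_def[OF v tr] case_prod_beta by (intro continuous_intros) auto
    qed
    show "uniform_limit ({-R<..<R} \<times> {0<..<d}) (\<lambda>n (x, t). quot v \<sigma> (inverse (Suc n)) x t)
       (\<lambda>(x, t). v_x \<sigma> x t) sequentially"
    proof (rule uniform_limitI)
      fix e :: real assume e: "0 < e"
      then have "0 < e / 2" by simp
      from quot_tendsto[OF this, where R = R]
      obtain r where r: "0 < r" "\<And>x t h. 0 \<le> t \<Longrightarrow> t \<le> d \<Longrightarrow> \<bar>x\<bar> \<le> R \<Longrightarrow> h \<noteq> 0 \<Longrightarrow> \<bar>h\<bar> \<le> r \<Longrightarrow>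
          \<bar>quot v \<sigma> h x t - v_x \<sigma> x t\<bar> \<le> e / 2"
        by metis
      have "\<forall>\<^sub>F n in sequentially. inverse (real (Suc n)) < r"
        using LIMSEQ_inverse_real_of_nat r(1) by (rule order_tendstoD)
      then show "\<forall>\<^sub>F n in sequentially. \<forall>p\<in>{-R<..<R} \<times> {0<..<d}.
          dist (case p of (x, t) \<Rightarrow> quot v \<sigma> (inverse (Suc n)) x t) (case p of (x, t) \<Rightarrow> v_x \<sigma> x t) < e"
        by (rule eventually_mono) (use r(2) e in \<open>auto simp: dist_real_def intro!: le_less_trans[OF r(2)]\<close>)
    qed
  qed simp
  then have "continuous_on (\<Union>n::nat. {-real n<..<real n} \<times> {0<..<d}) (\<lambda>(x, t). v_x \<sigma> x t)"
    by (intro continuous_on_open_UN open_Times) auto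
  moreover have "(\<Union>n::nat. {-real n<..<real n} \<times> {0<..<d}) = UNIV \<times> {0<..<d}"
  proof -
    have "\<exists>n::nat. - real n < x \<and> x < real n" for x
    proof -
      obtain n :: nat where "\<bar>x\<bar> < real n" using reals_Archimedean2 by blast
      then show ?thesis by (intro exI[of _ n]) auto
    qed
    then show ?thesis by auto
  qed
  ultimately show ?thesis by simp
qed

text \<open>From \<open>(x, s2)\<close> go back along the characteristic to time \<open>s1\<close> and then horizontally to \<open>(x, s1)\<close>.
  The first part contributes the source, the second the speed times the space derivative.\<close>

lemma v_t_deriv:
  assumes t: "0 < t" "t < d"
  shows "(v \<sigma> x has_real_derivative source v x t - speed v \<sigma> x t * v_x \<sigma> x t) (at t)"
proof (rule DERIV_from_increments)
  fix e :: real assume e: "0 < e"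
  define m where "m = 2 + Lam + \<bar>v_x \<sigma> x t\<bar>"
  have m: "0 < m" using nonneg by (simp add: m_def)
  define w where "w = e / m"
  have w: "0 < w" using e m by (simp add: w_def)
  obtain r1 where r1: "0 < r1" "\<And>y s. \<bar>y - x\<bar> \<le> r1 \<Longrightarrow> \<bar>s - t\<bar> \<le> r1 \<Longrightarrow> \<bar>v_x \<sigma> y s - v_x \<sigma> x t\<bar> \<le> w"
    using isCont_curried[OF v_x_cont _ _ w, of x t \<sigma>] open_Times[OF open_UNIV open_greaterThanLessThan, of 0 d] t by auto
  obtain r2 where r2: "0 < r2" "\<And>y s. \<bar>y - x\<bar> \<le> r2 \<Longrightarrow> \<bar>s - t\<bar> \<le> r2 \<Longrightarrow> \<bar>source v y s - source v x t\<bar> \<le> w"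
    using isCont_curried[OF source_cont[OF v] _ _ w, of x t] by auto
  obtain r3 where r3: "0 < r3" "\<And>y s. \<bar>y - x\<bar> \<le> r3 \<Longrightarrow> \<bar>s - t\<bar> \<le> r3 \<Longrightarrow> \<bar>speed v \<sigma> y s - speed v \<sigma> x t\<bar> \<le> w"
    using isCont_curried[OF speed_cont[OF v] _ _ w, of x t] by auto
  define r0 where "r0 = Min {r1, r2, r3}"
  have r0: "0 < r0" "r0 \<le> r1" "r0 \<le> r2" "r0 \<le> r3" using r1 r2 r3 by (auto simp: r0_def)
  \<comment> \<open>within time \<open>r\<close> of \<open>t\<close> no characteristic leaves the
    neighbourhood of radius \<open>r0\<close>\<close>
  define r where "r = Min {t / 2, (d - t) / 2, r0, r0 / (Lam + 1)}"
  have "0 < r" using t r0 nonneg unfolding r_def by (subst Min_gr_iff) auto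
  moreover have "r \<le> t / 2" "r \<le> (d - t) / 2" "r \<le> r0" "r \<le> r0 / (Lam + 1)"
    unfolding r_def by (intro Min.coboundedI; simp)+
  ultimately have r: "0 < r" "r \<le> t / 2" "r \<le> (d - t) / 2" "r \<le> r0" "r \<le> r0 / (Lam + 1)"
    by blast+
  have rL: "Lam * r \<le> r0" using r nonneg by (simp add: field_simps)
  show "\<exists>r>0. \<forall>s1 s2. s1 < s2 \<longrightarrow> (s1 = t \<or> s2 = t) \<longrightarrow> \<bar>s1 - t\<bar> \<le> r \<longrightarrow> \<bar>s2 - t\<bar> \<le> r \<longrightarrow>
     \<bar>v \<sigma> x s2 - v \<sigma> x s1 - (source v x t - speed v \<sigma> x t * v_x \<sigma> x t) * (s2 - s1)\<bar> \<le> e * (s2 - s1)"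
  proof (intro exI[of _ r] conjI allI impI r(1))
    fix s1 s2 assume s: "s1 < s2" "s1 = t \<or> s2 = t" "\<bar>s1 - t\<bar> \<le> r" "\<bar>s2 - t\<bar> \<le> r"
    have s': "0 \<le> s1" "s2 \<le> d" "0 \<le> s2" "s2 - s1 \<le> r" using s r by (auto simp: abs_le_iff)
    obtain y where y: "characteristic (speed v \<sigma>) s2 y" "y s2 = x"
      using transport_equation.characteristic_exists[OF transport_equation[OF v] s'(3)] .
    have near: "\<bar>y s - x\<bar> \<le> Lam * (s2 - s)" if "s \<in> {s1..s2}" for s
      using characteristic_cone[OF v tr y(1), of s] y(2) that s' by (auto simp: abs_minus_commute)
    have near0: "\<bar>y s - x\<bar> \<le> r0" "\<bar>s - t\<bar> \<le> r0" if "s \<in> {s1..s2}" for s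
    proof -
      have "Lam * (s2 - s) \<le> Lam * r" using that s' nonneg by (intro mult_left_mono) auto
      then show "\<bar>y s - x\<bar> \<le> r0" using near[OF that] rL by linarith
      show "\<bar>s - t\<bar> \<le> r0" using s r that by (auto simp: abs_le_iff)
    qed
    have sub: "(f has_real_derivative f') (at u within {s1..s2})"
      if "(f has_real_derivative f') (at u within {0..s2})" for f f' u
      by (rule has_field_derivative_subset[OF that]) (use s' in auto)
    have 1: "\<bar>(v \<sigma> (y s2) s2 - source v x t * s2) - (v \<sigma> (y s1) s1 - source v x t * s1)\<bar> \<le> w * (s2 - s1)"
    proof (rule bounded_increment[where h = "\<lambda>s. v \<sigma> (y s) s - source v x t * s" and h' = "\<lambda>s. source v (y s) s - source v x t"])
      fix u assume u: "u \<in> {s1..s2}"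
      have "((\<lambda>s. v \<sigma> (y s) s) has_real_derivative source v (y u) u) (at u within {s1..s2})"
        using tr[of \<sigma>] y u s' unfolding transported_def by (intro sub) auto
      then show "((\<lambda>s. v \<sigma> (y s) s - source v x t * s) has_real_derivative source v (y u) u - source v x t) (at u within {s1..s2})"
        by (auto intro!: derivative_eq_intros)
      show "\<bar>source v (y u) u - source v x t\<bar> \<le> w" using near0[OF u] r0 by (intro r2(2)) auto
    qed (use s in auto)
    have 2: "\<bar>(y s2 - speed v \<sigma> x t * s2) - (y s1 - speed v \<sigma> x t * s1)\<bar> \<le> w * (s2 - s1)"
    proof (rule bounded_increment[where h = "\<lambda>s. y s - speed v \<sigma> x t * s" and h' = "\<lambda>s. speed v \<sigma> (y s) s - speed v \<sigma> x t"])
      fix u assume u: "u \<in> {s1..s2}"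
      have "(y has_real_derivative speed v \<sigma> (y u) u) (at u within {s1..s2})"
        using y u s' unfolding characteristic_def by (intro sub) auto
      then show "((\<lambda>s. y s - speed v \<sigma> x t * s) has_real_derivative speed v \<sigma> (y u) u - speed v \<sigma> x t) (at u within {s1..s2})"
        by (auto intro!: derivative_eq_intros)
      show "\<bar>speed v \<sigma> (y u) u - speed v \<sigma> x t\<bar> \<le> w" using near0[OF u] r0 by (intro r3(2)) auto
    qed (use s in auto)
    have s1: "s1 \<in> {s1..s2}" using s by simp
    have 3: "\<bar>v \<sigma> (y s1) s1 - v \<sigma> x s1 - v_x \<sigma> x t * (y s1 - x)\<bar> \<le> w * \<bar>y s1 - x\<bar>"
    proof (rule linearization_error[OF v_x_deriv])
      fix z assume "z \<in> closed_segment x (y s1)"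
      then have "\<bar>z - x\<bar> \<le> r0" using near0(1)[OF s1]
        by (auto simp: closed_segment_eq_real_ivl split: if_splits)
      then show "\<bar>v_x \<sigma> z s1 - v_x \<sigma> x t\<bar> \<le> w" using near0(2)[OF s1] r0 by (intro r1(2)) auto
    qed (use s s' in auto)
    have 4: "w * \<bar>y s1 - x\<bar> \<le> w * (Lam * (s2 - s1))" using near[OF s1] w by (intro mult_left_mono) auto
    have 5: "\<bar>v_x \<sigma> x t * (y s1 - x + speed v \<sigma> x t * (s2 - s1))\<bar> \<le> \<bar>v_x \<sigma> x t\<bar> * (w * (s2 - s1))"
      unfolding abs_mult using 2 y(2) by (intro mult_left_mono) (auto simp: algebra_simps abs_minus_commute)
    have "v \<sigma> x s2 - v \<sigma> x s1 - (source v x t - speed v \<sigma> x t * v_x \<sigma> x t) * (s2 - s1)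
      = ((v \<sigma> (y s2) s2 - source v x t * s2) - (v \<sigma> (y s1) s1 - source v x t * s1))
        + (v \<sigma> (y s1) s1 - v \<sigma> x s1 - v_x \<sigma> x t * (y s1 - x))
        + v_x \<sigma> x t * (y s1 - x + speed v \<sigma> x t * (s2 - s1))"
      using y(2) by (simp add: algebra_simps)
    then have "\<bar>v \<sigma> x s2 - v \<sigma> x s1 - (source v x t - speed v \<sigma> x t * v_x \<sigma> x t) * (s2 - s1)\<bar>
      \<le> w * (s2 - s1) + w * (Lam * (s2 - s1)) + \<bar>v_x \<sigma> x t\<bar> * (w * (s2 - s1))"
      using 1 3 4 5 by linarith
    also have "\<dots> = w * (m - 1) * (s2 - s1)" by (simp add: m_def algebra_simps)
    also have "\<dots> \<le> w * m * (s2 - s1)" using w s by (intro mult_right_mono mult_left_mono) auto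
    also have "\<dots> = e * (s2 - s1)" using m by (simp add: w_def)
    finally show "\<bar>v \<sigma> x s2 - v \<sigma> x s1 - (source v x t - speed v \<sigma> x t * v_x \<sigma> x t) * (s2 - s1)\<bar> \<le> e * (s2 - s1)" .
  qed
qed

end

text \<open>The existence theorem: the life span \<open>d\<close> and the bounds are those of the data, uniformly in space.\<close>

theorem local_solution:
  "\<exists>v vx. (\<forall>\<sigma>. continuous_on (UNIV \<times> {0..}) (\<lambda>(x, t). v \<sigma> x t)) \<and>
     (\<forall>\<sigma> x t. \<bar>v \<sigma> x t\<bar> \<le> N + 1) \<and> (\<forall>\<sigma> x. v \<sigma> x 0 = v0 \<sigma> x) \<and>
     (\<forall>\<sigma>. continuous_on (UNIV \<times> {0<..<d}) (\<lambda>(x, t). vx \<sigma> x t)) \<and>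
     (\<forall>\<sigma> x. \<forall>t\<in>{0<..<d}. \<bar>vx \<sigma> x t\<bar> \<le> 2 * M + 1 \<and>
        ((\<lambda>x. v \<sigma> x t) has_real_derivative vx \<sigma> x t) (at x) \<and>
        (v \<sigma> x has_real_derivative
           - a t * half_sum v x t - sg \<sigma> * c (half_diff v x t) * vx \<sigma> x t) (at t))"
proof -
  obtain v where v: "admissible v" and tr: "\<And>\<sigma>. transported (speed v \<sigma>) (source v) (v0 \<sigma>) d (v \<sigma>)"
    using fixed_point_exists by blast
  have bd: "\<bar>v_x v \<sigma> x t\<bar> \<le> 2 * M + 1" if t: "0 < t" "t < d" for \<sigma> x t
  proof (rule field_le_epsilon)
    fix e :: real assume "0 < e"
    from quot_tendsto[OF v tr this, where R = "\<bar>x\<bar>"]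
    obtain r where r: "0 < r" "\<And>h. h \<noteq> 0 \<Longrightarrow> \<bar>h\<bar> \<le> r \<Longrightarrow> \<bar>quot v \<sigma> h x t - v_x v \<sigma> x t\<bar> \<le> e"
      using t by (metis order_refl less_imp_le)
    show "\<bar>v_x v \<sigma> x t\<bar> \<le> 2 * M + 1 + e"
      using r(2)[of r] r(1) quot_bound[OF v tr, of \<sigma> r x t] by linarith
  qed
  show ?thesis
  proof (rule exI[of _ v], rule exI[of _ "v_x v"], intro conjI allI ballI)
    fix \<sigma> x t assume t: "t \<in> {0<..<d}"
    show "(v \<sigma> x has_real_derivative
           - a t * half_sum v x t - sg \<sigma> * c (half_diff v x t) * v_x v \<sigma> x t) (at t)"
      using v_t_deriv[OF v tr, of t \<sigma> x] t by (simp add: source_def speed_def)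
    show "((\<lambda>x. v \<sigma> x t) has_real_derivative v_x v \<sigma> x t) (at x)"
      using v_x_deriv[OF v tr, of t \<sigma> x] t by simp
    show "\<bar>v_x v \<sigma> x t\<bar> \<le> 2 * M + 1" using bd t by simp
  next
    show "continuous_on (UNIV \<times> {0<..<d}) (\<lambda>(x, t). v_x v \<sigma> x t)" for \<sigma>
      by (rule v_x_cont[OF v tr])
    show "continuous_on (UNIV \<times> {0..}) (\<lambda>(x, t). v \<sigma> x t)" for \<sigma>
      using v_cont[OF v, of \<sigma>] by (rule continuous_on_subset) simp
    show "\<bar>v \<sigma> x t\<bar> \<le> N + 1" for \<sigma> x t by (rule v_bound[OF v])
    show "v \<sigma> x 0 = v0 \<sigma> x" for \<sigma> x using tr[of \<sigma>] by (simp add: transported_def)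
  qed
qed

end

lemma existence_time:
  fixes N M A L :: real
  obtains d where "0 < d" "exp (L * (2 * M + 1) * d) \<le> 2" "2 * d * A * (2 * M + 1) \<le> 1"
    "d * A * (N + 1) \<le> 1"
    "M * (2 * L * d) + d * A * (1 + (2 * M + 1) * (2 * L * d)) \<le> 1/2"
    "d * (A + 2 * L * (2 * M + 1)) \<le> 1/2"
proof -
  have "\<forall>\<^sub>F d in at_right 0. 0 < d \<and> exp (L * (2 * M + 1) * d) < 2 \<and> 2 * d * A * (2 * M + 1) < 1 \<and>
    d * A * (N + 1) < 1 \<and>
    M * (2 * L * d) + d * A * (1 + (2 * M + 1) * (2 * L * d)) < 1/2 \<and>
    d * (A + 2 * L * (2 * M + 1)) < 1/2"
    by (intro eventually_conj eventually_at_right_less;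
        rule order_tendstoD(2)[where y = 0] order_tendstoD(2)[where y = 1];
        (rule tendsto_eq_intros refl | simp)+)
  then obtain d where "0 < d \<and> exp (L * (2 * M + 1) * d) < 2 \<and> 2 * d * A * (2 * M + 1) < 1 \<and>
    d * A * (N + 1) < 1 \<and>
    M * (2 * L * d) + d * A * (1 + (2 * M + 1) * (2 * L * d)) < 1/2 \<and>
    d * (A + 2 * L * (2 * M + 1)) < 1/2"
    using eventually_happens trivial_limit_at_right_real by blast
  then show ?thesis by (intro that[of d]) auto
qed


section \<open>A priori bound and uniqueness\<close>

text \<open>The diagonal system with right-hand side \<open>- a u\<close>.  At \<open>t = 0\<close> only continuity of the invariants is
  required.\<close>

definition riemann_solution ::
  "(real \<Rightarrow> real) \<Rightarrow> (real \<Rightarrow> real) \<Rightarrow> real \<Rightarrow> (bool \<Rightarrow> real \<Rightarrow> real \<Rightarrow> real) \<Rightarrow> (bool \<Rightarrow> real \<Rightarrow> real \<Rightarrow> real) \<Rightarrow> bool"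
where
  "riemann_solution c a T v vx \<longleftrightarrow>
     (\<forall>\<sigma>. continuous_on (UNIV \<times> {0..<T}) (\<lambda>(x, t). v \<sigma> x t)) \<and>
     (\<forall>\<sigma>. continuous_on (UNIV \<times> {0<..<T}) (\<lambda>(x, t). vx \<sigma> x t)) \<and>
     (\<forall>\<sigma> x. \<forall>t\<in>{0<..<T}. ((\<lambda>x. v \<sigma> x t) has_real_derivative vx \<sigma> x t) (at x) \<and>
        (v \<sigma> x has_real_derivative
           - a t * half_sum v x t - sg \<sigma> * c (half_diff v x t) * vx \<sigma> x t) (at t))"

lemma curve_derivative:
  fixes f fx :: "real \<Rightarrow> real \<Rightarrow> real"
  assumes cont: "continuous_on (UNIV \<times> {p<..<q}) (\<lambda>(x, t). fx x t)"
    and dx: "\<And>x t. t \<in> {p<..<q} \<Longrightarrow> ((\<lambda>x. f x t) has_real_derivative fx x t) (at x)"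
    and dt: "(f (y t) has_real_derivative m) (at t)" and t: "t \<in> {p<..<q}"
    and y: "(y has_real_derivative b) (at t)"
  shows "((\<lambda>s. f (y s) s) has_real_derivative m + b * fx (y t) t) (at t)"
proof -
  define x where "x = y t"
  have "((\<lambda>s. f (y s) s - f x s - fx x t * (y s - x)) has_real_derivative 0) (at t)"
  proof (rule DERIV_from_increments)
    fix e :: real assume e: "0 < e"
    define w where "w = e / (\<bar>b\<bar> + 1)"
    have w: "0 < w" using e by (simp add: w_def)
    obtain r where r: "0 < r" "\<And>y s. \<bar>y - x\<bar> \<le> r \<Longrightarrow> \<bar>s - t\<bar> \<le> r \<Longrightarrow> \<bar>fx y s - fx x t\<bar> \<le> w"
      using isCont_curried[OF cont open_Times[OF open_UNIV open_greaterThanLessThan] _ w, of x t] t by auto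
    have "((\<lambda>s. (y s - y t) / (s - t)) \<longlongrightarrow> b) (at t)"
      using y by (simp add: has_field_derivative_iff)
    from tendstoD[OF this, of 1] obtain r1 where r1: "0 < r1"
      "\<And>s. s \<noteq> t \<Longrightarrow> dist s t < r1 \<Longrightarrow> dist ((y s - y t) / (s - t)) b < 1"
      by (auto simp: eventually_at)
    have y_lip: "\<bar>y s - x\<bar> \<le> (\<bar>b\<bar> + 1) * \<bar>s - t\<bar>" if "dist s t < r1" for s
    proof (cases "s = t")
      case False
      have "\<bar>(y s - x) / (s - t)\<bar> \<le> \<bar>b\<bar> + 1"
        using r1(2)[OF False that] unfolding dist_real_def x_def by linarith
      then show ?thesis using False by (simp add: abs_divide divide_le_eq)
    qed (simp add: x_def)
    define r' where "r' = Min {r, r / (\<bar>b\<bar> + 1), (t - p) / 2, (q - t) / 2, r1 / 2}"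
    have "0 < r'" unfolding r'_def using r t r1 by (subst Min_gr_iff) auto
    moreover have "r' \<le> r" "r' \<le> r / (\<bar>b\<bar> + 1)" "r' \<le> (t - p) / 2" "r' \<le> (q - t) / 2" "r' \<le> r1 / 2"
      unfolding r'_def by (intro Min.coboundedI; simp)+
    ultimately have r': "0 < r'" "r' \<le> r" "r' \<le> r / (\<bar>b\<bar> + 1)" "r' \<le> (t - p) / 2" "r' \<le> (q - t) / 2" "r' \<le> r1 / 2"
      by blast+
    have key: "\<bar>f (y s) s - f x s - fx x t * (y s - x)\<bar> \<le> e * \<bar>s - t\<bar>" if s: "\<bar>s - t\<bar> \<le> r'" for s
    proof -
      have yl: "\<bar>y s - x\<bar> \<le> (\<bar>b\<bar> + 1) * \<bar>s - t\<bar>" using s r' by (intro y_lip) (auto simp: dist_real_def)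
      also have "\<dots> \<le> (\<bar>b\<bar> + 1) * r'" using s by (intro mult_left_mono) auto
      also have "\<dots> \<le> r" using r' by (simp add: field_simps)
      finally have yr: "\<bar>y s - x\<bar> \<le> r" .
      have "\<bar>f (y s) s - f x s - fx x t * (y s - x)\<bar> \<le> w * \<bar>y s - x\<bar>"
      proof (rule linearization_error[OF dx])
        show "s \<in> {p<..<q}" using s r' t by (auto simp: abs_le_iff)
        fix z assume "z \<in> closed_segment x (y s)"
        then have "\<bar>z - x\<bar> \<le> r" using yr by (auto simp: closed_segment_eq_real_ivl split: if_splits)
        then show "\<bar>fx z s - fx x t\<bar> \<le> w" using s r' by (intro r(2)) auto
      qed
      also have "\<dots> \<le> w * ((\<bar>b\<bar> + 1) * \<bar>s - t\<bar>)" using yl w by (intro mult_left_mono) auto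
      also have "\<dots> = e * \<bar>s - t\<bar>" unfolding w_def by (simp add: add_nonneg_eq_0_iff)
      finally show ?thesis .
    qed
    show "\<exists>r>0. \<forall>s1 s2. s1 < s2 \<longrightarrow> (s1 = t \<or> s2 = t) \<longrightarrow> \<bar>s1 - t\<bar> \<le> r \<longrightarrow> \<bar>s2 - t\<bar> \<le> r \<longrightarrow>
       \<bar>f (y s2) s2 - f x s2 - fx x t * (y s2 - x) - (f (y s1) s1 - f x s1 - fx x t * (y s1 - x)) - 0 * (s2 - s1)\<bar> \<le> e * (s2 - s1)"
    proof (intro exI[of _ r'] conjI allI impI r'(1))
      fix s1 s2 assume s: "s1 < s2" "s1 = t \<or> s2 = t" "\<bar>s1 - t\<bar> \<le> r'" "\<bar>s2 - t\<bar> \<le> r'"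
      from s(2) show "\<bar>f (y s2) s2 - f x s2 - fx x t * (y s2 - x) - (f (y s1) s1 - f x s1 - fx x t * (y s1 - x)) - 0 * (s2 - s1)\<bar> \<le> e * (s2 - s1)"
      proof
        assume "s1 = t" then show ?thesis using key[OF s(4)] s(1) by (simp add: x_def)
      next
        assume "s2 = t" then show ?thesis using key[OF s(3)] s(1) by (simp add: x_def abs_minus_commute)
      qed
    qed
  qed
  moreover have "((\<lambda>s. f x s + fx x t * (y s - x)) has_real_derivative m + fx x t * b) (at t)"
    using dt y by (auto intro!: derivative_eq_intros simp: x_def)
  ultimately have "((\<lambda>s. (f (y s) s - f x s - fx x t * (y s - x)) + (f x s + fx x t * (y s - x)))
      has_real_derivative 0 + (m + fx x t * b)) (at t)"
    by (rule DERIV_add)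
  then show ?thesis by (simp add: x_def mult.commute)
qed

lemma riemann_solution_curve:
  assumes "riemann_solution c a T v vx" "0 < t" "t < T" "(y has_real_derivative b) (at t)"
  shows "((\<lambda>s. v \<sigma> (y s) s) has_real_derivative
     - a t * half_sum v (y t) t + (b - sg \<sigma> * c (half_diff v (y t) t)) * vx \<sigma> (y t) t) (at t)"
  using curve_derivative[of 0 T "vx \<sigma>" "v \<sigma>" y t _ b] assms
  by (fastforce simp: riemann_solution_def algebra_simps)

lemma riemann_solution_along:
  assumes "riemann_solution c a T v vx" "0 < t" "t < T"
  shows "((\<lambda>s. v \<sigma> (x + b * s) (t + s)) has_real_derivative
     - a t * half_sum v x t + (b - sg \<sigma> * c (half_diff v x t)) * vx \<sigma> x t) (at 0)"
proof -
  have "((\<lambda>s. x + b * (s - t)) has_real_derivative b) (at t)"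
    by (auto intro!: derivative_eq_intros)
  from riemann_solution_curve[OF assms this, of \<sigma>]
  show ?thesis
    using DERIV_shift[of "\<lambda>s. v \<sigma> (x + b * (s - t)) s" _ 0 t] by (simp add: add.commute)
qed

lemma cone_continuous:
  fixes f :: "real \<Rightarrow> real \<Rightarrow> real" and S T :: real
  assumes "continuous_on (UNIV \<times> {0..<T}) (\<lambda>(x, t). f x t)" "S < T"
  shows "continuous_on {(x, t). 0 \<le> t \<and> t \<le> S \<and> \<bar>x\<bar> + Lam * t \<le> R} (\<lambda>(x, t). f x t)"
  using assms(1) by (rule continuous_on_subset) (use assms(2) in auto)

text \<open>The barrier is \<open>N + e (1 + t)\<close>.  Where one invariant, up to sign, touches the barrier while the
  other one does not exceed it, \<open>u\<close> vanishes or has the sign of the first, so that damping does not push it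
  outwards.\<close>

lemma riemann_bound:
  assumes sol: "riemann_solution c a T v vx"
    and c: "\<And>y. \<bar>y\<bar> \<le> N + 1 \<Longrightarrow> \<bar>c y\<bar> \<le> Lam"
    and a: "\<And>t. 0 < t \<Longrightarrow> t < T \<Longrightarrow> 0 \<le> a t"
    and init: "\<And>\<sigma> x. \<bar>v \<sigma> x 0\<bar> \<le> N"
    and t: "0 \<le> t" "t < T"
  shows "\<bar>v \<sigma> x t\<bar> \<le> N"
proof -
  have N: "0 \<le> N" using order_trans[OF abs_ge_zero init] .
  then have Lam: "0 \<le> Lam" using order_trans[OF abs_ge_zero c[of 0]] by simp
  have main: "\<bar>v \<sigma> x t\<bar> < N + e * (1 + t)" if e: "0 < e" "e \<le> 1 / (1 + t)" for e
  proof -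
    have et: "e * (1 + t) \<le> 1" using e t by (simp add: field_simps)
    \<comment> \<open>\<open>\<tau>\<close> selects the invariant and \<open>\<rho>\<close> its sign\<close>
    define G where "G = (\<lambda>(\<tau>, \<rho>) x s. sg \<rho> * v \<tau> x s - (N + e * (1 + s)))"
    have "G (\<sigma>, \<rho>) x t < 0" for \<rho>
    proof (rule cone_comparison[where G = G and I = UNIV and S = t and Lam = Lam and R = "\<bar>x\<bar> + Lam * t"])
      fix i :: "bool \<times> bool"
      obtain \<tau> \<rho> where i: "i = (\<tau>, \<rho>)" by (cases i)
      have "continuous_on {(y, s). 0 \<le> s \<and> s \<le> t \<and> \<bar>y\<bar> + Lam * s \<le> \<bar>x\<bar> + Lam * t} (\<lambda>(y, s). v \<tau> y s)"
        using sol t by (intro cone_continuous) (auto simp: riemann_solution_def)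
      then show "continuous_on {(y, s). 0 \<le> s \<and> s \<le> t \<and> \<bar>y\<bar> + Lam * s \<le> \<bar>x\<bar> + Lam * t} (\<lambda>(y, s). G i y s)"
        unfolding G_def i prod.case unfolding case_prod_beta by (intro continuous_intros) auto
    next
      fix i :: "bool \<times> bool" and y
      show "G i y 0 < 0" using init[of "fst i" y] e by (auto simp: G_def sg_def abs_le_iff split: prod.split)
    next
      fix i :: "bool \<times> bool" and y s
      assume s: "0 < s" "s \<le> t" and G0: "G i y s = 0" and Gle: "\<And>j. j \<in> UNIV \<Longrightarrow> G j y s \<le> 0"
      obtain \<tau> \<rho> where i: "i = (\<tau>, \<rho>)" by (cases i)
      define \<beta> where "\<beta> = N + e * (1 + s)"
      have "e * (1 + s) \<le> e * (1 + t)" using s e by (intro mult_left_mono) auto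
      then have \<beta>: "\<beta> \<le> N + 1" using et by (simp add: \<beta>_def)
      have vb: "\<bar>v \<tau>' y s\<bar> \<le> \<beta>" for \<tau>'
        using Gle[of "(\<tau>', True)"] Gle[of "(\<tau>', False)"] by (auto simp: G_def \<beta>_def sg_def abs_le_iff)
      have "\<bar>half_diff v y s\<bar> \<le> N + 1" using half_diff_bound[of v y s \<beta>, OF vb] \<beta> by linarith
      from c[OF this] have b: "\<bar>sg \<tau> * c (half_diff v y s)\<bar> \<le> Lam" by simp
      have eq: "sg \<rho> * v \<tau> y s = \<beta>" using G0 by (simp add: G_def i \<beta>_def)
      have sum0: "0 \<le> sg \<rho> * half_sum v y s"
        using eq vb[of "\<not> \<tau>"] by (cases \<tau>; cases \<rho>) (auto simp: half_sum_def sg_def abs_le_iff field_simps)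
      have sT: "s < T" using s t by simp
      have "((\<lambda>r. G i (y + sg \<tau> * c (half_diff v y s) * r) (s + r)) has_real_derivative
          sg \<rho> * (- a s * half_sum v y s) - e) (at 0)"
        unfolding G_def i prod.case
        using riemann_solution_along[OF sol s(1) sT, of \<tau> y "sg \<tau> * c (half_diff v y s)"]
        by (auto intro!: derivative_eq_intros)
      moreover have "sg \<rho> * (- a s * half_sum v y s) - e < 0"
        using mult_nonneg_nonneg[OF a[OF s(1) sT] sum0] e by (simp add: mult_ac)
      ultimately show "\<exists>b m. \<bar>b\<bar> \<le> Lam \<and> m < 0 \<and> ((\<lambda>r. G i (y + b * r) (s + r)) has_real_derivative m) (at_left 0)"
        using b has_field_derivative_at_within by blast
    qed (use Lam t in auto)
    from this[of True] this[of False] show ?thesis by (auto simp: G_def sg_def)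
  qed
  have "((\<lambda>e. N + e * (1 + t)) \<longlongrightarrow> N + 0 * (1 + t)) (at_right 0)" by (intro tendsto_intros)
  then have "\<bar>v \<sigma> x t\<bar> \<le> N + 0 * (1 + t)"
    by (rule tendsto_lowerbound)
      (use main t in \<open>auto simp: eventually_at_right_field intro!: exI[of _ "1 / (1 + t)"] less_imp_le\<close>)
  then show ?thesis by simp
qed

text \<open>The difference of two solutions satisfies a linear system, whose coefficients are bounded in the cone
  because the gradient of one of them is.  The barrier is \<open>e exp (k t)\<close> with \<open>k\<close> larger than the
  resulting growth rate.\<close>

lemma riemann_unique:
  assumes v: "riemann_solution c a T v vx" and w: "riemann_solution c a T w wx"
    and vN: "\<And>\<sigma> x t. 0 \<le> t \<Longrightarrow> t < T \<Longrightarrow> \<bar>v \<sigma> x t\<bar> \<le> N"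
    and wN: "\<And>\<sigma> x t. 0 \<le> t \<Longrightarrow> t < T \<Longrightarrow> \<bar>w \<sigma> x t\<bar> \<le> N"
    and c: "\<And>y. \<bar>y\<bar> \<le> N \<Longrightarrow> \<bar>c y\<bar> \<le> Lam"
    and c_lip: "\<And>y z. \<bar>y\<bar> \<le> N \<Longrightarrow> \<bar>z\<bar> \<le> N \<Longrightarrow> \<bar>c y - c z\<bar> \<le> L * \<bar>y - z\<bar>"
    and a: "\<And>s. 0 < s \<Longrightarrow> s \<le> t \<Longrightarrow> \<bar>a s\<bar> \<le> A"
    and init: "\<And>\<sigma> x. v \<sigma> x 0 = w \<sigma> x 0"
    and wx: "\<And>\<sigma> y s. 0 < s \<Longrightarrow> s \<le> t \<Longrightarrow> \<bar>y\<bar> + Lam * s \<le> \<bar>x\<bar> + Lam * t \<Longrightarrow> \<bar>wx \<sigma> y s\<bar> \<le> M"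
    and t: "0 \<le> t" "t < T"
  shows "v \<sigma> x t = w \<sigma> x t"
proof (cases "t = 0")
  case False
  then have t0: "0 < t" using t by simp
  have Lam: "0 \<le> Lam" using order_trans[OF abs_ge_zero c[of 0]] order_trans[OF abs_ge_zero vN[of 0]] t by simp
  have A: "0 \<le> A" using order_trans[OF abs_ge_zero a[of t]] t0 by simp
  have M: "0 \<le> M" using order_trans[OF abs_ge_zero wx[of t x]] t0 by simp
  define k where "k = A + \<bar>L\<bar> * M + 1"
  have main: "\<bar>v \<sigma> x t - w \<sigma> x t\<bar> < e * exp (k * t)" if e: "0 < e" for e
  proof -
    define G where "G = (\<lambda>(\<tau>, \<rho>) x s. sg \<rho> * (v \<tau> x s - w \<tau> x s) - e * exp (k * s))"
    have "G (\<sigma>, \<rho>) x t < 0" for \<rho>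
    proof (rule cone_comparison[where G = G and I = UNIV and S = t and Lam = Lam and R = "\<bar>x\<bar> + Lam * t"])
      fix i :: "bool \<times> bool"
      obtain \<tau> \<rho> where i: "i = (\<tau>, \<rho>)" by (cases i)
      have "continuous_on {(y, s). 0 \<le> s \<and> s \<le> t \<and> \<bar>y\<bar> + Lam * s \<le> \<bar>x\<bar> + Lam * t} (\<lambda>(y, s). v \<tau> y s)"
        "continuous_on {(y, s). 0 \<le> s \<and> s \<le> t \<and> \<bar>y\<bar> + Lam * s \<le> \<bar>x\<bar> + Lam * t} (\<lambda>(y, s). w \<tau> y s)"
        using v w t by (auto intro!: cone_continuous simp: riemann_solution_def)
      then show "continuous_on {(y, s). 0 \<le> s \<and> s \<le> t \<and> \<bar>y\<bar> + Lam * s \<le> \<bar>x\<bar> + Lam * t} (\<lambda>(y, s). G i y s)"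
        unfolding G_def i prod.case unfolding case_prod_beta by (intro continuous_intros) auto
    next
      fix i :: "bool \<times> bool" and y
      show "G i y 0 < 0" using init e by (auto simp: G_def split: prod.split)
    next
      fix i :: "bool \<times> bool" and y s
      assume s: "0 < s" "s \<le> t" and cone: "\<bar>y\<bar> + Lam * s \<le> \<bar>x\<bar> + Lam * t"
        and G0: "G i y s = 0" and Gle: "\<And>j. j \<in> UNIV \<Longrightarrow> G j y s \<le> 0"
      obtain \<tau> \<rho> where i: "i = (\<tau>, \<rho>)" by (cases i)
      define \<beta> where "\<beta> = e * exp (k * s)"
      have \<beta>: "0 < \<beta>" using e by (simp add: \<beta>_def)
      have sT: "0 \<le> s" "s < T" using s t by auto
      have vb: "\<bar>v \<tau>' y s - w \<tau>' y s\<bar> \<le> \<beta>" for \<tau>'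
        using Gle[of "(\<tau>', True)"] Gle[of "(\<tau>', False)"] by (auto simp: G_def \<beta>_def sg_def abs_le_iff)
      define b where "b = sg \<tau> * c (half_diff v y s)"
      have pv: "\<bar>half_diff v y s\<bar> \<le> N" by (rule half_diff_bound[of v, OF vN[OF sT]])
      have pw: "\<bar>half_diff w y s\<bar> \<le> N" by (rule half_diff_bound[of w, OF wN[OF sT]])
      have b: "\<bar>b\<bar> \<le> Lam" using c[OF pv] by (simp add: b_def)
      have "\<bar>c (half_diff v y s) - c (half_diff w y s)\<bar> \<le> L * \<bar>half_diff v y s - half_diff w y s\<bar>"
        by (rule c_lip[OF pv pw])
      also have "\<dots> \<le> \<bar>L\<bar> * \<beta>"
        using half_diff_dist[of v _ _ w, OF vb] by (intro mult_mono) auto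
      finally have cc: "\<bar>(b - sg \<tau> * c (half_diff w y s)) * wx \<tau> y s\<bar> \<le> \<bar>L\<bar> * \<beta> * M"
        unfolding abs_mult b_def right_diff_distrib[symmetric] abs_sg mult_1_left
        using wx[OF s cone, of \<tau>] \<beta> M by (intro mult_mono) auto
      have aa: "\<bar>a s * (half_sum v y s - half_sum w y s)\<bar> \<le> A * \<beta>"
        unfolding abs_mult using a[OF s] half_sum_dist[of v _ _ w, OF vb] A by (intro mult_mono) auto
      define m where "m = sg \<rho> * ((- a s * half_sum v y s + (b - sg \<tau> * c (half_diff v y s)) * vx \<tau> y s)
          - (- a s * half_sum w y s + (b - sg \<tau> * c (half_diff w y s)) * wx \<tau> y s)) - e * (exp (k * s) * k)"
      have "((\<lambda>r. G i (y + b * r) (s + r)) has_real_derivative m) (at 0)"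
        unfolding G_def i prod.case m_def
        using riemann_solution_along[OF v s(1) sT(2), of \<tau> y b] riemann_solution_along[OF w s(1) sT(2), of \<tau> y b]
        by (auto intro!: derivative_eq_intros)
      moreover have "m < 0"
      proof -
        have "m = sg \<rho> * (- (a s * (half_sum v y s - half_sum w y s)) - (b - sg \<tau> * c (half_diff w y s)) * wx \<tau> y s) - \<beta> * k"
          by (simp add: m_def b_def \<beta>_def algebra_simps)
        also have "\<dots> \<le> \<bar>sg \<rho> * (- (a s * (half_sum v y s - half_sum w y s)) - (b - sg \<tau> * c (half_diff w y s)) * wx \<tau> y s)\<bar> - \<beta> * k"
          by (intro diff_right_mono abs_ge_self)
        also have "\<dots> \<le> (A * \<beta> + \<bar>L\<bar> * \<beta> * M) - \<beta> * k"
          unfolding abs_sg using aa cc by linarith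
        also have "\<dots> = - \<beta>" by (simp add: k_def algebra_simps)
        finally show ?thesis using \<beta> by simp
      qed
      ultimately show "\<exists>b m. \<bar>b\<bar> \<le> Lam \<and> m < 0 \<and> ((\<lambda>r. G i (y + b * r) (s + r)) has_real_derivative m) (at_left 0)"
        using b has_field_derivative_at_within by blast
    qed (use Lam t in auto)
    from this[of True] this[of False] show ?thesis by (auto simp: G_def sg_def)
  qed
  have "((\<lambda>e. e * exp (k * t)) \<longlongrightarrow> 0 * exp (k * t)) (at_right 0)" by (intro tendsto_intros)
  then have "\<bar>v \<sigma> x t - w \<sigma> x t\<bar> \<le> 0 * exp (k * t)"
    by (rule tendsto_lowerbound)
      (use main in \<open>auto simp: eventually_at_right_field intro!: exI[of _ 1] less_imp_le\<close>)
  then show ?thesis by simp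
qed (simp add: init)


section \<open>The gradient along a characteristic\<close>

lemma half_diff_sum_signed: "half_diff v x t = sg \<sigma> * (v \<sigma> x t - v (\<not> \<sigma>) x t) / 2"
  "half_sum v x t = (v \<sigma> x t + v (\<not> \<sigma>) x t) / 2"
  by (cases \<sigma>; simp add: half_diff_def half_sum_def sg_def field_simps)+

lemma product_error:
  fixes A0 H0 C0 P0 :: real
  assumes e: "0 < e"
  obtains w where "0 < w" "\<And>a h c p. \<bar>a - A0\<bar> \<le> w \<Longrightarrow> \<bar>h - H0\<bar> \<le> w \<Longrightarrow> \<bar>c - C0\<bar> \<le> w \<Longrightarrow> \<bar>p - P0\<bar> \<le> w \<Longrightarrow>
     \<bar>(- a * h - c * p) - (- A0 * H0 - C0 * P0)\<bar> \<le> e"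
proof -
  define f where "f = (\<lambda>(a, h, c, p). - a * h - c * p :: real)"
  have "isCont f (A0, H0, C0, P0)"
    unfolding f_def case_prod_beta by (intro continuous_intros)
  then obtain r where r: "0 < r" "\<And>z. dist z (A0, H0, C0, P0) < r \<Longrightarrow> dist (f z) (f (A0, H0, C0, P0)) < e"
    using e unfolding continuous_at_eps_delta by blast
  show ?thesis
  proof (rule that[of "r / 8"])
    fix a h c p assume *: "\<bar>a - A0\<bar> \<le> r / 8" "\<bar>h - H0\<bar> \<le> r / 8" "\<bar>c - C0\<bar> \<le> r / 8" "\<bar>p - P0\<bar> \<le> r / 8"
    have "dist (c, p) (C0, P0) \<le> dist c C0 + dist p P0"
      unfolding dist_Pair_Pair by (rule sqrt_sum_squares_le_sum) auto
    moreover have "dist (h, c, p) (H0, C0, P0) \<le> dist h H0 + dist (c, p) (C0, P0)"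
      unfolding dist_Pair_Pair[of h] by (rule sqrt_sum_squares_le_sum) auto
    moreover have "dist (a, h, c, p) (A0, H0, C0, P0) \<le> dist a A0 + dist (h, c, p) (H0, C0, P0)"
      unfolding dist_Pair_Pair[of a] by (rule sqrt_sum_squares_le_sum) auto
    ultimately have "dist (a, h, c, p) (A0, H0, C0, P0) < r"
      using * r(1) by (simp add: dist_real_def)
    from r(2)[OF this] show "\<bar>(- a * h - c * p) - (- A0 * H0 - C0 * P0)\<bar> \<le> e"
      by (simp add: f_def dist_real_def)
  qed (use r in auto)
qed

text \<open>Formally this is the equation differentiated in \<open>x\<close>, which would require second derivatives.
  Instead, the difference quotient \<open>(v(y + h) - v(y)) / h\<close> with a fixed increment \<open>h\<close> is
  differentiable along the characteristic \<open>y\<close>; its derivative is close to the asserted value near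
  \<open>t\<close>, uniformly in small \<open>h\<close>, and \<open>h \<rightarrow> 0\<close> in the increments gives the claim.\<close>

lemma gradient_along_characteristic:
  assumes sol: "riemann_solution c a T v vx"
    and c': "\<And>x t. 0 < t \<Longrightarrow> t < T \<Longrightarrow> (c has_real_derivative c' (half_diff v x t)) (at (half_diff v x t))"
    and c'_cont: "continuous_on (UNIV \<times> {0<..<T}) (\<lambda>(x, t). c' (half_diff v x t))"
    and a_cont: "continuous_on {0<..<T} a"
    and S: "S < T"
    and y: "\<And>s. s \<in> {0<..<S} \<Longrightarrow> (y has_real_derivative sg \<sigma> * c (half_diff v (y s) s)) (at s)"
    and t: "t \<in> {0<..<S}"
  shows "((\<lambda>s. vx \<sigma> (y s) s) has_real_derivative
     - a t * half_sum vx (y t) t - sg \<sigma> * c' (half_diff v (y t) t) * half_diff vx (y t) t * vx \<sigma> (y t) t) (at t)"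
proof (rule DERIV_from_increments)
  fix e :: real assume e: "0 < e"
  have vx_cont: "continuous_on (UNIV \<times> {0<..<T}) (\<lambda>(x, t). vx \<tau> x t)" for \<tau>
    using sol by (simp add: riemann_solution_def)
  have dvx: "((\<lambda>x. v \<tau> x s) has_real_derivative vx \<tau> x s) (at x)" if "0 < s" "s < T" for \<tau> x s
    using sol that by (simp add: riemann_solution_def)
  define k where "k x s = sg \<sigma> * c' (half_diff v x s) * half_diff vx x s" for x s
  have k_cont: "continuous_on (UNIV \<times> {0<..<T}) (\<lambda>(x, t). k x t)"
    using c'_cont vx_cont[of True] vx_cont[of False] unfolding k_def half_diff_def[of vx] case_prod_beta
    by (intro continuous_intros) auto
  have hs_cont: "continuous_on (UNIV \<times> {0<..<T}) (\<lambda>(x, t). half_sum vx x t)"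
    using vx_cont[of True] vx_cont[of False] unfolding half_sum_def case_prod_beta
    by (intro continuous_intros) auto
  have op: "open (UNIV \<times> {0<..<T})" by (intro open_Times) auto
  obtain w where w: "0 < w" "\<And>a' h c p. \<bar>a' - a t\<bar> \<le> w \<Longrightarrow> \<bar>h - half_sum vx (y t) t\<bar> \<le> w \<Longrightarrow> \<bar>c - k (y t) t\<bar> \<le> w \<Longrightarrow>
     \<bar>p - vx \<sigma> (y t) t\<bar> \<le> w \<Longrightarrow>
     \<bar>(- a' * h - c * p) - (- a t * half_sum vx (y t) t - k (y t) t * vx \<sigma> (y t) t)\<bar> \<le> e"
    using product_error[OF e] by metis
  have tU: "(y t, t) \<in> UNIV \<times> {0<..<T}" using t S by auto
  obtain r1 where r1: "0 < r1" "\<And>z s. \<bar>z - y t\<bar> \<le> r1 \<Longrightarrow> \<bar>s - t\<bar> \<le> r1 \<Longrightarrow> \<bar>half_sum vx z s - half_sum vx (y t) t\<bar> \<le> w"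
    using isCont_curried[OF hs_cont op tU w(1)] by metis
  obtain r2 where r2: "0 < r2" "\<And>z s. \<bar>z - y t\<bar> \<le> r2 \<Longrightarrow> \<bar>s - t\<bar> \<le> r2 \<Longrightarrow> \<bar>k z s - k (y t) t\<bar> \<le> w"
    using isCont_curried[OF k_cont op tU w(1)] by metis
  obtain r3 where r3: "0 < r3" "\<And>z s. \<bar>z - y t\<bar> \<le> r3 \<Longrightarrow> \<bar>s - t\<bar> \<le> r3 \<Longrightarrow> \<bar>vx \<sigma> z s - vx \<sigma> (y t) t\<bar> \<le> w"
    using isCont_curried[OF vx_cont op tU w(1)] by metis
  have "isCont a t" using a_cont t S by (auto simp: continuous_on_eq_continuous_at)
  then obtain r4 where r4: "0 < r4" "\<And>s. \<bar>s - t\<bar> < r4 \<Longrightarrow> \<bar>a s - a t\<bar> < w"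
    using w(1) unfolding continuous_at_eps_delta dist_real_def by blast
  define R where "R = Min {r1, r2, r3, r4 / 2}"
  have R: "0 < R" "R \<le> r1" "R \<le> r2" "R \<le> r3" "R < r4"
  proof -
    show "0 < R" unfolding R_def using r1 r2 r3 r4 by (subst Min_gr_iff) auto
    show "R \<le> r1" "R \<le> r2" "R \<le> r3" unfolding R_def by (intro Min.coboundedI; simp)+
    have "R \<le> r4 / 2" unfolding R_def by (intro Min.coboundedI; simp)
    then show "R < r4" using r4 by simp
  qed
  have "isCont y t" using y[OF t] by (rule DERIV_isCont)
  then obtain r5 where r5: "0 < r5" "\<And>s. \<bar>s - t\<bar> < r5 \<Longrightarrow> \<bar>y s - y t\<bar> < R / 2"
    using R unfolding continuous_at_eps_delta dist_real_def by (metis half_gt_zero)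
  define r where "r = Min {R, r5 / 2, t / 2, (S - t) / 2}"
  have r: "0 < r" "r \<le> R" "r < r5" "r < t" "r < S - t"
  proof -
    show "0 < r" unfolding r_def using R r5 t by (subst Min_gr_iff) auto
    show "r \<le> R" unfolding r_def by (intro Min.coboundedI; simp)
    have "r \<le> r5 / 2" "r \<le> t / 2" "r \<le> (S - t) / 2" unfolding r_def by (intro Min.coboundedI; simp)+
    then show "r < r5" "r < t" "r < S - t" using r5 t by auto
  qed
  define m where "m h s = (v \<sigma> (y s + h) s - v \<sigma> (y s) s) / h" for h s
  \<comment> \<open>the difference quotient obeys the limit equation up to \<open>e\<close> near \<open>t\<close>\<close>
  have m': "\<exists>g. (m h has_real_derivative g) (at s) \<and>
      \<bar>g - (- a t * half_sum vx (y t) t - k (y t) t * vx \<sigma> (y t) t)\<bar> \<le> e"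
    if h: "0 < h" "h \<le> R / 2" and s: "\<bar>s - t\<bar> \<le> r" for h s
  proof -
    have sS: "0 < s" "s < S" "s < T" using s r t S by (auto simp: abs_le_iff)
    have sR: "\<bar>s - t\<bar> \<le> R" using s r by simp
    have near: "\<bar>z - y t\<bar> \<le> R" if "z \<in> closed_segment (y s) (y s + h)" for z
    proof -
      have "\<bar>y s - y t\<bar> < R / 2" using s r by (intro r5(2)) auto
      moreover have "y s \<le> z" "z \<le> y s + h" using that h by (auto simp: closed_segment_eq_real_ivl)
      ultimately show ?thesis using h by linarith
    qed
    have near_h: "\<bar>y s + h - y t\<bar> \<le> R" by (rule near) (use h in \<open>auto simp: closed_segment_eq_real_ivl\<close>)
    have y': "(y has_real_derivative sg \<sigma> * c (half_diff v (y s) s)) (at s)" using y sS by simp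
    then have y'h: "((\<lambda>s. y s + h) has_real_derivative sg \<sigma> * c (half_diff v (y s) s)) (at s)"
      by (auto intro!: derivative_eq_intros)
    define H where "H = (half_sum v (y s + h) s - half_sum v (y s) s) / h"
    define C where "C = sg \<sigma> * (c (half_diff v (y s + h) s) - c (half_diff v (y s) s)) / h"
    have "(m h has_real_derivative - a s * H - C * vx \<sigma> (y s + h) s) (at s)"
      unfolding m_def H_def C_def
      using riemann_solution_curve[OF sol sS(1,3) y', of \<sigma>] riemann_solution_curve[OF sol sS(1,3) y'h, of \<sigma>] h
      by (auto intro!: derivative_eq_intros simp: field_simps)
    moreover have "\<bar>(- a s * H - C * vx \<sigma> (y s + h) s) - (- a t * half_sum vx (y t) t - k (y t) t * vx \<sigma> (y t) t)\<bar> \<le> e"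
    proof (rule w(2))
      show "\<bar>a s - a t\<bar> \<le> w" using r4(2)[of s] sR R by simp
      show "\<bar>vx \<sigma> (y s + h) s - vx \<sigma> (y t) t\<bar> \<le> w" using near_h sR R by (intro r3(2)) auto
      have "\<bar>half_sum v (y s + h) s - half_sum v (y s) s - half_sum vx (y t) t * (y s + h - y s)\<bar> \<le> w * \<bar>y s + h - y s\<bar>"
      proof (rule linearization_error)
        show "((\<lambda>x. half_sum v x s) has_real_derivative half_sum vx x s) (at x)" for x
          unfolding half_sum_def using dvx[OF sS(1,3)] by (auto intro!: derivative_eq_intros)
        show "\<bar>half_sum vx z s - half_sum vx (y t) t\<bar> \<le> w" if "z \<in> closed_segment (y s) (y s + h)" for z
          using near[OF that] sR R by (intro r1(2)) auto
      qed
      moreover have "H - half_sum vx (y t) t = (half_sum v (y s + h) s - half_sum v (y s) s - half_sum vx (y t) t * (y s + h - y s)) / h"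
        using h by (simp add: H_def field_simps)
      ultimately show "\<bar>H - half_sum vx (y t) t\<bar> \<le> w" using h by (simp add: abs_divide divide_le_eq)
      have "\<bar>sg \<sigma> * c (half_diff v (y s + h) s) - sg \<sigma> * c (half_diff v (y s) s) - k (y t) t * (y s + h - y s)\<bar> \<le> w * \<bar>y s + h - y s\<bar>"
      proof (rule linearization_error)
        show "((\<lambda>x. sg \<sigma> * c (half_diff v x s)) has_real_derivative k x s) (at x)" for x
        proof -
          have "((\<lambda>x. half_diff v x s) has_real_derivative half_diff vx x s) (at x)"
            unfolding half_diff_def using dvx[OF sS(1,3)] by (auto intro!: derivative_eq_intros)
          from DERIV_cmult[OF DERIV_chain2[OF c'[OF sS(1,3)] this], of "sg \<sigma>"]
          show ?thesis by (simp add: k_def mult.assoc)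
        qed
        show "\<bar>k z s - k (y t) t\<bar> \<le> w" if "z \<in> closed_segment (y s) (y s + h)" for z
          using near[OF that] sR R by (intro r2(2)) auto
      qed
      moreover have "C - k (y t) t = (sg \<sigma> * c (half_diff v (y s + h) s) - sg \<sigma> * c (half_diff v (y s) s) - k (y t) t * (y s + h - y s)) / h"
        using h by (simp add: C_def field_simps)
      ultimately show "\<bar>C - k (y t) t\<bar> \<le> w" using h by (simp add: abs_divide divide_le_eq)
    qed
    ultimately show ?thesis by blast
  qed
  have lim: "((\<lambda>h. m h s) \<longlongrightarrow> vx \<sigma> (y s) s) (at_right 0)" if "\<bar>s - t\<bar> \<le> r" for s
  proof -
    have "0 < s" "s < T" using that r t S by (auto simp: abs_le_iff)
    from dvx[OF this, of \<sigma> "y s"] show ?thesis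
      unfolding m_def DERIV_def by (rule filterlim_mono) (auto simp: at_le)
  qed
  show "\<exists>r>0. \<forall>s1 s2. s1 < s2 \<longrightarrow> (s1 = t \<or> s2 = t) \<longrightarrow> \<bar>s1 - t\<bar> \<le> r \<longrightarrow> \<bar>s2 - t\<bar> \<le> r \<longrightarrow>
      \<bar>vx \<sigma> (y s2) s2 - vx \<sigma> (y s1) s1
        - (- a t * half_sum vx (y t) t - sg \<sigma> * c' (half_diff v (y t) t) * half_diff vx (y t) t * vx \<sigma> (y t) t) * (s2 - s1)\<bar>
      \<le> e * (s2 - s1)"
  proof (intro exI[of _ r] conjI allI impI r(1))
    fix s1 s2 assume s: "s1 < s2" "s1 = t \<or> s2 = t" "\<bar>s1 - t\<bar> \<le> r" "\<bar>s2 - t\<bar> \<le> r"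
    define g0 where "g0 = - a t * half_sum vx (y t) t - k (y t) t * vx \<sigma> (y t) t"
    have "\<bar>m h s2 - m h s1 - g0 * (s2 - s1)\<bar> \<le> e * (s2 - s1)" if h: "0 < h" "h \<le> R / 2" for h
    proof -
      have "\<exists>g. (m h has_real_derivative g) (at s) \<and> \<bar>g - g0\<bar> \<le> e" if "s \<in> {s1..s2}" for s
        using m'[OF h, of s] that s unfolding g0_def by (auto simp: abs_le_iff)
      then obtain g where g: "\<And>s. s \<in> {s1..s2} \<Longrightarrow> (m h has_real_derivative g s) (at s)"
         "\<And>s. s \<in> {s1..s2} \<Longrightarrow> \<bar>g s - g0\<bar> \<le> e" by metis
      have "\<bar>(m h s2 - g0 * s2) - (m h s1 - g0 * s1)\<bar> \<le> e * (s2 - s1)"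
        by (rule bounded_increment[where h = "\<lambda>s. m h s - g0 * s" and h' = "\<lambda>s. g s - g0"])
          (use g s in \<open>auto intro!: derivative_eq_intros has_field_derivative_at_within[OF g(1)]\<close>)
      then show ?thesis by (simp add: algebra_simps)
    qed
    moreover have "((\<lambda>h. \<bar>m h s2 - m h s1 - g0 * (s2 - s1)\<bar>) \<longlongrightarrow> \<bar>vx \<sigma> (y s2) s2 - vx \<sigma> (y s1) s1 - g0 * (s2 - s1)\<bar>) (at_right 0)"
      by (intro tendsto_intros lim s)
    ultimately have "\<bar>vx \<sigma> (y s2) s2 - vx \<sigma> (y s1) s1 - g0 * (s2 - s1)\<bar> \<le> e * (s2 - s1)"
      using R(1) by (intro tendsto_upperbound[of _ _ "at_right 0"])
        (auto simp: eventually_at_right_field intro!: exI[of _ "R / 2"])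
    then show "\<bar>vx \<sigma> (y s2) s2 - vx \<sigma> (y s1) s1
        - (- a t * half_sum vx (y t) t - sg \<sigma> * c' (half_diff v (y t) t) * half_diff vx (y t) t * vx \<sigma> (y t) t) * (s2 - s1)\<bar>
      \<le> e * (s2 - s1)"
      by (simp add: g0_def k_def)
  qed
qed

text \<open>If \<open>Y \<le> - L0\<close>, the quadratic term dominates and \<open>Y' \<le> - (b0 / 8) Y\<^sup>2\<close>.  So \<open>Y\<close> stays below
  \<open>- L0\<close>, and \<open>1 / Y\<close>, which starts above \<open>- b0 / 16\<close>, grows at least at the rate \<open>b0 / 8\<close> while it
  has to remain negative: impossible on an interval of length \<open>1/2\<close>.\<close>

lemma riccati_blowup:
  fixes A b0 E Gm :: real
  assumes A: "0 \<le> A" and b0: "0 < b0" and E: "0 \<le> E" and Gm: "0 \<le> Gm"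
  obtains L0 where "0 < L0" "\<And>Y Y' g k. continuous_on {0..1/2} Y \<Longrightarrow>
     (\<And>s. s \<in> {0<..<1/2} \<Longrightarrow> (Y has_real_derivative Y' s) (at s)) \<Longrightarrow>
     (\<And>s. s \<in> {0<..<1/2} \<Longrightarrow> 0 \<le> g s \<and> g s \<le> Gm \<and> \<bar>k s\<bar> \<le> A \<and>
        Y' s \<le> k s * (Y s + g s) - b0 * (Y s + g s)\<^sup>2 + E) \<Longrightarrow> - L0 \<le> Y 0"
proof -
  define L0 where "L0 = 2 * Gm + 16 * A / b0 + 16 * E / b0 + 16 / b0 + 1"
  have L0: "1 \<le> L0" "2 * Gm \<le> L0" "16 * A / b0 \<le> L0" "16 * E / b0 \<le> L0" "16 / b0 \<le> L0"
    using assms by (auto simp: L0_def)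
  show ?thesis
  proof (rule that[of L0])
    show "0 < L0" using L0 by simp
    fix Y Y' g k :: "real \<Rightarrow> real"
    assume Yc: "continuous_on {0..1/2} Y"
      and Yd: "\<And>s. s \<in> {0<..<1/2} \<Longrightarrow> (Y has_real_derivative Y' s) (at s)"
      and ineq: "\<And>s. s \<in> {0<..<1/2} \<Longrightarrow> 0 \<le> g s \<and> g s \<le> Gm \<and> \<bar>k s\<bar> \<le> A \<and>
        Y' s \<le> k s * (Y s + g s) - b0 * (Y s + g s)\<^sup>2 + E"
    have decay: "Y' s \<le> - (b0 / 8) * (Y s)\<^sup>2" if s: "s \<in> {0<..<1/2}" and Y: "Y s \<le> - L0" for s
    proof -
      define q where "q = Y s + g s"
      have q: "Y s \<le> q" "q \<le> Y s / 2" using ineq[OF s] Y L0 by (auto simp: q_def)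
      have Yn: "Y s < 0" using Y L0 by simp
      have "k s * q \<le> A * \<bar>Y s\<bar>"
      proof -
        have "k s * q \<le> \<bar>k s\<bar> * \<bar>q\<bar>" by (metis abs_ge_self abs_mult)
        also have "\<dots> \<le> A * \<bar>Y s\<bar>" using ineq[OF s] q Yn A by (intro mult_mono) auto
        finally show ?thesis .
      qed
      also have "\<dots> \<le> (b0 / 16 * \<bar>Y s\<bar>) * \<bar>Y s\<bar>"
      proof (rule mult_right_mono)
        have "16 * A / b0 \<le> \<bar>Y s\<bar>" using Y Yn L0(3) by simp
        then show "A \<le> b0 / 16 * \<bar>Y s\<bar>" using b0 by (simp add: field_simps)
      qed simp
      finally have 1: "k s * q \<le> b0 / 16 * (Y s)\<^sup>2" by (simp add: power2_eq_square)
      have "(Y s / 2)\<^sup>2 \<le> q\<^sup>2" using q Yn by (intro abs_le_square_iff[THEN iffD1]) auto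
      then have 2: "b0 / 4 * (Y s)\<^sup>2 \<le> b0 * q\<^sup>2" using b0 by (simp add: power_divide)
      have "1 * L0 \<le> \<bar>Y s\<bar> * \<bar>Y s\<bar>" using Y Yn L0(1) by (intro mult_mono) auto
      then have "16 * E / b0 \<le> (Y s)\<^sup>2" using L0(4) by (simp add: power2_eq_square)
      then have 3: "E \<le> b0 / 16 * (Y s)\<^sup>2" using b0 by (simp add: field_simps)
      show ?thesis using ineq[OF s] 1 2 3 unfolding q_def[symmetric] by linarith
    qed
    show "- L0 \<le> Y 0"
    proof (rule ccontr)
      assume "\<not> - L0 \<le> Y 0"
      then have Y0: "Y 0 < - L0" by simp
      have stays: "Y t < - L0" if t: "0 \<le> t" "t < 1/2" for t
      proof -
        define G where "G i x s = Y s + L0" for i :: unit and x s :: real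
        have "G () 0 t < 0"
        proof (rule cone_comparison[where G = G and I = UNIV and S = t and Lam = 0 and R = 0])
          fix i
          have "continuous_on {(x, s). 0 \<le> s \<and> s \<le> t \<and> \<bar>x\<bar> + 0 * s \<le> (0::real)} (\<lambda>p. Y (snd p))"
            by (rule continuous_on_compose2[OF Yc]) (use t in \<open>auto intro!: continuous_intros\<close>)
          then show "continuous_on {(x, s). 0 \<le> s \<and> s \<le> t \<and> \<bar>x\<bar> + 0 * s \<le> (0::real)} (\<lambda>(x, s). G i x s)"
            unfolding G_def case_prod_beta by (intro continuous_intros)
        next
          fix i and x s :: real
          assume s: "0 < s" "s \<le> t" and "G i x s = 0"
          then have Ys: "Y s = - L0" and sI: "s \<in> {0<..<1/2}" using t by (auto simp: G_def)
          have "((\<lambda>r. G i (x + 0 * r) (s + r)) has_real_derivative Y' s) (at 0)"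
            unfolding G_def using DERIV_shift[of Y "Y' s" 0 s] Yd[OF sI]
            by (auto intro!: derivative_eq_intros simp: add.commute)
          moreover have "Y' s < 0"
          proof -
            have "0 < b0 / 8 * (Y s)\<^sup>2" using Ys L0 b0 by simp
            then show ?thesis using decay[OF sI] Ys by simp
          qed
          ultimately show "\<exists>b m. \<bar>b\<bar> \<le> 0 \<and> m < 0 \<and> ((\<lambda>r. G i (x + b * r) (s + r)) has_real_derivative m) (at_left 0)"
            by (intro exI[of _ 0] exI[of _ "Y' s"]) (auto intro: has_field_derivative_at_within)
        qed (use t Y0 in \<open>auto simp: G_def\<close>)
        then show ?thesis by (simp add: G_def)
      qed
      have half: "Y (1/2) \<le> - L0"
      proof -
        have "(Y \<longlongrightarrow> Y (1/2)) (at (1/2) within {0..1/2})"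
          using Yc by (simp add: continuous_on_def)
        then have "(Y \<longlongrightarrow> Y (1/2)) (at_left (1/2))" by (simp add: at_within_Icc_at_left)
        then show ?thesis
          by (rule tendsto_upperbound)
            (use stays in \<open>auto simp: eventually_at_left_field intro!: exI[of _ 0] less_imp_le\<close>)
      qed
      have neg: "Y t < 0" if "t \<in> {0..1/2}" for t
      proof (cases "t < 1/2")
        case True
        then show ?thesis using stays[of t] that L0(1) by simp
      next
        case False
        then have "t = 1/2" using that by simp
        then show ?thesis using half L0(1) by (simp only:)
      qed
      have "inverse (Y 0) - b0 / 8 * 0 \<le> inverse (Y (1/2)) - b0 / 8 * (1/2)"
      proof (rule DERIV_nonneg_imp_increasing_open[where f = "\<lambda>t. inverse (Y t) - b0 / 8 * t"])
        show "continuous_on {0..1/2} (\<lambda>t. inverse (Y t) - b0 / 8 * t)"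
          using neg by (intro continuous_intros Yc) force
        fix s :: real assume "0 < s" "s < 1/2"
        then have s: "s \<in> {0<..<1/2}" by simp
        have "Y s \<le> - L0" using stays[of s] s by simp
        note d = decay[OF s this]
        have Yn: "Y s < 0" using neg[of s] s by simp
        have "((\<lambda>t. inverse (Y t) - b0 / 8 * t) has_real_derivative - (inverse (Y s) * Y' s * inverse (Y s)) - b0 / 8) (at s)"
          using Yn by (auto intro!: derivative_eq_intros Yd[OF s])
        moreover have "0 \<le> - (inverse (Y s) * Y' s * inverse (Y s)) - b0 / 8"
        proof -
          have "b0 / 8 * (Y s)\<^sup>2 / (Y s)\<^sup>2 \<le> - Y' s / (Y s)\<^sup>2" using d by (intro divide_right_mono) auto
          moreover have "b0 / 8 * (Y s)\<^sup>2 / (Y s)\<^sup>2 = b0 / 8" using Yn by simp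
          moreover have "- Y' s / (Y s)\<^sup>2 = - (inverse (Y s) * Y' s * inverse (Y s))"
            by (simp add: power2_eq_square divide_inverse)
          ultimately show ?thesis by linarith
        qed
        ultimately show "\<exists>m. ((\<lambda>t. inverse (Y t) - b0 / 8 * t) has_real_derivative m) (at s) \<and> 0 \<le> m" by blast
      qed simp
      moreover have "inverse (Y (1/2)) < 0" using neg[of "1/2"] by simp
      moreover have "- (b0 / 16) \<le> inverse (Y 0)"
      proof -
        have "16 / b0 \<le> - Y 0" using Y0 L0(5) by simp
        then have "inverse (- Y 0) \<le> inverse (16 / b0)" using b0 by (intro le_imp_inverse_le) auto
        then show ?thesis by simp
      qed
      ultimately show False by simp
    qed
  qed
qed


section \<open>The gradient catastrophe\<close>

text \<open>The speed is bounded, so only its values in a compact set matter, where it is Lipschitz in \<open>x\<close>.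
  Clamping both arguments extends it from there to a globally Lipschitz function.\<close>

lemma characteristic_from_initial_point:
  fixes b bx :: "real \<Rightarrow> real \<Rightarrow> real"
  assumes S: "0 \<le> S" and b_cont: "continuous_on (UNIV \<times> {0..S}) (\<lambda>(x, t). b x t)"
    and bx_cont: "continuous_on (UNIV \<times> {0..S}) (\<lambda>(x, t). bx x t)"
    and dx: "\<And>x t. t \<in> {0..S} \<Longrightarrow> ((\<lambda>x. b x t) has_real_derivative bx x t) (at x)"
    and bound: "\<And>x t. t \<in> {0..S} \<Longrightarrow> \<bar>b x t\<bar> \<le> Lam"
  obtains y where "y 0 = x0" "\<And>s. s \<in> {0..S} \<Longrightarrow> (y has_real_derivative b (y s) s) (at s within {0..S})"
proof -
  have Lam: "0 \<le> Lam" using order_trans[OF abs_ge_zero bound[of 0]] S by simp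
  define R where "R = \<bar>x0\<bar> + Lam * S"
  have R: "0 \<le> R" using Lam S by (simp add: R_def)
  define cx where "cx x = max (- R) (min x R)" for x
  define ct where "ct t = max 0 (min t S)" for t
  have cx: "\<bar>cx x\<bar> \<le> R" for x using R by (auto simp: cx_def)
  have cx_id: "cx x = x" if "\<bar>x\<bar> \<le> R" for x using that by (auto simp: cx_def)
  have ct: "ct t \<in> {0..S}" for t using S by (auto simp: ct_def)
  have ct_id: "ct t = t" if "t \<in> {0..S}" for t using that by (auto simp: ct_def)
  have "bounded ((\<lambda>(x, t). bx x t) ` ({-R..R} \<times> {0..S}))"
    by (intro compact_imp_bounded compact_continuous_image continuous_on_subset[OF bx_cont] compact_Times) auto
  then obtain B where B: "\<forall>z \<in> (\<lambda>(x, t). bx x t) ` ({-R..R} \<times> {0..S}). norm z \<le> B"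
    unfolding bounded_iff by blast
  have Bx: "\<bar>bx x t\<bar> \<le> B" if "\<bar>x\<bar> \<le> R" "t \<in> {0..S}" for x t
    using B that by (force simp: abs_le_iff)
  define f where "f x t = b (cx x) (ct t)" for x t
  have "continuous_on UNIV (\<lambda>p. case (cx (fst p), ct (snd p)) of (x, t) \<Rightarrow> b x t)"
    by (rule continuous_on_compose2[OF b_cont]) (use ct in \<open>auto simp: cx_def ct_def intro!: continuous_intros\<close>)
  then have fc: "continuous_on UNIV (\<lambda>(x, t). f x t)" by (simp add: f_def case_prod_beta)
  have f_lip: "\<bar>f x t - f y t\<bar> \<le> B * \<bar>x - y\<bar>" for x y t
  proof -
    have "norm (b (cx x) (ct t) - b (cx y) (ct t)) \<le> B * norm (cx x - cx y)"
    proof (rule field_differentiable_bound[of "{-R..R}" _ "\<lambda>x. bx x (ct t)"])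
      fix z assume "z \<in> {-R..R}"
      then show "norm (bx z (ct t)) \<le> B" using Bx[of z "ct t"] ct by (auto simp: abs_le_iff)
      show "((\<lambda>x. b x (ct t)) has_field_derivative bx z (ct t)) (at z within {-R..R})"
        using dx[OF ct] by (rule has_field_derivative_at_within)
    qed (use cx[of x] cx[of y] in \<open>auto simp: abs_le_iff\<close>)
    moreover have "\<bar>cx x - cx y\<bar> \<le> \<bar>x - y\<bar>" by (auto simp: cx_def)
    moreover have "0 \<le> B" using order_trans[OF abs_ge_zero Bx[of 0 0]] R S by simp
    ultimately show ?thesis unfolding f_def by (smt (verit) mult_left_mono real_norm_def)
  qed
  obtain y where y: "y 0 = x0" "\<And>s. s \<in> {0..S} \<Longrightarrow> (y has_real_derivative f (y s) s) (at s within {0..S})"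
    using ode_forward[OF fc f_lip S, of 0 x0] by auto
  have yR: "\<bar>y s\<bar> \<le> R" if s: "s \<in> {0..S}" for s
  proof -
    have "\<bar>y s - y 0\<bar> \<le> Lam * (s - 0)"
      by (rule bounded_increment[where h' = "\<lambda>s. f (y s) s"])
        (use s y(2) bound ct in \<open>auto simp: f_def intro: has_field_derivative_subset[of _ _ _ "{0..S}"]\<close>)
    moreover have "Lam * s \<le> Lam * S" using s Lam by (intro mult_left_mono) auto
    ultimately show ?thesis using y(1) by (auto simp: R_def abs_le_iff)
  qed
  show ?thesis
    by (rule that[of y]) (use y yR cx_id ct_id in \<open>auto simp: f_def\<close>)
qed

text \<open>A solution of the diagonal system up to and including \<open>t = 0\<close> with the power law for the speed of
  sound and with the bounds on which the time of blow-up depends.  The damping coefficient is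
  controlled up to time \<open>1/2\<close> only.\<close>

definition bounded_flow ::
  "real \<Rightarrow> real \<Rightarrow> real \<Rightarrow> real \<Rightarrow> real \<Rightarrow> (real \<Rightarrow> real) \<Rightarrow> (real \<Rightarrow> real) \<Rightarrow> (real \<Rightarrow> real) \<Rightarrow> real
    \<Rightarrow> (bool \<Rightarrow> real \<Rightarrow> real \<Rightarrow> real) \<Rightarrow> (bool \<Rightarrow> real \<Rightarrow> real \<Rightarrow> real) \<Rightarrow> bool"
where
  "bounded_flow \<kappa> m N A A' c a a' T v vx \<longleftrightarrow>
     riemann_solution c a T v vx \<and> (\<forall>y>0. c y = \<kappa> * y powr m) \<and>
     (\<forall>\<sigma>. continuous_on (UNIV \<times> {0..<T}) (\<lambda>(x, t). vx \<sigma> x t)) \<and>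
     (\<forall>\<sigma> x. \<forall>t\<in>{0..<T}. ((\<lambda>x. v \<sigma> x t) has_real_derivative vx \<sigma> x t) (at x)) \<and>
     (\<forall>x. \<forall>t\<in>{0..<T}. 0 < half_diff v x t \<and> half_diff v x t \<le> N) \<and>
     continuous_on {0..<T} a \<and>
     (\<forall>t\<in>{0<..<1/2}. (a has_real_derivative a' t) (at t) \<and> \<bar>a' t\<bar> \<le> A') \<and>
     (\<forall>t\<in>{0..<1/2}. 0 \<le> a t \<and> a t \<le> A)"

text \<open>Along a characteristic write \<open>p\<close> and \<open>q\<close> for the gradients of the invariant of its own and of the
  other family.  Then \<open>\<Phi>' = - c q\<close> and \<open>p' = - a (p + q) / 2 - c' (p - q) p / 2\<close>.  Multiplying \<open>p\<close> by
  \<open>\<surd>c\<close> cancels the term with \<open>p q\<close>, and subtracting \<open>(a/2) G(\<Phi>)\<close>, where \<open>G' = 1 / \<surd>c\<close>, cancels the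
  term with \<open>a q\<close>.  What remains is a Riccati inequality whose coefficients are controlled by \<open>N\<close>
  alone, as \<open>1 - m/2 > 0\<close> bounds \<open>G\<close> above and \<open>m/2 - 1 < 0\<close> bounds \<open>b\<close> below.\<close>

lemma gradient_catastrophe:
  fixes \<kappa> m N A A' :: real
  assumes \<kappa>: "0 < \<kappa>" and m: "1 < m" "m < 2" and N: "0 < N" and A: "0 \<le> A" "0 \<le> A'"
  obtains L0 where "0 < L0"
    "\<And>a a' c v vx T x0 \<sigma>. bounded_flow \<kappa> m N A A' c a a' T v vx \<Longrightarrow> 1/2 < T \<Longrightarrow>
       - L0 \<le> sqrt \<kappa> * half_diff v x0 0 powr (m/2) * vx \<sigma> x0 0"
proof -
  define G where "G x = x powr (1 - m/2) / (sqrt \<kappa> * (1 - m/2))" for x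
  define b0 where "b0 = sqrt \<kappa> * (m/2) * N powr (m/2 - 1)"
  have b0: "0 < b0" using \<kappa> m N by (simp add: b0_def)
  have G0: "0 \<le> G x" for x using \<kappa> m by (simp add: G_def)
  have GN: "G x \<le> G N" if "0 < x" "x \<le> N" for x
    unfolding G_def using \<kappa> m that by (intro divide_right_mono powr_mono2) auto
  obtain L0 where L0: "0 < L0" "\<And>Y Y' g k. continuous_on {0..1/2} Y \<Longrightarrow>
     (\<And>s. s \<in> {0<..<1/2} \<Longrightarrow> (Y has_real_derivative Y' s) (at s)) \<Longrightarrow>
     (\<And>s. s \<in> {0<..<1/2} \<Longrightarrow> 0 \<le> g s \<and> g s \<le> A * G N \<and> \<bar>k s\<bar> \<le> A \<and>
        Y' s \<le> k s * (Y s + g s) - b0 * (Y s + g s)\<^sup>2 + A' * G N) \<Longrightarrow> - L0 \<le> Y 0"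
    using riccati_blowup[OF A(1) b0, of "A' * G N" "A * G N"] A G0[of N] by auto
  show ?thesis
  proof (rule that[OF L0(1)])
    fix a a' c v vx T x0 \<sigma>
    assume flow: "bounded_flow \<kappa> m N A A' c a a' T v vx" and T: "1/2 < T"
    have sol: "riemann_solution c a T v vx"
      and c: "\<And>y. 0 < y \<Longrightarrow> c y = \<kappa> * y powr m"
      and vx_cont: "\<And>\<sigma>. continuous_on (UNIV \<times> {0..<T}) (\<lambda>(x, t). vx \<sigma> x t)"
      and dx: "\<And>\<sigma> x t. 0 \<le> t \<Longrightarrow> t < T \<Longrightarrow> ((\<lambda>x. v \<sigma> x t) has_real_derivative vx \<sigma> x t) (at x)"
      and phi: "\<And>x t. 0 \<le> t \<Longrightarrow> t < T \<Longrightarrow> 0 < half_diff v x t \<and> half_diff v x t \<le> N"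
      and a_cont: "continuous_on {0..<T} a"
      and a': "\<And>t. 0 < t \<Longrightarrow> t < 1/2 \<Longrightarrow> (a has_real_derivative a' t) (at t) \<and> \<bar>a' t\<bar> \<le> A'"
      and aA: "\<And>t. 0 \<le> t \<Longrightarrow> t < 1/2 \<Longrightarrow> 0 \<le> a t \<and> a t \<le> A"
      using flow by (auto simp: bounded_flow_def)
    define c' where "c' y = \<kappa> * (m * y powr (m - 1))" for y
    have c': "(c has_real_derivative c' y) (at y)" if "0 < y" for y
    proof -
      have "((\<lambda>y. \<kappa> * y powr m) has_real_derivative c' y) (at y)"
        unfolding c'_def using that by (auto intro!: derivative_eq_intros)
      then show ?thesis
        by (rule has_field_derivative_transform_within_open[of _ _ _ "{0<..}"]) (use that c in auto)
    qed
    have v_cont: "continuous_on (UNIV \<times> {0..<T}) (\<lambda>(x, t). v \<sigma> x t)" for \<sigma>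
      using sol by (simp add: riemann_solution_def)
    have phi_cont: "continuous_on (UNIV \<times> {0..<T}) (\<lambda>p. half_diff v (fst p) (snd p))"
      using v_cont[of True] v_cont[of False] unfolding half_diff_def case_prod_beta
      by (intro continuous_intros) auto
    have phix_cont: "continuous_on (UNIV \<times> {0..<T}) (\<lambda>p. half_diff vx (fst p) (snd p))"
      using vx_cont[of True] vx_cont[of False] unfolding half_diff_def case_prod_beta
      by (intro continuous_intros) auto
    have phi_ne: "\<forall>p\<in>UNIV \<times> {0..<T}. half_diff v (fst p) (snd p) \<noteq> 0"
      using phi by (auto simp: less_le)
    have c'_cont: "continuous_on (UNIV \<times> {0..<T}) (\<lambda>p. c' (half_diff v (fst p) (snd p)))"
      unfolding c'_def by (intro continuous_intros phi_cont phi_ne)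
    have c_cont: "continuous_on (UNIV \<times> {0..<T}) (\<lambda>p. c (half_diff v (fst p) (snd p)))"
    proof -
      have "continuous_on (UNIV \<times> {0..<T}) (\<lambda>p. \<kappa> * half_diff v (fst p) (snd p) powr m)"
        by (intro continuous_intros phi_cont phi_ne)
      then show ?thesis
        by (rule continuous_on_cong[THEN iffD1, rotated -1]) (use phi c in auto)
    qed
    have sub: "continuous_on (UNIV \<times> {0..1/2}) f" if "continuous_on (UNIV \<times> {0..<T}) f" for f :: "real \<times> real \<Rightarrow> real"
      using that by (rule continuous_on_subset) (use T in auto)
    obtain y where y: "y 0 = x0"
      "\<And>s. s \<in> {0..1/2} \<Longrightarrow> (y has_real_derivative sg \<sigma> * c (half_diff v (y s) s)) (at s within {0..1/2})"
    proof (rule characteristic_from_initial_point[of "1/2" "\<lambda>x t. sg \<sigma> * c (half_diff v x t)"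
          "\<lambda>x t. sg \<sigma> * (c' (half_diff v x t) * half_diff vx x t)" "\<kappa> * N powr m" x0])
      show "continuous_on (UNIV \<times> {0..1/2}) (\<lambda>(x, t). sg \<sigma> * c (half_diff v x t))"
        unfolding case_prod_beta by (intro continuous_intros sub c_cont)
      show "continuous_on (UNIV \<times> {0..1/2}) (\<lambda>(x, t). sg \<sigma> * (c' (half_diff v x t) * half_diff vx x t))"
        unfolding case_prod_beta by (intro continuous_intros sub c'_cont phix_cont)
      show "((\<lambda>x. sg \<sigma> * c (half_diff v x t)) has_real_derivative sg \<sigma> * (c' (half_diff v x t) * half_diff vx x t)) (at x)"
        if "t \<in> {0..1/2}" for x t
      proof -
        have t: "0 \<le> t" "t < T" using that T by auto
        have "((\<lambda>x. half_diff v x t) has_real_derivative half_diff vx x t) (at x)"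
          unfolding half_diff_def using dx[OF t] by (auto intro!: derivative_eq_intros)
        from DERIV_cmult[OF DERIV_chain2[OF c' this]] phi[OF t] show ?thesis by blast
      qed
      show "\<bar>sg \<sigma> * c (half_diff v x t)\<bar> \<le> \<kappa> * N powr m" if "t \<in> {0..1/2}" for x t
        using phi[of t x] that T c \<kappa> m by (auto intro!: mult_left_mono powr_mono2)
    qed (use that in auto)
    have y_at: "(y has_real_derivative sg \<sigma> * c (half_diff v (y s) s)) (at s)" if "s \<in> {0<..<1/2}" for s
      using y(2)[of s] that by (simp add: at_within_Icc_at)
    have y_cont: "continuous_on {0..1/2} y" by (rule DERIV_continuous_on[OF y(2)])
    have along: "continuous_on {0..1/2} (\<lambda>s. f (y s) s)" if "continuous_on (UNIV \<times> {0..<T}) (\<lambda>p. f (fst p) (snd p))" for f :: "real \<Rightarrow> real \<Rightarrow> real"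
      using continuous_on_compose2[OF sub[OF that] continuous_on_Pair[OF y_cont continuous_on_id]] by auto
    define \<Phi> where "\<Phi> s = half_diff v (y s) s" for s
    define p where "p s = vx \<sigma> (y s) s" for s
    define q where "q s = vx (\<not> \<sigma>) (y s) s" for s
    have \<Phi>: "0 < \<Phi> s" "\<Phi> s \<le> N" if "s \<in> {0..1/2}" for s
      using phi[of s "y s"] that T by (auto simp: \<Phi>_def)
    define g where "g s = a s / 2 * G (\<Phi> s)" for s
    define Y where "Y s = sqrt \<kappa> * \<Phi> s powr (m/2) * p s - g s" for s
    \<comment> \<open>the value that the derivative of \<open>Y\<close> will turn out to have; \<open>Y +
      g\<close> is \<open>\<surd>c p\<close>\<close>
    define Y' where "Y' s = - (a s / 2) * (Y s + g s) - sqrt \<kappa> * (m/2) * \<Phi> s powr (m/2 - 1) * (Y s + g s)\<^sup>2 - a' s / 2 * G (\<Phi> s)" for s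
    have "- L0 \<le> Y 0"
    proof (rule L0(2))
      have 1: "continuous_on {0..1/2} \<Phi>" unfolding \<Phi>_def by (rule along[OF phi_cont])
      have 2: "continuous_on {0..1/2} p"
        unfolding p_def using vx_cont[of \<sigma>] by (intro along) (simp add: case_prod_beta)
      have 3: "continuous_on {0..1/2} a" using a_cont by (rule continuous_on_subset) (use T in auto)
      show "continuous_on {0..1/2} Y"
        unfolding Y_def g_def G_def using \<kappa> m
        by (intro continuous_intros 1 2 3) (use \<Phi> in \<open>auto simp: less_le\<close>)
      fix s :: real assume s: "s \<in> {0<..<1/2}"
      then have s': "0 < s" "s < T" "s < 1/2" "s \<in> {0..1/2}" using T by auto
      have cs: "c (\<Phi> s) = \<kappa> * \<Phi> s powr m" using c \<Phi>[OF s'(4)] by simp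
      have d\<Phi>: "(\<Phi> has_real_derivative - c (\<Phi> s) * q s) (at s)"
      proof -
        have "((\<lambda>s. sg \<sigma> * (v \<sigma> (y s) s - v (\<not> \<sigma>) (y s) s) / 2) has_real_derivative - c (\<Phi> s) * q s) (at s)"
          using riemann_solution_curve[OF sol s'(1,2) y_at[OF s], of \<sigma>]
            riemann_solution_curve[OF sol s'(1,2) y_at[OF s], of "\<not> \<sigma>"]
          by (auto intro!: derivative_eq_intros simp: sg_def \<Phi>_def q_def field_simps)
        then show ?thesis unfolding \<Phi>_def half_diff_sum_signed(1)[of v _ _ \<sigma>] .
      qed
      have dp: "(p has_real_derivative - a s * (p s + q s) / 2 - c' (\<Phi> s) * (p s - q s) / 2 * p s) (at s)"
      proof -
        have "(p has_real_derivative - a s * half_sum vx (y s) s - sg \<sigma> * c' (half_diff v (y s) s) * half_diff vx (y s) s * vx \<sigma> (y s) s) (at s)"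
          unfolding p_def
        proof (rule gradient_along_characteristic[OF sol _ _ _ T y_at s])
          show "(c has_real_derivative c' (half_diff v x t)) (at (half_diff v x t))" if "0 < t" "t < T" for x t
            using phi[of t x] that by (intro c') auto
          show "continuous_on (UNIV \<times> {0<..<T}) (\<lambda>(x, t). c' (half_diff v x t))"
            unfolding case_prod_beta using c'_cont by (rule continuous_on_subset) auto
          show "continuous_on {0<..<T} a" using a_cont by (rule continuous_on_subset) auto
        qed
        moreover have "half_sum vx (y s) s = (p s + q s) / 2" and hd: "sg \<sigma> * half_diff vx (y s) s = (p s - q s) / 2"
          by (auto simp: half_diff_sum_signed[of vx _ _ \<sigma>] p_def q_def sg_def)
        moreover have "sg \<sigma> * c' (half_diff v (y s) s) * half_diff vx (y s) s * vx \<sigma> (y s) s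
            = c' (\<Phi> s) * (sg \<sigma> * half_diff vx (y s) s) * p s"
          by (simp add: \<Phi>_def p_def)
        ultimately show ?thesis by simp
      qed
      have da: "(a has_real_derivative a' s) (at s)" "\<bar>a' s\<bar> \<le> A'" using a'[OF s'(1,3)] by auto
      define X where "X = \<Phi> s powr (m/2)"
      have P: "0 < \<Phi> s" "\<Phi> s \<le> N" using \<Phi>[OF s'(4)] by auto
      have X: "0 < X" using P by (simp add: X_def)
      \<comment> \<open>all powers of \<open>\<Phi>\<close> in terms of \<open>X\<close>, after which the
        identity is rational\<close>
      have pw: "\<Phi> s powr m = X\<^sup>2" "\<Phi> s powr (m - 1) = X\<^sup>2 / \<Phi> s" "\<Phi> s powr (m/2 - 1) = X / \<Phi> s"
        "\<Phi> s powr (- (m/2)) = 1 / X" "\<Phi> s powr (1 - m/2) = \<Phi> s / X"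
        using P powr_add[of "\<Phi> s" "m/2" "m/2"] powr_diff[of "\<Phi> s" m 1] powr_diff[of "\<Phi> s" "m/2" 1]
          powr_minus_divide[of "\<Phi> s" "m/2"] powr_diff[of "\<Phi> s" 1 "m/2"]
        by (simp_all only: X_def power2_eq_square powr_one field_sum_of_halves)
      have sk: "sqrt \<kappa> * sqrt \<kappa> = \<kappa>" "0 < sqrt \<kappa>" using \<kappa> by auto
      have dX: "((\<lambda>s. \<Phi> s powr (m/2)) has_real_derivative m/2 * (X / \<Phi> s) * (- c (\<Phi> s) * q s)) (at s)"
        using DERIV_chain2[OF has_real_derivative_powr[OF P(1), of "m/2"] d\<Phi>] unfolding pw(3) .
      have dG: "((\<lambda>s. G (\<Phi> s)) has_real_derivative 1 / (sqrt \<kappa> * X) * (- c (\<Phi> s) * q s)) (at s)"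
      proof -
        have "((\<lambda>s. \<Phi> s powr (1 - m/2)) has_real_derivative (1 - m/2) * (1 / X) * (- c (\<Phi> s) * q s)) (at s)"
          using DERIV_chain2[OF has_real_derivative_powr[OF P(1), of "1 - m/2"] d\<Phi>] pw(4) by simp
        from DERIV_cdivide[OF this, of "sqrt \<kappa> * (1 - m/2)"] show ?thesis
          unfolding G_def using m sk by (simp add: mult_ac)
      qed
      have "(Y has_real_derivative
          sqrt \<kappa> * (m/2 * (X / \<Phi> s) * (- c (\<Phi> s) * q s)) * p s
          + sqrt \<kappa> * X * (- a s * (p s + q s) / 2 - c' (\<Phi> s) * (p s - q s) / 2 * p s)
          - (a' s / 2 * G (\<Phi> s) + a s / 2 * (1 / (sqrt \<kappa> * X) * (- c (\<Phi> s) * q s)))) (at s)"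
        unfolding Y_def g_def
        by (rule DERIV_cong[OF DERIV_diff[OF DERIV_mult[OF DERIV_cmult[OF dX] dp]
              DERIV_mult[OF DERIV_cdivide[OF da(1)] dG]]]) (simp add: X_def mult_ac)
      moreover have "sqrt \<kappa> * (m/2 * (X / \<Phi> s) * (- c (\<Phi> s) * q s)) * p s
          + sqrt \<kappa> * X * (- a s * (p s + q s) / 2 - c' (\<Phi> s) * (p s - q s) / 2 * p s)
          - (a' s / 2 * G (\<Phi> s) + a s / 2 * (1 / (sqrt \<kappa> * X) * (- c (\<Phi> s) * q s))) = Y' s"
      proof -
        obtain r where r: "sqrt \<kappa> = r" "\<kappa> = r * r" "0 < r" using sk by metis
        have Yg: "Y s + g s = sqrt \<kappa> * X * p s" by (simp add: Y_def X_def)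
        show ?thesis
          unfolding Y'_def Yg cs c'_def pw r(1) unfolding r(2) using r(3) P X
          by (simp add: field_simps power2_eq_square)
      qed
      ultimately show "(Y has_real_derivative Y' s) (at s)" by simp
      have a0: "0 \<le> a s" "a s \<le> A" using aA[of s] s' by auto
      have gs: "0 \<le> g s" "g s \<le> A * G N"
      proof -
        show "0 \<le> g s" using a0 G0 by (simp add: g_def)
        have "a s / 2 * G (\<Phi> s) \<le> A * G N" using a0 G0 GN[OF P] by (intro mult_mono) auto
        then show "g s \<le> A * G N" by (simp add: g_def)
      qed
      have "b0 \<le> sqrt \<kappa> * (m/2) * \<Phi> s powr (m/2 - 1)"
        unfolding b0_def using \<kappa> m P by (intro mult_left_mono powr_mono2') auto
      then have "b0 * (Y s + g s)\<^sup>2 \<le> sqrt \<kappa> * (m/2) * \<Phi> s powr (m/2 - 1) * (Y s + g s)\<^sup>2"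
        by (intro mult_right_mono) auto
      moreover have "- (a' s / 2 * G (\<Phi> s)) \<le> A' * G N"
      proof -
        have "- (a' s / 2 * G (\<Phi> s)) \<le> \<bar>a' s / 2\<bar> * G (\<Phi> s)"
          using G0[of "\<Phi> s"] by (simp add: abs_if mult_nonneg_nonpos2)
        also have "\<dots> \<le> A' * G N" using da(2) G0 GN[OF P] by (intro mult_mono) auto
        finally show ?thesis .
      qed
      ultimately show "0 \<le> g s \<and> g s \<le> A * G N \<and> \<bar>- (a s / 2)\<bar> \<le> A \<and>
        Y' s \<le> - (a s / 2) * (Y s + g s) - b0 * (Y s + g s)\<^sup>2 + A' * G N"
        using gs a0 unfolding Y'_def by auto
    qed
    moreover have "0 \<le> g 0" using aA[of 0] G0 by (simp add: g_def)
    ultimately show "- L0 \<le> sqrt \<kappa> * half_diff v x0 0 powr (m/2) * vx \<sigma> x0 0"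
      by (simp add: Y_def \<Phi>_def p_def y(1))
  qed
qed


section \<open>Pointwise form of the Euler system\<close>

text \<open>Continuity of the partial derivatives relative to the closed half plane is a local property, so
  that solutions can be cut and glued in time.\<close>

definition C1_at :: "(real \<Rightarrow> real \<Rightarrow> real) \<Rightarrow> real \<Rightarrow> real \<Rightarrow> bool" where
  "C1_at f x t \<longleftrightarrow> (\<lambda>y. f y t) differentiable (at x) \<and> f x differentiable (at t within {0..}) \<and>
     continuous (at (x, t) within UNIV \<times> {0..}) (\<lambda>(x, t). partial_x f x t) \<and>
     continuous (at (x, t) within UNIV \<times> {0..}) (\<lambda>(x, t). partial_t f x t)"

definition solves_at :: "real \<Rightarrow> real \<Rightarrow> real \<Rightarrow> real \<Rightarrow> (real \<Rightarrow> real \<Rightarrow> real) \<Rightarrow> (real \<Rightarrow> real \<Rightarrow> real) \<Rightarrow> real \<Rightarrow> real \<Rightarrow> bool"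
where
  "solves_at K \<gamma> \<alpha> lam \<tau> u x t \<longleftrightarrow> C1_at \<tau> x t \<and> C1_at u x t \<and> 0 < \<tau> x t \<and>
     partial_t \<tau> x t - partial_x u x t = 0 \<and>
     partial_t u x t + partial_x (pressure K \<gamma> \<tau>) x t = - (\<alpha> / (1 + t) powr lam) * u x t"

lemma strip_eq: "strip T = UNIV \<times> {0..} \<inter> UNIV \<times> {t. ereal t < T}"
  by (auto simp: strip_def)

lemma open_less_ereal: "open {t. ereal t < T}"
proof (cases T)
  case (real r)
  then show ?thesis by (simp add: lessThan_def[symmetric])
qed simp_all

lemma at_within_strip:
  assumes "(x, t) \<in> strip T"
  shows "at (x, t) within strip T = at (x, t) within UNIV \<times> {0..}"
  by (rule at_within_nhd[where S = "UNIV \<times> {t. ereal t < T}"])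
    (use assms open_less_ereal in \<open>auto simp: strip_def intro: open_Times\<close>)

lemma C1_on_strip_iff: "C1_on_strip T f \<longleftrightarrow> (\<forall>x t. (x, t) \<in> strip T \<longrightarrow> C1_at f x t)"
  unfolding C1_on_strip_def C1_at_def continuous_on_eq_continuous_within
  by (auto simp: at_within_strip)

lemma damped_Euler_solution_iff:
  "damped_Euler_solution K \<gamma> \<alpha> lam \<tau>0 u0 T \<tau> u \<longleftrightarrow>
     0 < T \<and> (\<forall>x t. (x, t) \<in> strip T \<longrightarrow> solves_at K \<gamma> \<alpha> lam \<tau> u x t) \<and>
     (\<forall>x. \<tau> x 0 = \<tau>0 x \<and> u x 0 = u0 x)"
  unfolding damped_Euler_solution_def C1_on_strip_iff solves_at_def by blast

lemma partial_cong:
  assumes U: "open U" "t \<in> U" "0 \<le> t" and eq: "\<And>y s. s \<in> U \<Longrightarrow> 0 \<le> s \<Longrightarrow> g y s = f y s"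
  shows "partial_x g x t = partial_x f x t" "partial_t g x t = partial_t f x t"
proof -
  have "(\<lambda>y. g y t) = (\<lambda>y. f y t)" using eq U by auto
  then show "partial_x g x t = partial_x f x t" by (simp add: partial_x_def)
  have "\<forall>\<^sub>F s in nhds t. s \<in> {0..} \<longrightarrow> g x s = f x s"
    using eventually_nhds_in_open[OF U(1,2)] by eventually_elim (use eq in auto)
  then show "partial_t g x t = partial_t f x t"
    unfolding partial_t_def by (rule vector_derivative_cong_eq) (use U in auto)
qed

lemma C1_at_cong:
  assumes U: "open U" "t \<in> U" "0 \<le> t" and eq: "\<And>y s. s \<in> U \<Longrightarrow> 0 \<le> s \<Longrightarrow> g y s = f y s"
    and f: "C1_at f x t"
  shows "C1_at g x t"
proof -
  have ev: "\<forall>\<^sub>F p in at (x, t) within UNIV \<times> {0..}. snd p \<in> U \<and> 0 \<le> snd p"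
    unfolding eventually_at_topological
    by (rule exI[of _ "UNIV \<times> U"]) (use U in \<open>auto intro: open_Times\<close>)
  have px: "\<forall>\<^sub>F p in at (x, t) within UNIV \<times> {0..}. (\<lambda>(x, t). partial_x f x t) p = (\<lambda>(x, t). partial_x g x t) p"
    using ev by eventually_elim (auto simp: partial_cong(1)[OF U(1) _ _ eq])
  have pt: "\<forall>\<^sub>F p in at (x, t) within UNIV \<times> {0..}. (\<lambda>(x, t). partial_t f x t) p = (\<lambda>(x, t). partial_t g x t) p"
    using ev by eventually_elim (auto simp: partial_cong(2)[OF U(1) _ _ eq])
  have "continuous (at (x, t) within UNIV \<times> {0..}) (\<lambda>(x, t). partial_x g x t)"
    using Lim_transform_eventually[OF _ px] f partial_cong(1)[OF U eq]
    unfolding C1_at_def continuous_within by simp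
  moreover have "continuous (at (x, t) within UNIV \<times> {0..}) (\<lambda>(x, t). partial_t g x t)"
    using Lim_transform_eventually[OF _ pt] f partial_cong(2)[OF U eq]
    unfolding C1_at_def continuous_within by simp
  moreover have "g x differentiable (at t within {0..})"
  proof -
    obtain D where "(f x has_derivative D) (at t within {0..})"
      using f unfolding C1_at_def differentiable_def by blast
    moreover obtain r where r: "0 < r" "ball t r \<subseteq> U" by (rule openE[OF U(1,2)])
    have "f x s = g x s" if "s \<in> {0..}" "dist s t < r" for s
    proof -
      have "s \<in> ball t r" using that by (simp add: dist_commute)
      then show ?thesis using eq[of s x] r that by auto
    qed
    ultimately have "(g x has_derivative D) (at t within {0..})"
      using U r(1) by (auto intro: has_derivative_transform_within)
    then show ?thesis by (auto simp: differentiable_def)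
  qed
  moreover have "(\<lambda>y. g y t) = (\<lambda>y. f y t)" using eq U by auto
  ultimately show ?thesis using f by (simp add: C1_at_def)
qed

lemma solves_at_cong:
  assumes U: "open U" "t \<in> U" "0 \<le> t"
    and eq: "\<And>y s. s \<in> U \<Longrightarrow> 0 \<le> s \<Longrightarrow> \<tau>' y s = \<tau> y s" "\<And>y s. s \<in> U \<Longrightarrow> 0 \<le> s \<Longrightarrow> u' y s = u y s"
    and f: "solves_at K \<gamma> \<alpha> lam \<tau> u x t"
  shows "solves_at K \<gamma> \<alpha> lam \<tau>' u' x t"
proof -
  have "pressure K \<gamma> \<tau>' y s = pressure K \<gamma> \<tau> y s" if "s \<in> U" "0 \<le> s" for y s
    using eq that by (simp add: pressure_def)
  then have p: "partial_x (pressure K \<gamma> \<tau>') x t = partial_x (pressure K \<gamma> \<tau>) x t"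
    by (rule partial_cong(1)[OF U])
  have "C1_at \<tau>' x t" "C1_at u' x t"
    using f C1_at_cong[OF U eq(1)] C1_at_cong[OF U eq(2)] by (auto simp: solves_at_def)
  moreover have "\<tau>' x t = \<tau> x t" "u' x t = u x t" using eq U by auto
  moreover have "partial_t \<tau>' x t = partial_t \<tau> x t" "partial_t u' x t = partial_t u x t"
    "partial_x u' x t = partial_x u x t"
    using partial_cong[OF U eq(1)] partial_cong[OF U eq(2)] by auto
  ultimately show ?thesis
    using f p unfolding solves_at_def by simp
qed

lemma at_within_nonneg: "0 < t \<Longrightarrow> at t within {0..} = at (t :: real)"
  by (rule at_within_interior) (simp add: interior_real_atLeast)

lemma C1_at_derivs:
  assumes "C1_at f x t"
  shows "((\<lambda>y. f y t) has_real_derivative partial_x f x t) (at x)"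
    and "0 < t \<Longrightarrow> (f x has_real_derivative partial_t f x t) (at t)"
    and "0 \<le> t \<Longrightarrow> (f x has_real_derivative partial_t f x t) (at t within {0..})"
proof -
  show "((\<lambda>y. f y t) has_real_derivative partial_x f x t) (at x)"
    using assms unfolding C1_at_def partial_x_def
    by (meson DERIV_deriv_iff_real_differentiable)
  show *: "(f x has_real_derivative partial_t f x t) (at t within {0..})" if "0 \<le> t"
    using assms unfolding C1_at_def partial_t_def has_real_derivative_iff_has_vector_derivative
    by (simp add: vector_derivative_works)
  show "(f x has_real_derivative partial_t f x t) (at t)" if "0 < t"
    using * that at_within_nonneg[OF that] by simp
qed

lemma C1_atI:
  assumes dx: "\<And>y s. s \<in> {p<..<q} \<Longrightarrow> ((\<lambda>y. f y s) has_real_derivative fx y s) (at y)"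
    and dt: "\<And>y s. s \<in> {p<..<q} \<Longrightarrow> (f y has_real_derivative ft y s) (at s)"
    and cx: "continuous_on (UNIV \<times> {p<..<q}) (\<lambda>(x, t). fx x t)"
    and ct: "continuous_on (UNIV \<times> {p<..<q}) (\<lambda>(x, t). ft x t)"
    and t: "t \<in> {p<..<q}" "0 \<le> p"
  shows "C1_at f x t" "partial_x f x t = fx x t" "partial_t f x t = ft x t"
proof -
  have px: "partial_x f y s = fx y s" if "s \<in> {p<..<q}" for y s
    unfolding partial_x_def using dx[OF that] by (rule DERIV_imp_deriv)
  have pt: "partial_t f y s = ft y s" if "s \<in> {p<..<q}" for y s
  proof -
    have "(f y has_vector_derivative ft y s) (at s within {0..})"
      using dt[OF that] unfolding has_real_derivative_iff_has_vector_derivative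
      by (rule has_vector_derivative_at_within)
    moreover have "at s within {0..} \<noteq> bot" using that t at_within_nonneg[of s] by simp
    ultimately show ?thesis unfolding partial_t_def by (simp add: vector_derivative_within)
  qed
  show "partial_x f x t = fx x t" "partial_t f x t = ft x t" using px pt t by auto
  have op: "open (UNIV \<times> {p<..<q} :: (real \<times> real) set)" by (intro open_Times) auto
  have cc: "continuous (at (x, t) within UNIV \<times> {0..}) (\<lambda>(x, t). g x t)"
    if "continuous_on (UNIV \<times> {p<..<q}) (\<lambda>(x, t). h x t)" "\<And>y s. s \<in> {p<..<q} \<Longrightarrow> g y s = h y s" for g h :: "real \<Rightarrow> real \<Rightarrow> real"
  proof -
    have "continuous_on (UNIV \<times> {p<..<q}) (\<lambda>(x, t). g x t)"
      using that(1) by (rule continuous_on_cong[THEN iffD1, rotated -1]) (use that(2) in auto)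
    then have "isCont (\<lambda>(x, t). g x t) (x, t)"
      using t unfolding continuous_on_eq_continuous_at[OF op] by simp
    then show ?thesis by (rule continuous_at_imp_continuous_at_within)
  qed
  show "C1_at f x t"
    unfolding C1_at_def
  proof (intro conjI)
    show "(\<lambda>y. f y t) differentiable at x"
      using dx[OF t(1)] by (auto simp: real_differentiable_def)
    have "f x differentiable at t"
      using dt[OF t(1)] by (auto simp: real_differentiable_def)
    then show "f x differentiable at t within {0..}" by (rule differentiable_at_withinI)
  qed (rule cc[OF cx px] cc[OF ct pt], assumption)+
qed


section \<open>Riemann invariants of the gas\<close>

text \<open>The pressure law in terms of \<open>\<phi> = kphi \<tau>\<^bsup>-(\<gamma>-1)/2\<^esup>\<close>: the speed of sound
  \<open>\<surd>(K \<gamma>) \<tau>\<^bsup>-(\<gamma>+1)/2\<^esup>\<close> is \<open>\<kappa> \<phi>\<^bsup>m\<^esup>\<close>.  It is continued by \<open>0\<close> to negative \<open>\<phi>\<close>, which keeps it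
  \<open>C\<^sup>1\<close>, so that local existence does not have to deal with the vacuum.\<close>

locale gas =
  fixes K \<gamma> :: real
  assumes K: "0 < K" and gamma: "3 < \<gamma>"
begin

definition "m = (\<gamma> + 1) / (\<gamma> - 1)"
definition "kphi = 2 * sqrt (K * \<gamma>) / (\<gamma> - 1)"
definition "\<kappa> = sqrt (K * \<gamma>) / kphi powr m"
definition "sound y = \<kappa> * max 0 y powr m"
definition "sound' y = \<kappa> * (m * max 0 y powr (m - 1))"

lemma gas_consts: "1 < m" "m < 2" "0 < kphi" "0 < \<kappa>" "0 < sqrt (K * \<gamma>)"
  using K gamma by (auto simp: m_def kphi_def \<kappa>_def field_simps)

lemma sound_pos: "0 < y \<Longrightarrow> sound y = \<kappa> * y powr m"
  by (simp add: sound_def)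

lemma sound'_cont: "continuous_on X sound'"
  unfolding sound'_def[abs_def] using gas_consts
  by (intro continuous_intros continuous_on_powr') auto

lemma sound_deriv: "(sound has_real_derivative sound' y) (at y)"
proof -
  consider "y < 0" | "y = 0" | "0 < y" by linarith
  then show ?thesis
  proof cases
    case 1
    have "((\<lambda>_. 0) has_real_derivative 0) (at y)" by simp
    then have "(sound has_real_derivative 0) (at y)"
      by (rule has_field_derivative_transform_within_open[of _ _ _ "{..<0}"]) (use 1 in \<open>auto simp: sound_def\<close>)
    then show ?thesis using 1 by (simp add: sound'_def)
  next
    case 2
    have "isCont sound' 0" using sound'_cont[of UNIV] by (simp add: continuous_on_eq_continuous_at)
    then have "(sound' \<longlongrightarrow> sound' 0) (at 0)" by (simp add: isCont_def)
    then have "((\<lambda>h. sound' h / m) \<longlongrightarrow> sound' 0 / m) (at 0)" using gas_consts by (intro tendsto_intros) auto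
    moreover have "\<forall>\<^sub>F h in at 0. sound' h / m = (sound h - sound 0) / (h - 0)"
      unfolding eventually_at_filter
      by (rule always_eventually) (use gas_consts in \<open>auto simp: sound_def sound'_def powr_diff max_def\<close>)
    ultimately have "((\<lambda>h. (sound h - sound 0) / (h - 0)) \<longlongrightarrow> sound' 0 / m) (at 0)"
      by (rule Lim_transform_eventually)
    then show ?thesis using 2 gas_consts by (simp add: has_field_derivative_iff sound'_def)
  next
    case 3
    have "((\<lambda>y. \<kappa> * y powr m) has_real_derivative sound' y) (at y)"
      unfolding sound'_def using 3 by (auto intro!: derivative_eq_intros)
    then show ?thesis
      by (rule has_field_derivative_transform_within_open[of _ _ _ "{0<..}"]) (use 3 in \<open>auto simp: sound_def\<close>)
  qed
qed

lemma sound_bound: "\<bar>y\<bar> \<le> N \<Longrightarrow> \<bar>sound y\<bar> \<le> sound N"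
  using gas_consts by (auto simp: sound_def abs_mult intro!: mult_left_mono powr_mono2)

lemma sound'_bound: "\<bar>y\<bar> \<le> N \<Longrightarrow> \<bar>sound' y\<bar> \<le> sound' N"
  using gas_consts by (auto simp: sound'_def abs_mult intro!: mult_left_mono powr_mono2)

lemma sound_lip: "\<bar>y\<bar> \<le> N \<Longrightarrow> \<bar>z\<bar> \<le> N \<Longrightarrow> \<bar>sound y - sound z\<bar> \<le> sound' N * \<bar>y - z\<bar>"
  using field_differentiable_bound[of "{-N..N}" sound sound' "sound' N" z y] sound'_bound sound_deriv
  by (auto simp: has_field_derivative_at_within abs_le_iff abs_minus_commute[of z y])

lemma phi_pos: "0 < \<tau> x t \<Longrightarrow> 0 < phi K \<gamma> \<tau> x t"
  unfolding phi_def kphi_def[symmetric] using gas_consts by simp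

lemma sound_phi: "0 < \<tau> x t \<Longrightarrow> sound (phi K \<gamma> \<tau> x t) = sqrt (K * \<gamma>) * \<tau> x t powr (- ((\<gamma> + 1) / 2))"
proof -
  assume t: "0 < \<tau> x t"
  have "phi K \<gamma> \<tau> x t powr m = kphi powr m * (\<tau> x t powr (- ((\<gamma> - 1) / 2))) powr m"
    unfolding phi_def kphi_def[symmetric] by (rule powr_mult)
  also have "(\<tau> x t powr (- ((\<gamma> - 1) / 2))) powr m = \<tau> x t powr (- ((\<gamma> + 1) / 2))"
  proof -
    have "- ((\<gamma> - 1) / 2) * m = - ((\<gamma> + 1) / 2)" unfolding m_def using gamma by (simp add: divide_simps algebra_simps)
    then show ?thesis by (simp only: powr_powr)
  qed
  finally show ?thesis
    using sound_pos[OF phi_pos[of \<tau> x t, OF t]] gas_consts by (simp add: \<kappa>_def)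
qed

lemma phi_of_tau_deriv:
  assumes "0 < y"
  shows "((\<lambda>y. 2 * sqrt (K * \<gamma>) / (\<gamma> - 1) * y powr (- ((\<gamma> - 1) / 2))) has_real_derivative
     - (sqrt (K * \<gamma>) * y powr (- ((\<gamma> + 1) / 2)))) (at y)"
proof -
  have "((\<lambda>y. kphi * y powr (- ((\<gamma> - 1) / 2))) has_real_derivative kphi * (- ((\<gamma> - 1) / 2) * y powr (- ((\<gamma> - 1) / 2) - 1))) (at y)"
    by (rule DERIV_cmult[OF has_real_derivative_powr[OF assms]])
  moreover have "- ((\<gamma> - 1) / 2) - 1 = - ((\<gamma> + 1) / 2)" by (simp add: field_simps)
  moreover have "kphi * (- ((\<gamma> - 1) / 2) * r) = - (sqrt (K * \<gamma>) * r)" for r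
    using gamma by (simp add: kphi_def)
  ultimately show ?thesis unfolding kphi_def by simp
qed

lemma pressure_of_tau_deriv:
  assumes "0 < y"
  shows "((\<lambda>y. K * y powr (- \<gamma>)) has_real_derivative
     - (sqrt (K * \<gamma>) * y powr (- ((\<gamma> + 1) / 2)))\<^sup>2) (at y)"
proof -
  have "((\<lambda>y. K * y powr (- \<gamma>)) has_real_derivative K * (- \<gamma> * y powr (- \<gamma> - 1))) (at y)"
    by (rule DERIV_cmult[OF has_real_derivative_powr[OF assms]])
  moreover have "(y powr (- ((\<gamma> + 1) / 2)))\<^sup>2 = y powr (- \<gamma> - 1)"
    unfolding power2_eq_square powr_add[symmetric] by (rule arg_cong[where f = "\<lambda>e. y powr e"]) (simp add: field_simps)
  moreover have "(sqrt (K * \<gamma>))\<^sup>2 = K * \<gamma>" using K gamma by simp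
  ultimately show ?thesis by (simp add: power_mult_distrib mult.assoc)
qed

lemma solution_derivs:
  assumes "solves_at K \<gamma> \<alpha> lam \<tau> u x t"
  defines "c \<equiv> sound (phi K \<gamma> \<tau> x t)"
  shows "((\<lambda>y. phi K \<gamma> \<tau> y t) has_real_derivative - c * partial_x \<tau> x t) (at x)"
    and "0 < t \<Longrightarrow> (phi K \<gamma> \<tau> x has_real_derivative - c * partial_t \<tau> x t) (at t)"
    and "partial_x (pressure K \<gamma> \<tau>) x t = - c\<^sup>2 * partial_x \<tau> x t"
proof -
  have C: "C1_at \<tau> x t" and pos: "0 < \<tau> x t" using assms(1) by (auto simp: solves_at_def)
  note dx = C1_at_derivs(1)[OF C] and dt = C1_at_derivs(2)[OF C]
  have c: "c = sqrt (K * \<gamma>) * \<tau> x t powr (- ((\<gamma> + 1) / 2))"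
    unfolding c_def by (rule sound_phi[of \<tau> x t, OF pos])
  show "((\<lambda>y. phi K \<gamma> \<tau> y t) has_real_derivative - c * partial_x \<tau> x t) (at x)"
    using DERIV_chain2[OF phi_of_tau_deriv[OF pos] dx] unfolding phi_def c by simp
  show "(phi K \<gamma> \<tau> x has_real_derivative - c * partial_t \<tau> x t) (at t)" if "0 < t"
    using DERIV_chain2[OF phi_of_tau_deriv[OF pos] dt[OF that]] unfolding phi_def[abs_def] c by simp
  show "partial_x (pressure K \<gamma> \<tau>) x t = - c\<^sup>2 * partial_x \<tau> x t"
    using DERIV_chain2[OF pressure_of_tau_deriv[OF pos] dx] unfolding partial_x_def pressure_def[abs_def] c
    by (intro DERIV_imp_deriv) simp
qed

definition rinv :: "(real \<Rightarrow> real \<Rightarrow> real) \<Rightarrow> (real \<Rightarrow> real \<Rightarrow> real) \<Rightarrow> bool \<Rightarrow> real \<Rightarrow> real \<Rightarrow> real" where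
  "rinv \<tau> u \<sigma> x t = u x t + sg \<sigma> * phi K \<gamma> \<tau> x t"

text \<open>The space derivative of the invariant, since \<open>\<phi>\<^sub>x = - c \<tau>\<^sub>x\<close>.\<close>

definition rinv_x :: "(real \<Rightarrow> real \<Rightarrow> real) \<Rightarrow> (real \<Rightarrow> real \<Rightarrow> real) \<Rightarrow> bool \<Rightarrow> real \<Rightarrow> real \<Rightarrow> real" where
  "rinv_x \<tau> u \<sigma> x t = partial_x u x t - sg \<sigma> * sound (phi K \<gamma> \<tau> x t) * partial_x \<tau> x t"

lemma half_rinv: "half_diff (rinv \<tau> u) x t = phi K \<gamma> \<tau> x t" "half_sum (rinv \<tau> u) x t = u x t"
  by (auto simp: half_diff_def half_sum_def rinv_def sg_def)

lemma rinv_derivs: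
  assumes s: "solves_at K \<gamma> \<alpha> lam \<tau> u x t"
  shows "((\<lambda>x. rinv \<tau> u \<sigma> x t) has_real_derivative rinv_x \<tau> u \<sigma> x t) (at x)"
    and "0 < t \<Longrightarrow> (rinv \<tau> u \<sigma> x has_real_derivative - (\<alpha> / (1 + t) powr lam) * half_sum (rinv \<tau> u) x t
       - sg \<sigma> * sound (half_diff (rinv \<tau> u) x t) * rinv_x \<tau> u \<sigma> x t) (at t)"
    and "rinv_x \<tau> u \<sigma> x t = partial_x u x t + sg \<sigma> * partial_x (phi K \<gamma> \<tau>) x t"
proof -
  note d = solution_derivs[OF s]
  have C: "C1_at u x t" using s by (simp add: solves_at_def)
  show "((\<lambda>x. rinv \<tau> u \<sigma> x t) has_real_derivative rinv_x \<tau> u \<sigma> x t) (at x)"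
    unfolding rinv_def using DERIV_add[OF C1_at_derivs(1)[OF C] DERIV_cmult[OF d(1), of "sg \<sigma>"]]
    by (simp add: rinv_x_def mult.assoc)
  show "rinv_x \<tau> u \<sigma> x t = partial_x u x t + sg \<sigma> * partial_x (phi K \<gamma> \<tau>) x t"
    using DERIV_imp_deriv[OF d(1)] by (simp add: rinv_x_def partial_x_def)
  assume t: "0 < t"
  have "(rinv \<tau> u \<sigma> x has_real_derivative partial_t u x t + sg \<sigma> * (- sound (phi K \<gamma> \<tau> x t) * partial_t \<tau> x t)) (at t)"
    unfolding rinv_def using DERIV_add[OF C1_at_derivs(2)[OF C t] DERIV_cmult[OF d(2)[OF t], of "sg \<sigma>"]] .
  moreover have "partial_t \<tau> x t = partial_x u x t"
    "partial_t u x t = - (\<alpha> / (1 + t) powr lam) * u x t + (sound (phi K \<gamma> \<tau> x t))\<^sup>2 * partial_x \<tau> x t"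
    using s d(3) by (auto simp: solves_at_def)
  ultimately show "(rinv \<tau> u \<sigma> x has_real_derivative - (\<alpha> / (1 + t) powr lam) * half_sum (rinv \<tau> u) x t
       - sg \<sigma> * sound (half_diff (rinv \<tau> u) x t) * rinv_x \<tau> u \<sigma> x t) (at t)"
    unfolding half_rinv rinv_x_def by (cases \<sigma>) (auto simp: sg_def algebra_simps power2_eq_square)
qed

end

lemma C1_at_continuous:
  assumes C: "\<And>y s. (y, s) \<in> strip T \<Longrightarrow> C1_at f y s" and p: "(x, t) \<in> strip T"
  shows "continuous (at (x, t) within UNIV \<times> {0..}) (\<lambda>(x, t). f x t)"
  unfolding continuous_within
proof (rule tendstoI)
  fix e :: real assume e: "0 < e"
  have t: "0 \<le> t" using p by (simp add: strip_def)
  let ?F = "at (x, t) within UNIV \<times> {0..}"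
  have "((\<lambda>(x, t). partial_x f x t) \<longlongrightarrow> partial_x f x t) ?F"
    using C[OF p] by (auto simp: C1_at_def continuous_within)
  from tendstoD[OF this, of 1] obtain r where r: "0 < r"
    "\<And>y s. 0 \<le> s \<Longrightarrow> (y, s) \<noteq> (x, t) \<Longrightarrow> dist (y, s) (x, t) < r \<Longrightarrow> dist (partial_x f y s) (partial_x f x t) < 1"
    unfolding eventually_at by auto
  define B where "B = \<bar>partial_x f x t\<bar> + 1"
  have B: "\<bar>partial_x f y s\<bar> \<le> B" if "0 \<le> s" "dist (y, s) (x, t) < r" for y s
    using r(2)[OF that(1) _ that(2)] by (cases "(y, s) = (x, t)") (auto simp: B_def dist_real_def)
  have "((\<lambda>p. B * \<bar>fst p - x\<bar>) \<longlongrightarrow> B * \<bar>x - x\<bar>) ?F"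
    using tendsto_fst[OF tendsto_ident_at, of "(x, t)" "UNIV \<times> {0..}"] by (intro tendsto_intros) auto
  from tendstoD[OF this, of "e / 2"] e have 1: "\<forall>\<^sub>F p in ?F. B * \<bar>fst p - x\<bar> < e / 2"
    by (auto simp: B_def dist_real_def abs_mult)
  have fx: "(f x \<longlongrightarrow> f x t) (at t within {0..})"
    using DERIV_continuous[OF C1_at_derivs(3)[OF C[OF p] t]] by (simp add: continuous_within)
  have "\<exists>r>0. \<forall>s\<ge>0. \<bar>s - t\<bar> < r \<longrightarrow> \<bar>f x s - f x t\<bar> < e / 2"
  proof -
    from tendstoD[OF fx, of "e / 2"] e
    obtain r where r: "0 < r" "\<And>s. 0 \<le> s \<Longrightarrow> s \<noteq> t \<Longrightarrow> dist s t < r \<Longrightarrow> dist (f x s) (f x t) < e / 2"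
      unfolding eventually_at by auto
    have "\<bar>f x s - f x t\<bar> < e / 2" if "0 \<le> s" "\<bar>s - t\<bar> < r" for s
      using r(2)[of s] that e by (cases "s = t") (auto simp: dist_real_def)
    then show ?thesis using r(1) by blast
  qed
  then obtain r2 where r2: "0 < r2" "\<And>s. 0 \<le> s \<Longrightarrow> \<bar>s - t\<bar> < r2 \<Longrightarrow> \<bar>f x s - f x t\<bar> < e / 2" by blast
  have strip_ev: "\<forall>\<^sub>F p in ?F. p \<in> strip T"
    unfolding eventually_at_topological strip_eq
    by (rule exI[of _ "UNIV \<times> {t. ereal t < T}"]) (use p open_less_ereal in \<open>auto simp: strip_def intro: open_Times\<close>)
  have near: "\<forall>\<^sub>F p in ?F. dist p (x, t) < min r r2"
    using r r2 by (auto simp: eventually_at intro!: exI[of _ "min r r2"])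
  show "\<forall>\<^sub>F p in ?F. dist (case p of (x, t) \<Rightarrow> f x t) (case (x, t) of (x, t) \<Rightarrow> f x t) < e"
    using 1 strip_ev near
  proof eventually_elim
    case (elim p)
    obtain y s where ys: "p = (y, s)" by (cases p)
    have s: "0 \<le> s" using elim ys by (auto simp: strip_def)
    have ds: "\<bar>s - t\<bar> < r2" "dist (y, s) (x, t) < r"
      using elim dist_snd_le[of p "(x, t)"] by (auto simp: ys dist_real_def)
    have "norm (f y s - f x s) \<le> B * norm (y - x)"
    proof (rule field_differentiable_bound[of "closed_segment x y" "\<lambda>z. f z s" "\<lambda>z. partial_x f z s"])
      fix z assume z: "z \<in> closed_segment x y"
      show "((\<lambda>z. f z s) has_field_derivative partial_x f z s) (at z within closed_segment x y)"
        by (rule has_field_derivative_at_within[OF C1_at_derivs(1)[OF C]])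
          (use elim in \<open>auto simp: ys strip_def\<close>)
      have "\<bar>z - x\<bar> \<le> \<bar>y - x\<bar>" using z by (auto simp: closed_segment_eq_real_ivl split: if_splits)
      then have "dist (z, s) (x, t) \<le> dist (y, s) (x, t)"
        unfolding dist_Pair_Pair by (intro real_sqrt_le_mono add_right_mono power_mono) (auto simp: dist_real_def)
      then show "norm (partial_x f z s) \<le> B" using B[OF s, of z] ds by simp
    qed auto
    then have "\<bar>f y s - f x s\<bar> < e / 2" using elim by (simp add: ys)
    moreover have "\<bar>f x s - f x t\<bar> < e / 2" using r2(2)[OF s ds(1)] .
    ultimately have "\<bar>f y s - f x t\<bar> < e" by linarith
    then show ?case by (simp add: ys dist_real_def)
  qed
qed

lemma DERIV_shift_left:
  assumes "(f has_real_derivative D) (at (c + x))"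
  shows "((\<lambda>s. f (c + s)) has_real_derivative D) (at x)"
  using DERIV_shift[of f D x c] assms by (simp add: add.commute)

lemma continuous_on_stripI:
  assumes "\<And>x t. (x, t) \<in> strip T \<Longrightarrow> continuous (at (x, t) within UNIV \<times> {0..}) (\<lambda>(x, t). f x t)"
  shows "continuous_on (strip T) (\<lambda>(x, t). f x t)"
  unfolding continuous_on_eq_continuous_within using assms by (auto simp: at_within_strip)

lemma riemann_half_derivs:
  assumes sol: "riemann_solution c a d v vx" and s: "0 < s" "s < d"
  shows "((\<lambda>x. half_diff v x s) has_real_derivative half_diff vx x s) (at x)"
    and "((\<lambda>x. half_sum v x s) has_real_derivative half_sum vx x s) (at x)"
    and "((\<lambda>s. half_diff v x s) has_real_derivative - c (half_diff v x s) * half_sum vx x s) (at s)"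
    and "((\<lambda>s. half_sum v x s) has_real_derivative
      - a s * half_sum v x s - c (half_diff v x s) * half_diff vx x s) (at s)"
proof -
  have dx: "((\<lambda>x. v \<sigma> x s) has_real_derivative vx \<sigma> x s) (at x)"
    and dt: "(v \<sigma> x has_real_derivative - a s * half_sum v x s - sg \<sigma> * c (half_diff v x s) * vx \<sigma> x s) (at s)"
    for \<sigma> x
    using sol s by (auto simp: riemann_solution_def)
  show "((\<lambda>x. half_diff v x s) has_real_derivative half_diff vx x s) (at x)"
    and "((\<lambda>x. half_sum v x s) has_real_derivative half_sum vx x s) (at x)"
    and "((\<lambda>s. half_diff v x s) has_real_derivative - c (half_diff v x s) * half_sum vx x s) (at s)"
    and "((\<lambda>s. half_sum v x s) has_real_derivative
      - a s * half_sum v x s - c (half_diff v x s) * half_diff vx x s) (at s)"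
    using dx[of True] dx[of False] dt[of True x] dt[of False x]
    unfolding half_diff_def half_sum_def
    by (auto intro!: derivative_eq_intros simp: sg_def field_simps)
qed

context gas
begin

lemma sound_cont: "continuous_on X sound"
  using sound_deriv by (meson DERIV_continuous_on has_field_derivative_at_within)

lemma rinv_continuous:
  assumes s: "\<And>x t. (x, t) \<in> strip T \<Longrightarrow> solves_at K \<gamma> \<alpha> lam \<tau> u x t"
  shows "continuous_on (strip T) (\<lambda>(x, t). rinv \<tau> u \<sigma> x t)"
    and "continuous_on (strip T) (\<lambda>(x, t). rinv_x \<tau> u \<sigma> x t)"
proof -
  have C: "C1_at \<tau> x t" "C1_at u x t" "0 < \<tau> x t" if "(x, t) \<in> strip T" for x t
    using s[OF that] by (auto simp: solves_at_def)
  have c: "continuous_on (strip T) (\<lambda>(x, t). \<tau> x t)" "continuous_on (strip T) (\<lambda>(x, t). u x t)"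
    using C by (auto intro!: continuous_on_stripI C1_at_continuous)
  have cx: "continuous_on (strip T) (\<lambda>(x, t). partial_x \<tau> x t)" "continuous_on (strip T) (\<lambda>(x, t). partial_x u x t)"
    using C by (auto intro!: continuous_on_stripI simp: C1_at_def)
  have cp: "continuous_on (strip T) (\<lambda>(x, t). phi K \<gamma> \<tau> x t)"
    unfolding phi_def case_prod_beta
    by (intro continuous_intros c[unfolded case_prod_beta]) (use C(3) in \<open>auto simp: less_le\<close>)
  show "continuous_on (strip T) (\<lambda>(x, t). rinv \<tau> u \<sigma> x t)"
    unfolding rinv_def case_prod_beta by (intro continuous_intros c[unfolded case_prod_beta] cp[unfolded case_prod_beta])
  have "continuous_on (strip T) (\<lambda>(x, t). sound (phi K \<gamma> \<tau> x t))"
    unfolding case_prod_beta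
    by (rule continuous_on_compose2[OF sound_cont[of UNIV] cp[unfolded case_prod_beta]]) auto
  then show "continuous_on (strip T) (\<lambda>(x, t). rinv_x \<tau> u \<sigma> x t)"
    unfolding rinv_x_def case_prod_beta by (intro continuous_intros cx[unfolded case_prod_beta])
qed

text \<open>The Euler system restarted at time \<open>t1\<close>, in diagonal form.\<close>

lemma solution_riemann:
  assumes s: "\<And>x t. (x, t) \<in> strip T \<Longrightarrow> solves_at K \<gamma> \<alpha> lam \<tau> u x t"
    and t1: "0 \<le> t1" "ereal (t1 + T2) \<le> T"
    and a: "\<And>s. 0 < s \<Longrightarrow> s < T2 \<Longrightarrow> a s = \<alpha> / (1 + (t1 + s)) powr lam"
  shows "riemann_solution sound a T2 (\<lambda>\<sigma> x s. rinv \<tau> u \<sigma> x (t1 + s)) (\<lambda>\<sigma> x s. rinv_x \<tau> u \<sigma> x (t1 + s))"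
    and "continuous_on (UNIV \<times> {0..<T2}) (\<lambda>(x, s). rinv_x \<tau> u \<sigma> x (t1 + s))"
    and "\<And>\<sigma> x s. 0 \<le> s \<Longrightarrow> s < T2 \<Longrightarrow> ((\<lambda>x. rinv \<tau> u \<sigma> x (t1 + s)) has_real_derivative rinv_x \<tau> u \<sigma> x (t1 + s)) (at x)"
proof -
  have mem: "(x, t1 + s) \<in> strip T" if "0 \<le> s" "s < T2" for x s
  proof -
    have "ereal (t1 + s) < ereal (t1 + T2)" using that by simp
    also note t1(2)
    finally show ?thesis using that t1 by (simp add: strip_def)
  qed
  have shift: "continuous_on (UNIV \<times> {0..<T2}) (\<lambda>(x, s). f x (t1 + s))"
    if "continuous_on (strip T) (\<lambda>(x, t). f x t)" for f :: "real \<Rightarrow> real \<Rightarrow> real"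
  proof -
    have "continuous_on (UNIV \<times> {0..<T2}) (\<lambda>p. case (fst p, t1 + snd p) of (x, t) \<Rightarrow> f x t)"
      by (rule continuous_on_compose2[OF that]) (use mem in \<open>auto intro!: continuous_intros\<close>)
    then show ?thesis by (simp add: case_prod_beta)
  qed
  show c: "continuous_on (UNIV \<times> {0..<T2}) (\<lambda>(x, s). rinv_x \<tau> u \<sigma> x (t1 + s))" for \<sigma>
    by (rule shift[OF rinv_continuous(2)[OF s]])
  show dx: "((\<lambda>x. rinv \<tau> u \<sigma> x (t1 + s)) has_real_derivative rinv_x \<tau> u \<sigma> x (t1 + s)) (at x)"
    if "0 \<le> s" "s < T2" for \<sigma> x s
    by (rule rinv_derivs(1)[OF assms(1)[OF mem[OF that]]])
  show "riemann_solution sound a T2 (\<lambda>\<sigma> x s. rinv \<tau> u \<sigma> x (t1 + s)) (\<lambda>\<sigma> x s. rinv_x \<tau> u \<sigma> x (t1 + s))"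
    unfolding riemann_solution_def
  proof (intro conjI allI ballI)
    show "continuous_on (UNIV \<times> {0..<T2}) (\<lambda>(x, t). rinv \<tau> u \<sigma> x (t1 + t))" for \<sigma>
      by (rule shift[OF rinv_continuous(1)[OF s]])
    show "continuous_on (UNIV \<times> {0<..<T2}) (\<lambda>(x, t). rinv_x \<tau> u \<sigma> x (t1 + t))" for \<sigma>
      using c[of \<sigma>] by (rule continuous_on_subset) auto
    fix \<sigma> x r assume r: "r \<in> {0<..<T2}"
    then have r': "0 \<le> r" "r < T2" "0 < t1 + r" "0 < r" using t1 by auto
    show "((\<lambda>x. rinv \<tau> u \<sigma> x (t1 + r)) has_real_derivative rinv_x \<tau> u \<sigma> x (t1 + r)) (at x)"
      by (rule dx[OF r'(1,2)])
    have "((\<lambda>s. rinv \<tau> u \<sigma> x (t1 + s)) has_real_derivative - (\<alpha> / (1 + (t1 + r)) powr lam) * half_sum (rinv \<tau> u) x (t1 + r)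
       - sg \<sigma> * sound (half_diff (rinv \<tau> u) x (t1 + r)) * rinv_x \<tau> u \<sigma> x (t1 + r)) (at r)"
      by (rule DERIV_shift_left[OF rinv_derivs(2)[OF assms(1)[OF mem[OF r'(1,2)]] r'(3)]])
    then show "((\<lambda>s. rinv \<tau> u \<sigma> x (t1 + s)) has_real_derivative
       - a r * half_sum (\<lambda>\<sigma> x s. rinv \<tau> u \<sigma> x (t1 + s)) x r
       - sg \<sigma> * sound (half_diff (\<lambda>\<sigma> x s. rinv \<tau> u \<sigma> x (t1 + s)) x r) * rinv_x \<tau> u \<sigma> x (t1 + r)) (at r)"
      by (simp add: a[OF r'(4,2)] half_sum_def half_diff_def)
  qed
qed

definition tau_of :: "real \<Rightarrow> real" where
  "tau_of y = (y / kphi) powr (- (2 / (\<gamma> - 1)))"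

lemma powr_inverse_exponents:
  assumes "0 < y"
  shows "(y powr (- ((\<gamma> - 1) / 2))) powr (- (2 / (\<gamma> - 1))) = y"
    and "(y powr (- (2 / (\<gamma> - 1)))) powr (- ((\<gamma> - 1) / 2)) = y"
proof -
  have "- ((\<gamma> - 1) / 2) * - (2 / (\<gamma> - 1)) = 1" "- (2 / (\<gamma> - 1)) * - ((\<gamma> - 1) / 2) = 1"
    using gamma by simp_all
  then show "(y powr (- ((\<gamma> - 1) / 2))) powr (- (2 / (\<gamma> - 1))) = y"
    "(y powr (- (2 / (\<gamma> - 1)))) powr (- ((\<gamma> - 1) / 2)) = y"
    using assms by (simp_all only: powr_powr powr_one)
qed

lemma tau_of_phi: "0 < \<tau> x t \<Longrightarrow> tau_of (phi K \<gamma> \<tau> x t) = \<tau> x t"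
  unfolding tau_of_def phi_def kphi_def[symmetric] using gas_consts
  by (simp add: powr_inverse_exponents)

lemma phi_tau_of: "0 < f x t \<Longrightarrow> phi K \<gamma> (\<lambda>x t. tau_of (f x t)) x t = f x t"
  unfolding tau_of_def phi_def kphi_def[symmetric] using gas_consts
  by (simp add: powr_inverse_exponents)

lemma tau_of_pos: "0 < y \<Longrightarrow> 0 < tau_of y"
  unfolding tau_of_def using gas_consts by simp

lemma tau_of_deriv:
  assumes y: "0 < y"
  shows "(tau_of has_real_derivative - (1 / sound y)) (at y)"
proof -
  have yk: "0 < y / kphi" using y gas_consts by simp
  have "((\<lambda>y. y / kphi) has_real_derivative 1 / kphi) (at y)" by (rule DERIV_cdivide[OF DERIV_ident])
  from DERIV_chain2[OF has_real_derivative_powr[OF yk, of "- (2 / (\<gamma> - 1))"] this]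
  have "(tau_of has_real_derivative - (2 / (\<gamma> - 1)) * (y / kphi) powr (- (2 / (\<gamma> - 1)) - 1) * (1 / kphi)) (at y)"
    unfolding tau_of_def[abs_def] .
  moreover have "- (2 / (\<gamma> - 1)) - 1 = - m" using gamma by (simp add: m_def field_simps)
  moreover have "sound y = sqrt (K * \<gamma>) * (y / kphi) powr m"
    using sound_pos[OF y] y gas_consts by (simp add: \<kappa>_def powr_divide)
  moreover have "2 / (\<gamma> - 1) * (1 / kphi) = 1 / sqrt (K * \<gamma>)"
  proof -
    have "kphi * (\<gamma> - 1) = 2 * sqrt (K * \<gamma>)" using gamma by (simp add: kphi_def)
    then have "2 / (kphi * (\<gamma> - 1)) = 1 / sqrt (K * \<gamma>)" by simp
    then show ?thesis by (simp add: mult.commute)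
  qed
  moreover have "- (2 / (\<gamma> - 1)) * P * (1 / kphi) = - ((2 / (\<gamma> - 1) * (1 / kphi)) * P)" for P
    by simp
  ultimately show ?thesis by (simp only: powr_minus_divide) simp
qed

text \<open>Conversely, a solution of the diagonal system without vacuum, started at time \<open>t1\<close>, yields a
  solution of the Euler system.\<close>

lemma riemann_to_gas:
  assumes sol: "riemann_solution sound a d v vx"
    and pos: "\<And>x s. 0 < s \<Longrightarrow> s < d \<Longrightarrow> 0 < half_diff v x s"
    and a: "\<And>s. 0 < s \<Longrightarrow> s < d \<Longrightarrow> a s = \<alpha> / (1 + (t1 + s)) powr lam"
    and t1: "0 \<le> t1" and t: "t1 < t" "t < t1 + d"
  shows "solves_at K \<gamma> \<alpha> lam (\<lambda>x t. tau_of (half_diff v x (t - t1))) (\<lambda>x t. half_sum v x (t - t1)) x t"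
proof -
  let ?T = "{t1<..<t1 + d}"
  let ?\<tau> = "\<lambda>x t. tau_of (half_diff v x (t - t1))" and ?u = "\<lambda>x t. half_sum v x (t - t1)"
  note dxd = riemann_half_derivs(1)[OF sol] and dxs = riemann_half_derivs(2)[OF sol]
    and dtd = riemann_half_derivs(3)[OF sol] and dts = riemann_half_derivs(4)[OF sol]
  have go_back: "((\<lambda>s. f (s - t1)) has_real_derivative e) (at s)" if "(f has_real_derivative e) (at (s - t1))" for f :: "real \<Rightarrow> real" and e s
    using DERIV_shift[of f e s "- t1"] that by simp
  have shift: "continuous_on (UNIV \<times> ?T) (\<lambda>p. f (fst p) (snd p - t1))"
    if "continuous_on (UNIV \<times> {0<..<d}) (\<lambda>(x, t). f x t)" for f :: "real \<Rightarrow> real \<Rightarrow> real"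
  proof -
    have "continuous_on (UNIV \<times> ?T) (\<lambda>p. case (fst p, snd p - t1) of (x, t) \<Rightarrow> f x t)"
      by (rule continuous_on_compose2[OF that]) (auto intro!: continuous_intros)
    then show ?thesis by simp
  qed
  have vc: "continuous_on (UNIV \<times> ?T) (\<lambda>p. v \<sigma> (fst p) (snd p - t1))" for \<sigma>
  proof (rule shift)
    have "continuous_on (UNIV \<times> {0..<d}) (\<lambda>(x, t). v \<sigma> x t)" using sol by (simp add: riemann_solution_def)
    then show "continuous_on (UNIV \<times> {0<..<d}) (\<lambda>(x, t). v \<sigma> x t)" by (rule continuous_on_subset) auto
  qed
  have vxc: "continuous_on (UNIV \<times> ?T) (\<lambda>p. vx \<sigma> (fst p) (snd p - t1))" for \<sigma>
    using sol by (intro shift) (simp add: riemann_solution_def)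
  have hc: "continuous_on (UNIV \<times> ?T) (\<lambda>p. half_diff v (fst p) (snd p - t1))"
    "continuous_on (UNIV \<times> ?T) (\<lambda>p. half_sum v (fst p) (snd p - t1))"
    "continuous_on (UNIV \<times> ?T) (\<lambda>p. half_diff vx (fst p) (snd p - t1))"
    "continuous_on (UNIV \<times> ?T) (\<lambda>p. half_sum vx (fst p) (snd p - t1))"
    unfolding half_diff_def half_sum_def by (intro continuous_intros vc vxc; simp)+
  have cc: "continuous_on (UNIV \<times> ?T) (\<lambda>p. sound (half_diff v (fst p) (snd p - t1)))"
    by (rule continuous_on_compose2[OF sound_cont[of UNIV] hc(1)]) auto
  have cpos: "0 < sound (half_diff v x (s - t1))" if "s \<in> ?T" for x s
    using pos[of "s - t1" x] that sound_pos[of "half_diff v x (s - t1)"] gas_consts by simp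
  have tT: "t \<in> ?T" using t by simp
  have "0 < d" using t by simp
  let ?ut = "\<lambda>x t. - (\<alpha> / (1 + t) powr lam) * half_sum v x (t - t1)
          - sound (half_diff v x (t - t1)) * half_diff vx x (t - t1)"
  let ?\<tau>x = "\<lambda>x t. - (1 / sound (half_diff v x (t - t1))) * half_diff vx x (t - t1)"
  have udx: "((\<lambda>y. ?u y s) has_real_derivative half_sum vx y (s - t1)) (at y)" if "s \<in> ?T" for y s
    using that by (intro dxs) auto
  have udt: "(?u y has_real_derivative ?ut y s) (at s)" if s: "s \<in> ?T" for y s
    using go_back[OF dts[of "s - t1" y]] a[of "s - t1"] s by simp
  have ct: "continuous_on (UNIV \<times> ?T) (\<lambda>(x, t). half_sum vx x (t - t1))"
    unfolding case_prod_beta by (rule hc(4))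
  have uct: "continuous_on (UNIV \<times> ?T) (\<lambda>(x, t). ?ut x t)"
    unfolding case_prod_beta using t1 by (intro continuous_intros hc cc) auto
  note U = C1_atI[where f = ?u and fx = "\<lambda>x t. half_sum vx x (t - t1)" and ft = ?ut and x = x,
      OF udx udt ct uct tT t1]
  have tdx: "((\<lambda>y. ?\<tau> y s) has_real_derivative ?\<tau>x y s) (at y)" if s: "s \<in> ?T" for y s
    using s by (intro DERIV_chain2[OF tau_of_deriv[OF pos] dxd]) auto
  have tdt: "(?\<tau> y has_real_derivative half_sum vx y (s - t1)) (at s)" if s: "s \<in> ?T" for y s
    using DERIV_chain2[OF tau_of_deriv[OF pos[of "s - t1" y]] go_back[OF dtd[of "s - t1" y]]] s cpos[OF s, of y] by simp
  have tcx: "continuous_on (UNIV \<times> ?T) (\<lambda>(x, t). ?\<tau>x x t)"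
    unfolding case_prod_beta by (intro continuous_intros hc cc) (use cpos in \<open>auto simp: less_le\<close>)
  note T = C1_atI[where f = ?\<tau> and ft = "\<lambda>x t. half_sum vx x (t - t1)" and fx = ?\<tau>x and x = x,
      OF tdx tdt tcx ct tT t1]
  have p: "0 < half_diff v x (t - t1)" using pos[of "t - t1" x] t by simp
  have phi: "phi K \<gamma> ?\<tau> x t = half_diff v x (t - t1)" using phi_tau_of[of "\<lambda>x t. half_diff v x (t - t1)" x t, OF p] .
  have pr: "partial_x (pressure K \<gamma> ?\<tau>) x t = sound (half_diff v x (t - t1)) * half_diff vx x (t - t1)"
  proof -
    let ?y = "tau_of (half_diff v x (t - t1))"
    have y: "0 < ?y" using tau_of_pos[OF p] .
    have "((\<lambda>y. pressure K \<gamma> ?\<tau> y t) has_real_derivative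
        - (sqrt (K * \<gamma>) * ?y powr (- ((\<gamma> + 1) / 2)))\<^sup>2 * partial_x ?\<tau> x t) (at x)"
      unfolding pressure_def using DERIV_chain2[OF pressure_of_tau_deriv[OF y] C1_at_derivs(1)[OF T(1)]] .
    then have "partial_x (pressure K \<gamma> ?\<tau>) x t = - (sqrt (K * \<gamma>) * ?y powr (- ((\<gamma> + 1) / 2)))\<^sup>2 * partial_x ?\<tau> x t"
      unfolding partial_x_def[of "pressure K \<gamma> ?\<tau>"] by (rule DERIV_imp_deriv)
    moreover have "sqrt (K * \<gamma>) * ?y powr (- ((\<gamma> + 1) / 2)) = sound (half_diff v x (t - t1))"
      using sound_phi[of ?\<tau> x t] y phi by simp
    ultimately show ?thesis using T(2) cpos[OF tT, of x] by (simp add: power2_eq_square)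
  qed
  show ?thesis
    unfolding solves_at_def using U T pr tau_of_pos[OF p] by simp
qed

text \<open>At fixed \<open>x\<close> we have \<open>\<phi>\<^sub>t = - c(\<phi>) u\<^sub>x\<close>, and \<open>c\<close> vanishes at least linearly at \<open>0\<close>.  So \<open>\<phi>\<close>
  cannot fall below an exponentially decaying barrier.\<close>

lemma phi_stays_positive:
  assumes sol: "riemann_solution sound a d v vx"
    and bd: "\<And>\<sigma> x s. 0 \<le> s \<Longrightarrow> s < d \<Longrightarrow> \<bar>v \<sigma> x s\<bar> \<le> N"
    and vx: "\<And>\<sigma> x s. 0 < s \<Longrightarrow> s < d \<Longrightarrow> \<bar>vx \<sigma> x s\<bar> \<le> M"
    and init: "0 < half_diff v x 0" and t: "0 \<le> t" "t < d"
  shows "0 < half_diff v x t"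
proof -
  define f0 where "f0 = half_diff v x 0"
  have N: "0 \<le> N" using order_trans[OF abs_ge_zero bd[of 0]] t by simp
  define k where "k = sound' N * \<bar>M\<bar> + 1"
  have c'0: "0 \<le> sound' N" using order_trans[OF abs_ge_zero sound'_bound[of 0 N]] N by simp
  define G where "G i y s = f0 / 2 * exp (- k * s) - half_diff v x s" for i :: unit and y s :: real
  have "G () 0 t < 0"
  proof (rule cone_comparison[where G = G and I = UNIV and S = t and Lam = 0 and R = 0])
    fix i
    have "continuous_on (UNIV \<times> {0..<d}) (\<lambda>p. half_diff v (fst p) (snd p))"
      using sol unfolding riemann_solution_def half_diff_def case_prod_beta by (intro continuous_intros) auto
    then have "continuous_on {(y, s). 0 \<le> s \<and> s \<le> t \<and> \<bar>y\<bar> + 0 * s \<le> (0::real)} (\<lambda>p. half_diff v (fst (x, snd p)) (snd (x, snd p)))"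
      by (rule continuous_on_compose2) (use t in \<open>auto intro!: continuous_intros\<close>)
    then show "continuous_on {(y, s). 0 \<le> s \<and> s \<le> t \<and> \<bar>y\<bar> + 0 * s \<le> (0::real)} (\<lambda>(y, s). G i y s)"
      unfolding G_def case_prod_beta by (intro continuous_intros) auto
  next
    fix i and y s :: real
    assume s: "0 < s" "s \<le> t" and G0: "G i y s = 0"
    define \<beta> where "\<beta> = f0 / 2 * exp (- k * s)"
    have "0 < \<beta>" using init by (simp add: \<beta>_def f0_def)
    moreover have "half_diff v x s = \<beta>" using G0 by (simp add: \<beta>_def G_def)
    ultimately have \<beta>: "0 < \<beta>" "half_diff v x s = \<beta>" by auto
    have sd: "0 \<le> s" "s < d" using s t by auto
    have dd: "((\<lambda>s. half_diff v x s) has_real_derivative - sound (half_diff v x s) * half_sum vx x s) (at s)"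
      by (rule riemann_half_derivs(3)[OF sol s(1) sd(2)])
    have "((\<lambda>r. half_diff v x (s + r)) has_real_derivative - sound (half_diff v x s) * half_sum vx x s) (at 0)"
      using DERIV_shift[of "half_diff v x" _ 0 s] dd by (simp add: add.commute)
    then have "((\<lambda>r. G i (y + 0 * r) (s + r)) has_real_derivative - k * \<beta> + sound \<beta> * half_sum vx x s) (at 0)"
      unfolding G_def \<beta>(2) by (auto intro!: derivative_eq_intros simp: \<beta>_def)
    moreover have "- k * \<beta> + sound \<beta> * half_sum vx x s < 0"
    proof -
      have "\<bar>\<beta>\<bar> \<le> N" using half_diff_bound[of v x s N, OF bd[OF sd]] \<beta> by simp
      from sound_lip[OF this, of 0] N gas_consts \<beta> have "\<bar>sound \<beta>\<bar> \<le> sound' N * \<beta>" by (simp add: sound_def)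
      moreover have "\<bar>half_sum vx x s\<bar> \<le> \<bar>M\<bar>"
        using half_sum_bound[of vx x s M, OF vx[OF s(1) sd(2)]] by linarith
      ultimately have "\<bar>sound \<beta> * half_sum vx x s\<bar> \<le> sound' N * \<beta> * \<bar>M\<bar>"
        unfolding abs_mult using \<beta> c'0 by (intro mult_mono) auto
      also have "\<dots> = k * \<beta> - \<beta>" by (simp add: k_def algebra_simps)
      finally show ?thesis using \<beta> by linarith
    qed
    ultimately show "\<exists>b m. \<bar>b\<bar> \<le> 0 \<and> m < 0 \<and> ((\<lambda>r. G i (y + b * r) (s + r)) has_real_derivative m) (at_left 0)"
      by (intro exI[of _ 0] exI[of _ "- k * \<beta> + sound \<beta> * half_sum vx x s"]) (auto intro: has_field_derivative_at_within)
  qed (use t init in \<open>auto simp: G_def f0_def\<close>)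
  moreover have "0 < f0 / 2 * exp (- k * t)" using init by (simp add: f0_def)
  ultimately show ?thesis by (simp add: G_def)
qed

end


section \<open>Uniqueness and continuation of Euler solutions\<close>

lemma damping_cont: "continuous_on {0..} (\<lambda>s. \<alpha> / (1 + s) powr lam)" for \<alpha> lam :: real
  by (intro continuous_intros) auto

lemma damping_bounded:
  fixes \<alpha> lam r :: real
  obtains A where "0 \<le> A" "\<And>s. 0 \<le> s \<Longrightarrow> s \<le> r \<Longrightarrow> \<bar>\<alpha> / (1 + s) powr lam\<bar> \<le> A"
proof -
  have "bounded ((\<lambda>s. \<alpha> / (1 + s) powr lam) ` {0..r})"
    by (intro compact_imp_bounded compact_continuous_image continuous_on_subset[OF damping_cont]) auto
  then obtain B where "\<forall>z\<in>(\<lambda>s. \<alpha> / (1 + s) powr lam) ` {0..r}. norm z \<le> B"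
    unfolding bounded_iff by blast
  then show ?thesis by (intro that[of "max 0 B"]) (auto simp: le_max_iff_disj)
qed

lemma damping_deriv:
  "0 < t \<Longrightarrow> ((\<lambda>s. \<alpha> / (1 + s) powr lam) has_real_derivative - lam * (\<alpha> / (1 + t) powr (lam + 1))) (at t)" for \<alpha> lam t :: real
proof -
  assume t: "0 < t"
  have 1: "((\<lambda>s. 1 + s) has_real_derivative 1) (at t)" by (auto intro!: derivative_eq_intros)
  have "((\<lambda>s. \<alpha> * (1 + s) powr (- lam)) has_real_derivative \<alpha> * (- lam * (1 + t) powr (- lam - 1) * 1)) (at t)"
    using t by (intro DERIV_cmult DERIV_chain2[OF has_real_derivative_powr 1]) auto
  moreover have "\<alpha> * (- lam * (1 + t) powr (- lam - 1) * 1) = - lam * (\<alpha> / (1 + t) powr (lam + 1))"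
    using powr_minus_divide[of "1 + t" "lam + 1"] by simp
  ultimately show ?thesis by (simp add: powr_minus_divide)
qed

context gas
begin

context
  fixes \<alpha> lam C0 :: real and \<tau>0 u0 :: "real \<Rightarrow> real"
  assumes alpha: "0 \<le> \<alpha>" and C0: "0 < C0"
    and data: "\<And>x. \<bar>u0 x\<bar> \<le> C0" "\<And>x. inverse C0 < \<tau>0 x"
begin

text \<open>A bound for \<open>\<bar>u0\<bar> + \<phi>\<close> at time \<open>0\<close>.\<close>

definition N0 :: real where "N0 = C0 + kphi * C0 powr ((\<gamma> - 1) / 2)"

lemma N0_pos: "0 < N0"
  unfolding N0_def using C0 gas_consts by (intro add_pos_nonneg) auto

context
  fixes T \<tau> u assumes sol: "damped_Euler_solution K \<gamma> \<alpha> lam \<tau>0 u0 T \<tau> u"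
begin

lemma sol_at: "(x, t) \<in> strip T \<Longrightarrow> solves_at K \<gamma> \<alpha> lam \<tau> u x t"
  and sol_init: "\<tau> x 0 = \<tau>0 x" "u x 0 = u0 x"
  and sol_T: "0 < T"
  using sol unfolding damped_Euler_solution_iff by auto

lemma rinv_init: "\<bar>rinv \<tau> u \<sigma> x 0\<bar> \<le> N0"
proof -
  have t0: "0 < \<tau>0 x" using data(2)[of x] C0 by (meson inverse_positive_iff_positive less_trans)
  have "\<tau>0 x powr (- ((\<gamma> - 1) / 2)) \<le> inverse C0 powr (- ((\<gamma> - 1) / 2))"
    using data(2)[of x] C0 gamma by (intro powr_mono2') auto
  also have "\<dots> = C0 powr ((\<gamma> - 1) / 2)" using C0 by (simp add: powr_minus inverse_powr)
  finally have "phi K \<gamma> \<tau> x 0 \<le> kphi * C0 powr ((\<gamma> - 1) / 2)"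
    unfolding phi_def kphi_def[symmetric] sol_init using gas_consts by (intro mult_left_mono) auto
  moreover have "0 < phi K \<gamma> \<tau> x 0" using phi_pos[of \<tau> x 0] t0 sol_init by simp
  ultimately show ?thesis
    using data(1)[of x] by (auto simp: rinv_def N0_def sg_def abs_le_iff sol_init)
qed

lemma rinv_bounded:
  assumes "(x, t) \<in> strip T"
  shows "\<bar>rinv \<tau> u \<sigma> x t\<bar> \<le> N0"
proof -
  have t: "0 \<le> t" "ereal t < T" using assms by (auto simp: strip_def)
  obtain T2 where T2: "ereal t < ereal T2" "ereal T2 < T" using ereal_dense2[OF t(2)] by blast
  have "\<bar>rinv \<tau> u \<sigma> x (0 + t)\<bar> \<le> N0"
  proof (rule riemann_bound[where v = "\<lambda>\<sigma> x s. rinv \<tau> u \<sigma> x (0 + s)" and T = T2 and c = sound and Lam = "sound (N0 + 1)"])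
    show "riemann_solution sound (\<lambda>s. \<alpha> / (1 + s) powr lam) T2 (\<lambda>\<sigma> x s. rinv \<tau> u \<sigma> x (0 + s)) (\<lambda>\<sigma> x s. rinv_x \<tau> u \<sigma> x (0 + s))"
      by (rule solution_riemann(1)[OF sol_at]) (use T2 in auto)
  qed (use sound_bound alpha rinv_init t T2 in auto)
  then show ?thesis by simp
qed

lemma phi_bounds:
  assumes "(x, t) \<in> strip T"
  shows "0 < phi K \<gamma> \<tau> x t" "phi K \<gamma> \<tau> x t \<le> N0"
  using sol_at[OF assms] phi_pos[of \<tau> x t] half_diff_bound[of "rinv \<tau> u" x t N0, OF rinv_bounded[OF assms]]
  by (auto simp: solves_at_def half_rinv)

end

lemma solutions_agree:
  assumes s1: "damped_Euler_solution K \<gamma> \<alpha> lam \<tau>0 u0 T1 \<tau>1 u1"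
    and s2: "damped_Euler_solution K \<gamma> \<alpha> lam \<tau>0 u0 T2 \<tau>2 u2"
    and p: "(x, t) \<in> strip T1" "(x, t) \<in> strip T2"
  shows "\<tau>1 x t = \<tau>2 x t" "u1 x t = u2 x t"
proof -
  have t: "0 \<le> t" "ereal t < min T1 T2" using p by (auto simp: strip_def)
  obtain T3 where T3: "ereal t < ereal T3" "ereal T3 < min T1 T2" using ereal_dense2[OF t(2)] by blast
  let ?a = "\<lambda>s. \<alpha> / (1 + s) powr lam"
  let ?v = "\<lambda>\<sigma> x s. rinv \<tau>1 u1 \<sigma> x (0 + s)" and ?w = "\<lambda>\<sigma> x s. rinv \<tau>2 u2 \<sigma> x (0 + s)"
  have T3': "ereal (0 + T3) \<le> T1" "ereal (0 + T3) \<le> T2" using T3 by auto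
  have in1: "(y, s) \<in> strip T1" "(y, s) \<in> strip T2" if "0 \<le> s" "s < T3" for y s
  proof -
    have "ereal s < ereal T3" using that by simp
    also have "ereal T3 < min T1 T2" by (rule T3)
    finally show "(y, s) \<in> strip T1" "(y, s) \<in> strip T2" using that by (auto simp: strip_def)
  qed
  obtain A where A: "0 \<le> A" "\<And>s. 0 \<le> s \<Longrightarrow> s \<le> t \<Longrightarrow> \<bar>?a s\<bar> \<le> A"
    using damping_bounded[where \<alpha> = \<alpha> and lam = lam and r = t] by metis
  define Lam where "Lam = sound N0"
  have Lam: "0 \<le> Lam" unfolding Lam_def using order_trans[OF abs_ge_zero sound_bound[of N0 N0]] N0_pos by simp
  have tT3: "t < T3" using T3 by simp
  have "\<exists>M. \<forall>y s. 0 \<le> s \<longrightarrow> s \<le> t \<longrightarrow> \<bar>y\<bar> + Lam * s \<le> \<bar>x\<bar> + Lam * t \<longrightarrow> \<bar>rinv_x \<tau>2 u2 \<sigma> y (0 + s)\<bar> \<le> M" for \<sigma>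
  proof -
    let ?C = "{-(\<bar>x\<bar> + Lam * t)..\<bar>x\<bar> + Lam * t} \<times> {0..t}"
    have "continuous_on (UNIV \<times> {0..<T3}) (\<lambda>(y, s). rinv_x \<tau>2 u2 \<sigma> y (0 + s))"
      by (rule solution_riemann(2)[OF sol_at[OF s2] _ T3'(2), where a = ?a]) auto
    then have "continuous_on ?C (\<lambda>(y, s). rinv_x \<tau>2 u2 \<sigma> y (0 + s))"
      by (rule continuous_on_subset) (use tT3 in auto)
    then have "bounded ((\<lambda>(y, s). rinv_x \<tau>2 u2 \<sigma> y (0 + s)) ` ?C)"
      by (intro compact_imp_bounded compact_continuous_image compact_Times) auto
    then obtain M where M: "\<forall>z\<in>(\<lambda>(y, s). rinv_x \<tau>2 u2 \<sigma> y (0 + s)) ` ?C. norm z \<le> M"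
      unfolding bounded_iff by blast
    have "\<bar>rinv_x \<tau>2 u2 \<sigma> y (0 + s)\<bar> \<le> M" if s: "0 \<le> s" "s \<le> t" "\<bar>y\<bar> + Lam * s \<le> \<bar>x\<bar> + Lam * t" for y s
    proof -
      have "0 \<le> Lam * s" using Lam s by simp
      then have "(y, s) \<in> ?C" using s by (auto simp: abs_le_iff)
      then have "(\<lambda>(y, s). rinv_x \<tau>2 u2 \<sigma> y (0 + s)) (y, s) \<in> (\<lambda>(y, s). rinv_x \<tau>2 u2 \<sigma> y (0 + s)) ` ?C"
        by (rule imageI)
      with M have "norm ((\<lambda>(y, s). rinv_x \<tau>2 u2 \<sigma> y (0 + s)) (y, s)) \<le> M" by (rule bspec)
      then show ?thesis by simp
    qed
    then show ?thesis by blast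
  qed
  then obtain M where M: "\<And>\<sigma> y s. 0 \<le> s \<Longrightarrow> s \<le> t \<Longrightarrow> \<bar>y\<bar> + Lam * s \<le> \<bar>x\<bar> + Lam * t \<Longrightarrow> \<bar>rinv_x \<tau>2 u2 \<sigma> y (0 + s)\<bar> \<le> M \<sigma>"
    by metis
  have M': "\<bar>rinv_x \<tau>2 u2 \<sigma> y (0 + s)\<bar> \<le> max (M True) (M False)" if "0 < s" "s \<le> t" "\<bar>y\<bar> + Lam * s \<le> \<bar>x\<bar> + Lam * t" for \<sigma> y s
    using M[of s y \<sigma>] that by (cases \<sigma>) auto
  have eq: "rinv \<tau>1 u1 \<sigma> x (0 + t) = rinv \<tau>2 u2 \<sigma> x (0 + t)" for \<sigma>
  proof (rule riemann_unique[where v = ?v and w = ?w and T = T3 and c = sound and Lam = Lam and N = N0 and L = "sound' N0" and A = A])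
    show "riemann_solution sound ?a T3 ?v (\<lambda>\<sigma> x s. rinv_x \<tau>1 u1 \<sigma> x (0 + s))"
      by (rule solution_riemann(1)[OF sol_at[OF s1] _ T3'(1)]) auto
    show "riemann_solution sound ?a T3 ?w (\<lambda>\<sigma> x s. rinv_x \<tau>2 u2 \<sigma> x (0 + s))"
      by (rule solution_riemann(1)[OF sol_at[OF s2] _ T3'(2)]) auto
    show "\<bar>rinv \<tau>1 u1 \<sigma> x (0 + s)\<bar> \<le> N0" if "0 \<le> s" "s < T3" for \<sigma> x s
      using rinv_bounded[OF s1 in1(1)[OF that]] by simp
    show "\<bar>rinv \<tau>2 u2 \<sigma> x (0 + s)\<bar> \<le> N0" if "0 \<le> s" "s < T3" for \<sigma> x s
      using rinv_bounded[OF s2 in1(2)[OF that]] by simp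
    show "\<bar>sound y\<bar> \<le> Lam" if "\<bar>y\<bar> \<le> N0" for y using sound_bound[OF that] by (simp add: Lam_def)
    show "\<bar>sound y - sound z\<bar> \<le> sound' N0 * \<bar>y - z\<bar>" if "\<bar>y\<bar> \<le> N0" "\<bar>z\<bar> \<le> N0" for y z
      using sound_lip[OF that] .
    show "rinv \<tau>1 u1 \<sigma> x (0 + 0) = rinv \<tau>2 u2 \<sigma> x (0 + 0)" for \<sigma> x
      by (simp add: rinv_def phi_def sol_init[OF s1] sol_init[OF s2])
    show "\<bar>?a s\<bar> \<le> A" if "0 < s" "s \<le> t" for s using A(2)[of s] that by simp
  qed (rule M' t tT3, assumption+ | rule t tT3)+
  then have eq: "rinv \<tau>1 u1 \<sigma> x t = rinv \<tau>2 u2 \<sigma> x t" for \<sigma> by simp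
  have "half_sum (rinv \<tau>1 u1) x t = half_sum (rinv \<tau>2 u2) x t" "half_diff (rinv \<tau>1 u1) x t = half_diff (rinv \<tau>2 u2) x t"
    using eq by (auto simp: half_sum_def half_diff_def)
  then have "u1 x t = u2 x t" "phi K \<gamma> \<tau>1 x t = phi K \<gamma> \<tau>2 x t" by (auto simp: half_rinv)
  moreover have "0 < \<tau>1 x t" "0 < \<tau>2 x t"
    using sol_at[OF s1 p(1)] sol_at[OF s2 p(2)] by (auto simp: solves_at_def)
  ultimately show "\<tau>1 x t = \<tau>2 x t" "u1 x t = u2 x t" using tau_of_phi by metis+
qed

text \<open>The data at a time \<open>t1\<close> before \<open>Ts\<close> satisfy bounds that do not depend on \<open>t1\<close>, so the solution
  started there has a life span \<open>d\<close> independent of \<open>t1\<close>; choose \<open>t1\<close> with \<open>Ts < t1 + d\<close>.  By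
  uniqueness it agrees with the given solution until \<open>Ts\<close>, so the two pieces fit
  together to a solution that reaches beyond \<open>Ts\<close>.\<close>

lemma bounded_gradient_extends:
  assumes sol: "damped_Euler_solution K \<gamma> \<alpha> lam \<tau>0 u0 (ereal Ts) \<tau> u" and Ts: "0 < Ts" "Ts \<le> 1"
    and h: "0 < h" and grad: "\<And>x t. Ts - h < t \<Longrightarrow> t < Ts \<Longrightarrow> 0 \<le> t \<Longrightarrow> \<bar>partial_x \<tau> x t\<bar> \<le> B \<and> \<bar>partial_x u x t\<bar> \<le> B"
  shows "\<exists>T' \<tau>' u'. ereal Ts < T' \<and> damped_Euler_solution K \<gamma> \<alpha> lam \<tau>0 u0 T' \<tau>' u' \<and>
     agree_on_strip (ereal Ts) \<tau> u \<tau>' u'"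
proof -
  have B0: "0 \<le> B"
  proof -
    define t where "t = max (Ts / 2) (Ts - h / 2)"
    have "Ts - h < t" "t < Ts" "0 \<le> t" using Ts h by (auto simp: t_def)
    from grad[OF this, of 0] show ?thesis by linarith
  qed
  define N where "N = N0"
  define Lam where "Lam = sound (N + 1)"
  define L where "L = sound' (N + 1)"
  define M where "M = B + Lam * B"
  have N: "0 < N" using N0_pos by (simp add: N_def)
  have Lam0: "0 \<le> Lam" unfolding Lam_def using order_trans[OF abs_ge_zero sound_bound[of "N + 1" "N + 1"]] N by simp
  obtain A where A: "0 \<le> A" "\<And>s. 0 \<le> s \<Longrightarrow> s \<le> 2 \<Longrightarrow> \<bar>\<alpha> / (1 + s) powr lam\<bar> \<le> A"
    using damping_bounded[where \<alpha> = \<alpha> and lam = lam and r = 2] by metis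
  obtain d where d: "0 < d" "exp (L * (2 * M + 1) * d) \<le> 2" "2 * d * A * (2 * M + 1) \<le> 1"
    "d * A * (N + 1) \<le> 1"
    "M * (2 * L * d) + d * A * (1 + (2 * M + 1) * (2 * L * d)) \<le> 1/2"
    "d * (A + 2 * L * (2 * M + 1)) \<le> 1/2"
    using existence_time[of L M A N] by metis
  define t1 where "t1 = Max {Ts / 2, Ts - h / 2, Ts - d / 2}"
  have t1: "0 < t1" "t1 < Ts" "Ts - h < t1" "Ts < t1 + d"
  proof -
    have "Ts / 2 \<le> t1" "Ts - h / 2 \<le> t1" "Ts - d / 2 \<le> t1" unfolding t1_def by (intro Max_ge; simp)+
    then show "0 < t1" "Ts - h < t1" "Ts < t1 + d" using Ts h d by auto
    show "t1 < Ts" unfolding t1_def using Ts h d by (subst Max_less_iff) auto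
  qed
  have in_strip: "(x, t) \<in> strip (ereal Ts)" if "0 \<le> t" "t < Ts" for x t using that by (simp add: strip_def)
  have at1: "solves_at K \<gamma> \<alpha> lam \<tau> u x t1" for x using sol_at[OF sol in_strip] t1 by simp
  \<comment> \<open>the damping coefficient is needed on the whole line with a bound independent of
    \<open>t1\<close>; up to time \<open>2\<close> nothing is changed\<close>
  define a where "a s = \<alpha> / (1 + max 0 (min (t1 + s) 2)) powr lam" for s
  have a_eq: "a s = \<alpha> / (1 + (t1 + s)) powr lam" if "0 < s" "t1 + s \<le> 2" for s
    using that t1 by (simp add: a_def max_def min_def)
  have a_cont: "continuous_on UNIV a"
    unfolding a_def by (rule continuous_on_compose2[OF damping_cont]) (auto intro!: continuous_intros)
  have a_A: "\<bar>a s\<bar> \<le> A" for s unfolding a_def by (rule A(2)) auto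
  define v0 where "v0 \<sigma> x = rinv \<tau> u \<sigma> x t1" for \<sigma> x
  define v0' where "v0' \<sigma> x = rinv_x \<tau> u \<sigma> x t1" for \<sigma> x
  have t1s: "0 \<le> t1" using t1 by simp
  have Tm: "ereal (t1 + (Ts - t1)) \<le> ereal Ts" by simp
  have old_a: "a s = \<alpha> / (1 + (t1 + s)) powr lam" if "0 < s" "s < Ts - t1" for s
    using a_eq that Ts by simp
  note old = solution_riemann[OF sol_at[OF sol] t1s Tm old_a]
  interpret cauchy_data sound sound' a v0 v0' N M A L Lam d
  proof
    show "(sound has_real_derivative sound' y) (at y)" for y by (rule sound_deriv)
    show "continuous_on UNIV sound'" by (rule sound'_cont)
    show "(v0 \<sigma> has_real_derivative v0' \<sigma> x) (at x)" for \<sigma> x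
      unfolding v0_def[abs_def] v0'_def by (rule rinv_derivs(1)[OF at1])
    show "continuous_on UNIV (v0' \<sigma>)" for \<sigma>
    proof -
      have "continuous_on UNIV (\<lambda>x. case (x, 0) of (x, s) \<Rightarrow> rinv_x \<tau> u \<sigma> x (t1 + s))"
        by (rule continuous_on_compose2[OF old(2)]) (use t1 in \<open>auto intro!: continuous_intros\<close>)
      then show ?thesis by (simp add: v0'_def[abs_def])
    qed
    show "\<bar>sound y\<bar> \<le> Lam" "\<bar>sound' y\<bar> \<le> L" if "\<bar>y\<bar> \<le> N + 1" for y
      using sound_bound[OF that] sound'_bound[OF that] by (auto simp: Lam_def L_def)
    show "\<bar>v0 \<sigma> x\<bar> \<le> N" for \<sigma> x
      unfolding v0_def N_def by (rule rinv_bounded[OF sol in_strip]) (use t1 in auto)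
    show "\<bar>v0' \<sigma> x\<bar> \<le> M" for \<sigma> x
    proof -
      have g: "\<bar>partial_x \<tau> x t1\<bar> \<le> B" "\<bar>partial_x u x t1\<bar> \<le> B" using grad[of t1 x] t1 by auto
      have "\<bar>phi K \<gamma> \<tau> x t1\<bar> \<le> N + 1"
        using phi_bounds[OF sol in_strip, of t1 x] t1 by (simp add: N_def)
      then have "\<bar>sound (phi K \<gamma> \<tau> x t1) * partial_x \<tau> x t1\<bar> \<le> Lam * B"
        unfolding abs_mult Lam_def using g sound_bound[of "phi K \<gamma> \<tau> x t1" "N + 1"] B0
        by (intro mult_mono) auto
      then show ?thesis using g unfolding v0'_def rinv_x_def M_def by (cases \<sigma>) (auto simp: sg_def)
    qed
  qed (use a_cont a_A d in auto)
  obtain v vx where v: "\<And>\<sigma>. continuous_on (UNIV \<times> {0..}) (\<lambda>(x, t). v \<sigma> x t)"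
     "\<And>\<sigma> x t. \<bar>v \<sigma> x t\<bar> \<le> N + 1" "\<And>\<sigma> x. v \<sigma> x 0 = v0 \<sigma> x"
     "\<And>\<sigma>. continuous_on (UNIV \<times> {0<..<d}) (\<lambda>(x, t). vx \<sigma> x t)"
     "\<And>\<sigma> x t. t \<in> {0<..<d} \<Longrightarrow> \<bar>vx \<sigma> x t\<bar> \<le> 2 * M + 1 \<and>
        ((\<lambda>x. v \<sigma> x t) has_real_derivative vx \<sigma> x t) (at x) \<and>
        (v \<sigma> x has_real_derivative
           - a t * half_sum v x t - sg \<sigma> * sound (half_diff v x t) * vx \<sigma> x t) (at t)"
    using local_solution by metis
  have new: "riemann_solution sound a d' v vx" if "d' \<le> d" for d'
    unfolding riemann_solution_def
    using v(5) that by (auto intro: continuous_on_subset[OF v(1)] continuous_on_subset[OF v(4)])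
  have agree: "v \<sigma> x s = rinv \<tau> u \<sigma> x (t1 + s)" if s: "0 \<le> s" "s < Ts - t1" for \<sigma> x s
  proof -
    have "rinv \<tau> u \<sigma> x (t1 + s) = v \<sigma> x s"
    proof (rule riemann_unique[where v = "\<lambda>\<sigma> x s. rinv \<tau> u \<sigma> x (t1 + s)" and w = v and wx = vx and T = "Ts - t1" and c = sound
          and a = a and Lam = Lam and N = "N + 1" and L = L and A = A and M = "2 * M + 1"])
      show "riemann_solution sound a (Ts - t1) (\<lambda>\<sigma> x s. rinv \<tau> u \<sigma> x (t1 + s)) (\<lambda>\<sigma> x s. rinv_x \<tau> u \<sigma> x (t1 + s))"
        by (rule old(1))
      show "riemann_solution sound a (Ts - t1) v vx" by (rule new) (use t1 in simp)
      show "\<bar>rinv \<tau> u \<sigma> x (t1 + s)\<bar> \<le> N + 1" if "0 \<le> s" "s < Ts - t1" for \<sigma> x s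
        using rinv_bounded[OF sol in_strip[of "t1 + s" x], of \<sigma>] that t1 by (simp add: N_def)
      show "\<bar>sound y - sound z\<bar> \<le> L * \<bar>y - z\<bar>" if "\<bar>y\<bar> \<le> N + 1" "\<bar>z\<bar> \<le> N + 1" for y z
        unfolding L_def by (rule sound_lip[OF that])
      show "rinv \<tau> u \<sigma> x (t1 + 0) = v \<sigma> x 0" for \<sigma> x using v(3) by (simp add: v0_def)
      show "\<bar>vx \<sigma> y r\<bar> \<le> 2 * M + 1" if "0 < r" "r \<le> s" for \<sigma> y r
        using v(5)[of r \<sigma> y] that s t1 by simp
      show "\<bar>sound y\<bar> \<le> Lam" if "\<bar>y\<bar> \<le> N + 1" for y using sound_bound[OF that] by (simp add: Lam_def)
      show "\<bar>v \<sigma> x s\<bar> \<le> N + 1" for \<sigma> x s by (rule v(2))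
      show "\<bar>a r\<bar> \<le> A" for r by (rule a_A)
    qed (use s in auto)
    then show ?thesis by simp
  qed
  define d' where "d' = min d (2 - t1)"
  have d': "0 < d'" "d' \<le> d" "t1 + d' \<le> 2" "Ts < t1 + d'" using t1 Ts d by (auto simp: d'_def)
  have pos: "0 < half_diff v x s" if "0 < s" "s < d'" for x s
  proof (rule phi_stays_positive[OF new[OF d'(2)]])
    have "half_diff v x 0 = phi K \<gamma> \<tau> x t1"
      using v(3) by (simp add: half_diff_def v0_def rinv_def sg_def)
    then show "0 < half_diff v x 0" using phi_bounds(1)[OF sol in_strip] t1 by simp
    show "\<bar>v \<sigma> x s\<bar> \<le> N + 1" for \<sigma> x s by (rule v(2))
    show "\<bar>vx \<sigma> x s\<bar> \<le> 2 * M + 1" if "0 < s" "s < d'" for \<sigma> x s using v(5)[of s \<sigma> x] that d' by simp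
  qed (use that in auto)
  define \<tau>n where "\<tau>n x t = tau_of (half_diff v x (t - t1))" for x t
  define un where "un x t = half_sum v x (t - t1)" for x t
  have new_solves: "solves_at K \<gamma> \<alpha> lam \<tau>n un x t" if "t1 < t" "t < t1 + d'" for x t
    unfolding \<tau>n_def[abs_def] un_def[abs_def]
    by (rule riemann_to_gas[OF new[OF d'(2)] pos _ t1s that]) (use a_eq d' in auto)
  have same: "\<tau>n x t = \<tau> x t" "un x t = u x t" if t: "t1 \<le> t" "t < Ts" for x t
  proof -
    have "half_diff v x (t - t1) = half_diff (rinv \<tau> u) x t" "half_sum v x (t - t1) = half_sum (rinv \<tau> u) x t"
      using agree[of "t - t1" _ x] t by (auto simp: half_diff_def half_sum_def)
    moreover have "0 < \<tau> x t" using sol_at[OF sol in_strip, of t x] t t1 by (simp add: solves_at_def)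
    ultimately show "\<tau>n x t = \<tau> x t" "un x t = u x t"
      by (simp_all add: \<tau>n_def un_def half_rinv tau_of_phi)
  qed
  define \<tau>' where "\<tau>' x t = (if t < Ts then \<tau> x t else \<tau>n x t)" for x t
  define u' where "u' x t = (if t < Ts then u x t else un x t)" for x t
  have "solves_at K \<gamma> \<alpha> lam \<tau>' u' x t" if t: "0 \<le> t" "t < t1 + d'" for x t
  proof (cases "t < Ts")
    case True
    show ?thesis
      by (rule solves_at_cong[where U = "{..<Ts}", OF _ _ _ _ _ sol_at[OF sol in_strip[OF t(1) True]]])
        (use True t in \<open>auto simp: \<tau>'_def u'_def\<close>)
  next
    case False
    then have tt: "t1 < t" using t1 by simp
    show ?thesis
      by (rule solves_at_cong[where U = "{t1<..}", OF _ _ _ _ _ new_solves[OF tt t(2)]])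
        (use tt t same in \<open>auto simp: \<tau>'_def u'_def\<close>)
  qed
  then have "damped_Euler_solution K \<gamma> \<alpha> lam \<tau>0 u0 (ereal (t1 + d')) \<tau>' u'"
    unfolding damped_Euler_solution_iff using t1 d' Ts sol_init[OF sol]
    by (auto simp: strip_def \<tau>'_def u'_def)
  moreover have "agree_on_strip (ereal Ts) \<tau> u \<tau>' u'"
    by (auto simp: agree_on_strip_def strip_def \<tau>'_def u'_def)
  ultimately show ?thesis using d'(4) by (intro exI[of _ "ereal (t1 + d')"]) auto
qed

end
end


section \<open>Blow-up\<close>

text \<open>A nonempty open set has positive measure.\<close>

lemma esssup_le_imp_le:
  fixes f :: "real \<Rightarrow> real"
  assumes f: "continuous_on UNIV f" and le: "esssup lborel (\<lambda>x. ereal (f x)) \<le> ereal M"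
  shows "f x \<le> M"
proof (rule ccontr)
  assume "\<not> f x \<le> M"
  then have x: "x \<in> {x. M < f x}" by simp
  have op: "open {x. M < f x}" using f by (intro open_Collect_less continuous_intros)
  then obtain r where r: "0 < r" "ball x r \<subseteq> {x. M < f x}" using x by (rule openE)
  have meas: "{x. M < f x} \<in> sets lborel" using op by simp
  have "AE x in lborel. ereal (f x) \<le> esssup lborel (\<lambda>x. ereal (f x))" by (rule esssup_AE)
  then have "AE x in lborel. f x \<le> M" by eventually_elim (use le order_trans in fastforce)
  then have "emeasure lborel {x. M < f x} = 0"
    using AE_iff_measurable[of "{x. M < f x}" lborel "\<lambda>x. f x \<le> M"] meas by (simp add: not_le)
  moreover have "emeasure lborel {x - r<..<x + r} \<le> emeasure lborel {x. M < f x}"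
    by (rule emeasure_mono[OF _ meas]) (use r in \<open>auto simp: subset_iff dist_real_def abs_less_iff\<close>)
  moreover have "emeasure lborel {x - r<..<x + r} = ennreal (2 * r)" using r by simp
  ultimately show False using r by simp
qed

lemma gradient_Linf_bound:
  assumes C: "\<And>x. C1_at \<tau> x t" "\<And>x. C1_at u x t" and t: "0 \<le> t"
    and le: "gradient_Linf \<tau> u t \<le> ereal M"
  shows "\<bar>partial_x \<tau> x t\<bar> \<le> M \<and> \<bar>partial_x u x t\<bar> \<le> M"
proof -
  have c: "continuous_on UNIV (\<lambda>x. partial_x f x t)" if "\<And>x. C1_at f x t" for f
  proof -
    have "continuous_on (UNIV \<times> {t}) (\<lambda>(x, t). partial_x f x t)"
      unfolding continuous_on_eq_continuous_within
      using that t by (auto simp: C1_at_def intro: continuous_within_subset)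
    then have "continuous_on UNIV (\<lambda>x. case (x, t) of (x, t) \<Rightarrow> partial_x f x t)"
      by (rule continuous_on_compose2) (auto intro!: continuous_intros)
    then show ?thesis by simp
  qed
  have "norm (partial_x \<tau> x t, partial_x u x t) \<le> M"
    using le unfolding gradient_Linf_def
    by (rule esssup_le_imp_le[rotated]) (intro continuous_intros c C)
  then show ?thesis
    using norm_fst_le[of "partial_x \<tau> x t" "partial_x u x t"] norm_snd_le[of "partial_x u x t" "partial_x \<tau> x t"] by auto
qed

theorem theorem2p4:
  fixes K \<gamma> \<alpha> lam C0 :: real
  assumes "K > 0" and "\<gamma> > 3" and "\<alpha> \<ge> 0" and "lam \<noteq> 1" and "C0 > 0"
  shows "\<exists>K5 > 0. \<exists>K6 > 0.
    \<forall>(\<tau>0 :: real \<Rightarrow> real) (u0 :: real \<Rightarrow> real) (T :: ereal)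
      (\<tau> :: real \<Rightarrow> real \<Rightarrow> real) (u :: real \<Rightarrow> real \<Rightarrow> real).
      \<tau>0 C1_differentiable_on UNIV \<longrightarrow>
      u0 C1_differentiable_on UNIV \<longrightarrow>
      (\<forall>x. \<bar>u0 x\<bar> \<le> C0 \<and> inverse C0 < \<tau>0 x) \<longrightarrow>
      damped_Euler_solution K \<gamma> \<alpha> lam \<tau>0 u0 T \<tau> u \<longrightarrow>
      (\<exists>x0.
         partial_x u x0 0 + partial_x (phi K \<gamma> \<tau>) x0 0
           < K5 * phi K \<gamma> \<tau> x0 0 powr (- (2 / (\<gamma> - 1)))
             - K6 * phi K \<gamma> \<tau> x0 0 powr (- ((\<gamma> + 1) / (2 * (\<gamma> - 1)))) \<or>
         partial_x u x0 0 - partial_x (phi K \<gamma> \<tau>) x0 0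
           < K5 * phi K \<gamma> \<tau> x0 0 powr (- (2 / (\<gamma> - 1)))
             - K6 * phi K \<gamma> \<tau> x0 0 powr (- ((\<gamma> + 1) / (2 * (\<gamma> - 1))))) \<longrightarrow>
      blows_up_in_finite_time K \<gamma> \<alpha> lam \<tau>0 u0 T \<tau> u"
proof -
  interpret gas K \<gamma> by unfold_locales (use assms in auto)
  define N where "N = N0 C0"
  have N: "0 < N" unfolding N_def by (rule N0_pos[where ?\<tau>0.0 = "\<lambda>_. 2 * inverse C0" and ?u0.0 = "\<lambda>_. 0"]) (use assms in auto)
  obtain A where A: "0 \<le> A" "\<And>s. 0 \<le> s \<Longrightarrow> s \<le> 1 \<Longrightarrow> \<bar>\<alpha> / (1 + s) powr lam\<bar> \<le> A"
    using damping_bounded[where \<alpha> = \<alpha> and lam = lam and r = 1] by metis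
  obtain A2 where A2: "0 \<le> A2" "\<And>s. 0 \<le> s \<Longrightarrow> s \<le> 1 \<Longrightarrow> \<bar>\<alpha> / (1 + s) powr (lam + 1)\<bar> \<le> A2"
    using damping_bounded[where \<alpha> = \<alpha> and lam = "lam + 1" and r = 1] by metis
  have lamA2: "0 \<le> \<bar>lam\<bar> * A2" using A2(1) by simp
  obtain L0 where L0: "0 < L0" "\<And>a a' c v vx T x0 \<sigma>.
      bounded_flow \<kappa> m N A (\<bar>lam\<bar> * A2) c a a' T v vx \<Longrightarrow> 1/2 < T \<Longrightarrow>
      - L0 \<le> sqrt \<kappa> * half_diff v x0 0 powr (m/2) * vx \<sigma> x0 0"
    using gradient_catastrophe[OF gas_consts(4,1,2) N A(1) lamA2] by blast
  \<comment> \<open>after multiplication by \<open>\<phi>\<^bsup>m/2\<^esup>\<close> the hypothesis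
    reads \<open>\<phi>\<^bsup>m/2\<^esup> w\<^sub>x < \<phi>\<^bsup>1-m/2\<^esup> -
    K6\<close>, and \<open>\<phi>\<^bsup>1-m/2\<^esup>\<close> is bounded\<close>
  define K6 where "K6 = N powr (1 - m/2) + L0 / sqrt \<kappa>"
  have K6: "0 < K6" unfolding K6_def using L0(1) gas_consts by (intro add_nonneg_pos) auto
  show ?thesis
  proof (rule exI[of _ 1], rule conjI[OF zero_less_one], rule exI[of _ K6], rule conjI[OF K6], intro allI impI)
    fix \<tau>0 u0 :: "real \<Rightarrow> real" and T :: ereal and \<tau> u :: "real \<Rightarrow> real \<Rightarrow> real"
    assume dat: "\<forall>x. \<bar>u0 x\<bar> \<le> C0 \<and> inverse C0 < \<tau>0 x"
      and sol: "damped_Euler_solution K \<gamma> \<alpha> lam \<tau>0 u0 T \<tau> u"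
      and "\<exists>x0. partial_x u x0 0 + partial_x (phi K \<gamma> \<tau>) x0 0
           < 1 * phi K \<gamma> \<tau> x0 0 powr (- (2 / (\<gamma> - 1)))
             - K6 * phi K \<gamma> \<tau> x0 0 powr (- ((\<gamma> + 1) / (2 * (\<gamma> - 1)))) \<or>
         partial_x u x0 0 - partial_x (phi K \<gamma> \<tau>) x0 0
           < 1 * phi K \<gamma> \<tau> x0 0 powr (- (2 / (\<gamma> - 1)))
             - K6 * phi K \<gamma> \<tau> x0 0 powr (- ((\<gamma> + 1) / (2 * (\<gamma> - 1))))"
    have D: "0 \<le> \<alpha>" "0 < C0" "\<And>x. \<bar>u0 x\<bar> \<le> C0" "\<And>x. inverse C0 < \<tau>0 x" using assms dat by auto
    note bound = phi_bounds[OF D, folded N_def] and s_at = sol_at[OF D] and s_init = sol_init[OF D]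
      and agree = solutions_agree[OF D]
    have strip0: "(x, 0) \<in> strip T'" if "0 < T'" for x T' using that by (simp add: strip_def zero_ereal_def)
    obtain x0 \<sigma> where x0: "partial_x u x0 0 + sg \<sigma> * partial_x (phi K \<gamma> \<tau>) x0 0
           < phi K \<gamma> \<tau> x0 0 powr (- (2 / (\<gamma> - 1)))
             - K6 * phi K \<gamma> \<tau> x0 0 powr (- ((\<gamma> + 1) / (2 * (\<gamma> - 1))))"
    proof -
      from \<open>\<exists>x0. _ x0\<close> obtain x0 where "partial_x u x0 0 + partial_x (phi K \<gamma> \<tau>) x0 0
           < 1 * phi K \<gamma> \<tau> x0 0 powr (- (2 / (\<gamma> - 1)))
             - K6 * phi K \<gamma> \<tau> x0 0 powr (- ((\<gamma> + 1) / (2 * (\<gamma> - 1)))) \<or>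
         partial_x u x0 0 - partial_x (phi K \<gamma> \<tau>) x0 0
           < 1 * phi K \<gamma> \<tau> x0 0 powr (- (2 / (\<gamma> - 1)))
             - K6 * phi K \<gamma> \<tau> x0 0 powr (- ((\<gamma> + 1) / (2 * (\<gamma> - 1))))" by blast
      then show ?thesis using that[of x0 True] that[of x0 False] by (auto simp: sg_def)
    qed
    have T0: "0 < T" using sol_T[OF D sol] .
    have steep: "sqrt \<kappa> * phi K \<gamma> \<tau> x0 0 powr (m/2) * rinv_x \<tau> u \<sigma> x0 0 < - L0"
    proof -
      let ?p = "phi K \<gamma> \<tau> x0 0"
      have p: "0 < ?p" "?p \<le> N" using bound[OF sol strip0[OF T0]] by auto
      have e: "2 / (\<gamma> - 1) = m - 1" "(\<gamma> + 1) / (2 * (\<gamma> - 1)) = m / 2"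
        using assms(2) by (auto simp: m_def field_simps)
      have "rinv_x \<tau> u \<sigma> x0 0 < ?p powr (- (m - 1)) - K6 * ?p powr (- (m/2))"
        using x0 rinv_derivs(3)[OF s_at[OF sol strip0[OF T0]]] unfolding e by simp
      then have "?p powr (m/2) * rinv_x \<tau> u \<sigma> x0 0 < ?p powr (m/2) * (?p powr (- (m - 1)) - K6 * ?p powr (- (m/2)))"
        using p by (intro mult_strict_left_mono) auto
      also have "\<dots> = ?p powr (m/2 + (- (m - 1))) - K6 * ?p powr (m/2 + (- (m/2)))"
        unfolding powr_add by (simp add: algebra_simps)
      also have "\<dots> = ?p powr (1 - m/2) - K6"
      proof -
        have "m/2 + (- (m - 1)) = 1 - m/2" "m/2 + (- (m/2)) = 0" by (simp_all add: field_simps)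
        then show ?thesis using p by (simp only: powr_zero_eq_one) simp
      qed
      also have "\<dots> \<le> N powr (1 - m/2) - K6"
        using p gas_consts by (intro diff_right_mono powr_mono2) auto
      also have "\<dots> = - (L0 / sqrt \<kappa>)" by (simp add: K6_def)
      finally have "sqrt \<kappa> * (?p powr (m/2) * rinv_x \<tau> u \<sigma> x0 0) < sqrt \<kappa> * - (L0 / sqrt \<kappa>)"
        using gas_consts by (intro mult_strict_left_mono) auto
      then show ?thesis using gas_consts by (simp add: mult.assoc)
    qed
    have short: "T' \<le> ereal (1/2)" if s': "damped_Euler_solution K \<gamma> \<alpha> lam \<tau>0 u0 T' \<tau>' u'" for T' \<tau>' u'
    proof (rule ccontr)
      assume "\<not> T' \<le> ereal (1/2)"
      then have "ereal (1/2) < T'" by simp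
      then obtain T2 where T2: "ereal (1/2) < ereal T2" "ereal T2 < T'" using ereal_dense2 by blast
      have T2': "1/2 < T2" "ereal (0 + T2) \<le> T'" using T2 by auto
      have T'0: "0 < T'" using sol_T[OF D s'] .
      let ?a = "\<lambda>s. \<alpha> / (1 + s) powr lam"
      have ain: "?a s = \<alpha> / (1 + (0 + s)) powr lam" for s by simp
      note R = solution_riemann[OF s_at[OF s'] order_refl T2'(2) ain]
      have eq0: "(\<lambda>y. \<tau>' y 0) = (\<lambda>y. \<tau> y 0)" "(\<lambda>y. u' y 0) = (\<lambda>y. u y 0)"
        using s_init[OF s'] s_init[OF sol] by auto
      have "rinv_x \<tau>' u' \<sigma> x0 0 = rinv_x \<tau> u \<sigma> x0 0" "phi K \<gamma> \<tau>' x0 0 = phi K \<gamma> \<tau> x0 0"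
        using eq0 fun_cong[OF eq0(1), of x0] by (simp_all add: rinv_x_def partial_x_def phi_def)
      moreover have flow: "bounded_flow \<kappa> m N A (\<bar>lam\<bar> * A2) sound ?a (\<lambda>t. - lam * (\<alpha> / (1 + t) powr (lam + 1))) T2
            (\<lambda>\<sigma> x s. rinv \<tau>' u' \<sigma> x (0 + s)) (\<lambda>\<sigma> x s. rinv_x \<tau>' u' \<sigma> x (0 + s))"
      proof -
        have phi: "0 < half_diff (\<lambda>\<sigma> x s. rinv \<tau>' u' \<sigma> x (0 + s)) x t \<and> half_diff (\<lambda>\<sigma> x s. rinv \<tau>' u' \<sigma> x (0 + s)) x t \<le> N"
          if t: "t \<in> {0..<T2}" for x t
        proof -
          have "ereal t < ereal T2" using t by simp
          also note T2(2)
          finally have "(x, t) \<in> strip T'" using t by (simp add: strip_def)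
          from bound[OF s' this] show ?thesis by (simp add: half_diff_def rinv_def sg_def)
        qed
        have a_cont: "continuous_on {0..<T2} ?a" by (rule continuous_on_subset[OF damping_cont]) auto
        have a': "(?a has_real_derivative - lam * (\<alpha> / (1 + t) powr (lam + 1))) (at t) \<and>
            \<bar>- lam * (\<alpha> / (1 + t) powr (lam + 1))\<bar> \<le> \<bar>lam\<bar> * A2" if t: "t \<in> {0<..<1/2}" for t
        proof -
          have "\<bar>- lam * (\<alpha> / (1 + t) powr (lam + 1))\<bar> \<le> \<bar>lam\<bar> * A2"
            unfolding abs_mult abs_minus_cancel using A2(2)[of t] t by (intro mult_left_mono) auto
          moreover have "0 < t" using t by simp
          ultimately show ?thesis using damping_deriv by blast
        qed
        have aA: "0 \<le> ?a t \<and> ?a t \<le> A" if "t \<in> {0..<1/2}" for t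
          using A(2)[of t] assms(3) that by simp
        show ?thesis
          unfolding bounded_flow_def
        proof (intro conjI allI impI ballI)
          fix \<sigma> x t assume "t \<in> {0..<T2}"
          then have t: "0 \<le> t" "t < T2" by auto
          show "((\<lambda>x. rinv \<tau>' u' \<sigma> x (0 + t)) has_real_derivative rinv_x \<tau>' u' \<sigma> x (0 + t)) (at x)"
            by (rule R(3)) (use t in auto)
        qed (rule R(1), assumption | rule R(2), assumption | rule sound_pos, assumption | rule a_cont
            | rule conjunct1[OF phi], assumption | rule conjunct2[OF phi], assumption
            | rule conjunct1[OF a'], assumption | rule conjunct2[OF a'], assumption
            | rule conjunct1[OF aA], assumption | rule conjunct2[OF aA], assumption)+
      qed
      moreover have "half_diff (\<lambda>\<sigma> x s. rinv \<tau>' u' \<sigma> x (0 + s)) x0 0 = phi K \<gamma> \<tau>' x0 0"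
        by (simp add: half_diff_def rinv_def sg_def)
      ultimately show False using steep L0(2)[OF flow T2'(1), of x0 \<sigma>] by simp
    qed
    \<comment> \<open>the life spans of all solutions with these data\<close>
    define S where "S = {T'. \<exists>\<tau>' u'. damped_Euler_solution K \<gamma> \<alpha> lam \<tau>0 u0 T' \<tau>' u'}"
    have TS: "T \<in> S" using sol by (auto simp: S_def)
    have T_le: "T \<le> Sup S" using TS by (rule Sup_upper)
    moreover have "0 < Sup S" using T0 T_le by (rule less_le_trans)
    moreover have "Sup S \<le> ereal (1/2)" using short by (intro Sup_least) (auto simp: S_def)
    ultimately obtain Ts where Ts: "Sup S = ereal Ts" "0 < Ts" "Ts \<le> 1/2" "T \<le> ereal Ts"
      using T0 by (cases "Sup S") auto
    have "\<exists>T' \<tau>' u'. damped_Euler_solution K \<gamma> \<alpha> lam \<tau>0 u0 T' \<tau>' u' \<and> ereal t < T'" if "t < Ts" for t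
    proof -
      have "ereal t < Sup S" using that Ts by simp
      then show ?thesis unfolding less_Sup_iff S_def by blast
    qed
    then obtain TT \<tau>\<tau> uu where pick: "\<And>t. t < Ts \<Longrightarrow> damped_Euler_solution K \<gamma> \<alpha> lam \<tau>0 u0 (TT t) (\<tau>\<tau> t) (uu t) \<and> ereal t < TT t"
      by metis
    define \<tau>s where "\<tau>s x t = \<tau>\<tau> t x t" for x t
    define us where "us x t = uu t x t" for x t
    have le_Ts: "t < Ts" if "damped_Euler_solution K \<gamma> \<alpha> lam \<tau>0 u0 T' \<tau>' u'" "(x, t) \<in> strip T'" for T' \<tau>' u' x t
    proof -
      have "T' \<le> Sup S" using that(1) by (intro Sup_upper) (auto simp: S_def)
      moreover have "ereal t < T'" using that(2) by (simp add: strip_def)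
      ultimately show ?thesis using Ts(1) by (metis less_ereal.simps(1) less_le_trans)
    qed
    have same: "\<tau>s x t = \<tau>' x t" "us x t = u' x t"
      if s': "damped_Euler_solution K \<gamma> \<alpha> lam \<tau>0 u0 T' \<tau>' u'" and p: "(x, t) \<in> strip T'" for T' \<tau>' u' x t
    proof -
      note P = pick[OF le_Ts[OF s' p]]
      have "(x, t) \<in> strip (TT t)" using P p by (simp add: strip_def)
      from agree[OF conjunct1[OF P] s' this p] show "\<tau>s x t = \<tau>' x t" "us x t = u' x t"
        by (simp_all add: \<tau>s_def us_def)
    qed
    have s_sol: "damped_Euler_solution K \<gamma> \<alpha> lam \<tau>0 u0 (ereal Ts) \<tau>s us"
      unfolding damped_Euler_solution_iff
    proof (intro conjI allI impI)
      show "0 < ereal Ts" using Ts by simp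
      fix x t assume "(x, t) \<in> strip (ereal Ts)"
      then have t: "0 \<le> t" "t < Ts" by (auto simp: strip_def)
      note P = pick[OF t(2)]
      have "solves_at K \<gamma> \<alpha> lam (\<tau>\<tau> t) (uu t) x t"
        using s_at[OF conjunct1[OF P], of x t] P t by (simp add: strip_def)
      then show "solves_at K \<gamma> \<alpha> lam \<tau>s us x t"
      proof (rule solves_at_cong[where U = "{s. ereal s < TT t}", rotated -1])
        fix y s assume "s \<in> {s. ereal s < TT t}" "0 \<le> s"
        then have "(y, s) \<in> strip (TT t)" by (simp add: strip_def)
        from same[OF conjunct1[OF P] this] show "\<tau>s y s = \<tau>\<tau> t y s" "us y s = uu t y s" by auto
      qed (use P t open_less_ereal in auto)
    next
      fix x show "\<tau>s x 0 = \<tau>0 x" "us x 0 = u0 x"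
        using same[OF sol strip0[OF T0]] s_init[OF sol] by auto
    qed
    have no_longer: False if "ereal Ts < T'" "damped_Euler_solution K \<gamma> \<alpha> lam \<tau>0 u0 T' \<tau>' u'" for T' \<tau>' u'
    proof -
      have "T' \<le> Sup S" using that(2) by (intro Sup_upper) (auto simp: S_def)
      then show False using that(1) Ts(1) by simp
    qed
    show "blows_up_in_finite_time K \<gamma> \<alpha> lam \<tau>0 u0 T \<tau> u"
      unfolding blows_up_in_finite_time_def
    proof (intro exI conjI)
      show "T \<le> ereal Ts" by (rule Ts(4))
      show "agree_on_strip T \<tau> u \<tau>s us"
        using same[OF sol] by (auto simp: agree_on_strip_def)
      show "maximal_damped_Euler_solution K \<gamma> \<alpha> lam \<tau>0 u0 (ereal Ts) \<tau>s us"
        unfolding maximal_damped_Euler_solution_def using s_sol no_longer by blast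
      show "\<not> (\<exists>M. \<forall>\<^sub>F t in at_left Ts. gradient_Linf \<tau>s us t \<le> ereal M)"
      proof
        assume "\<exists>M. \<forall>\<^sub>F t in at_left Ts. gradient_Linf \<tau>s us t \<le> ereal M"
        then obtain M b where M: "b < Ts" "\<And>t. b < t \<Longrightarrow> t < Ts \<Longrightarrow> gradient_Linf \<tau>s us t \<le> ereal M"
          unfolding eventually_at_left_field by blast
        have grad: "\<bar>partial_x \<tau>s x t\<bar> \<le> M \<and> \<bar>partial_x us x t\<bar> \<le> M" if t: "Ts - (Ts - b) < t" "t < Ts" "0 \<le> t" for x t
        proof (rule gradient_Linf_bound[OF _ _ t(3)])
          show "C1_at \<tau>s x t" "C1_at us x t" for x
            using s_at[OF s_sol, of x t] t by (auto simp: solves_at_def strip_def)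
          show "gradient_Linf \<tau>s us t \<le> ereal M" using M(2)[of t] t by simp
        qed
        have "0 < Ts - b" "Ts \<le> 1" using M(1) Ts by auto
        from bounded_gradient_extends[OF D s_sol Ts(2) this(2,1) grad] no_longer show False by blast
      qed
    qed
  qed
qed

end
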